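(* Let $k$ be an algebraically closed field whose characteristic is not $2$, $3$, or $5$, and let $R=k\llbracket x,y,z\rrbracket/(z^2+x^3+y^5)$. Then $\tau_{MCM}(R)=(x,y^2,z)$.
   Context: All rings are commutative, unital, Noetherian and local. A maximal Cohen-Macaulay (MCM) module over a ring $R$ is a finitely generated (nonzero) $R$-module $M$ such that the length of the longest regular sequence on $M$ equals the Krull dimension of $R$; a sequence $x_1,\ldots,x_n$ in $R$ is regular on $M$ if $(x_1,\ldots,x_n)M\ne M$, $x_1$ is a non-zerodivisor on $M$, and $x_i$ is a non-zerodivisor on $M/(x_1,\ldots,x_{i-1})M$ for $2\le i\le n$. For an $R$-module $M$ and $R$-modules $A\subseteq B$, let $A_B^{\mathrm{cl}_M}=\{b\in B : x\otimes b\in \operatorname{im}(M\otimes_R A\to M\otimes_R B)\text{ for all }x\in M\}$. The test ideal of $R$ associated to $M$ is $\tau_M(R)=\bigcap_{A\subseteq B}(A:_R A_B^{\mathrm{cl}_M})$, the intersection over all pairs of $R$-modules $A\subseteq B$. By a known theorem, when $R$ is local and $M$ is finitely generated, $\tau_M(R)$ equals the trace ideal $\sum_{f\in\operatorname{Hom}_R(M,R)}f(M)$, and $\tau_M(R)$ denotes this common ideal. $\tau_{MCM}(R)=\bigcap_M \tau_M(R)$, the intersection over all isomorphism classes of maximal Cohen-Macaulay $R$-modules $M$. *)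

theory Defs
  imports "HOL-Algebra.Algebra" "HOL-Algebra.Algebraic_Closure_Type"
    "HOL-Computational_Algebra.Formal_Power_Series" "HOL-Library.Extended_Nat"
begin

section \<open>Modules\<close>

definition gen_submodule ::
    "('a, 'c) ring_scheme \<Rightarrow> ('a, 'm, 'd) module_scheme \<Rightarrow> 'm set \<Rightarrow> 'm set"
  where "gen_submodule R M S = \<Inter>{N. submodule N R M \<and> S \<subseteq> N}"

definition fin_gen ::
    "('a, 'c) ring_scheme \<Rightarrow> ('a, 'm, 'd) module_scheme \<Rightarrow> bool"
  where "fin_gen R M \<longleftrightarrow>
    (\<exists>S. finite S \<and> S \<subseteq> carrier M \<and> gen_submodule R M S = carrier M)"

definition ideal_smult ::
    "('a, 'c) ring_scheme \<Rightarrow> 'a set \<Rightarrow> ('a, 'm, 'd) module_scheme \<Rightarrow> 'm set"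
  where "ideal_smult R I M = gen_submodule R M {a \<odot>\<^bsub>M\<^esub> m | a m. a \<in> I \<and> m \<in> carrier M}"

definition module_hom ::
    "('a, 'c) ring_scheme \<Rightarrow> ('a, 'm, 'd) module_scheme \<Rightarrow> ('a, 'n, 'e) module_scheme
      \<Rightarrow> ('m \<Rightarrow> 'n) set"
  where "module_hom R M N = {f \<in> carrier M \<rightarrow> carrier N.
    (\<forall>u\<in>carrier M. \<forall>v\<in>carrier M. f (u \<oplus>\<^bsub>M\<^esub> v) = f u \<oplus>\<^bsub>N\<^esub> f v) \<and>
    (\<forall>a\<in>carrier R. \<forall>u\<in>carrier M. f (a \<odot>\<^bsub>M\<^esub> u) = a \<odot>\<^bsub>N\<^esub> f u)}"

definition regular_module :: "('a, 'c) ring_scheme \<Rightarrow> ('a, 'a) module"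
  where "regular_module R = \<lparr>carrier = carrier R, monoid.mult = monoid.mult R, one = one R,
    ring.zero = ring.zero R, ring.add = ring.add R, module.smult = monoid.mult R\<rparr>"


section \<open>Maximal Cohen-Macaulay modules\<close>

definition krull_dim :: "('a, 'c) ring_scheme \<Rightarrow> enat"
  where "krull_dim R = (SUP n \<in> {n. \<exists>P :: nat \<Rightarrow> 'a set.
    (\<forall>i\<le>n. primeideal (P i) R) \<and> (\<forall>i<n. P i \<subset> P (Suc i))}. enat n)"

text \<open>That \<open>x\<close> is a non-zerodivisor on \<open>M/N\<close> is written out on representatives:
  \<open>x \<odot> m \<in> N\<close> implies \<open>m \<in> N\<close>.  For the first element of the sequence
  \<open>N\<close> is the zero submodule.\<close>

definition regular_sequence ::
    "('a, 'c) ring_scheme \<Rightarrow> ('a, 'm, 'd) module_scheme \<Rightarrow> 'a list \<Rightarrow> bool"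
  where "regular_sequence R M xs \<longleftrightarrow>
    set xs \<subseteq> carrier R \<and>
    ideal_smult R (Idl\<^bsub>R\<^esub> (set xs)) M \<noteq> carrier M \<and>
    (\<forall>i<length xs. \<forall>m\<in>carrier M.
      xs ! i \<odot>\<^bsub>M\<^esub> m \<in> ideal_smult R (Idl\<^bsub>R\<^esub> (set (take i xs))) M
        \<longrightarrow> m \<in> ideal_smult R (Idl\<^bsub>R\<^esub> (set (take i xs))) M)"

definition module_depth ::
    "('a, 'c) ring_scheme \<Rightarrow> ('a, 'm, 'd) module_scheme \<Rightarrow> enat"
  where "module_depth R M = (SUP xs \<in> {xs. regular_sequence R M xs}. enat (length xs))"

definition maximal_CM ::
    "('a, 'c) ring_scheme \<Rightarrow> ('a, 'm, 'd) module_scheme \<Rightarrow> bool"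
  where "maximal_CM R M \<longleftrightarrow>
    module R M \<and> fin_gen R M \<and> carrier M \<noteq> {\<zero>\<^bsub>M\<^esub>} \<and> module_depth R M = krull_dim R"


section \<open>Test ideals\<close>

text \<open>For \<open>R\<close> local and \<open>M\<close> finitely generated, \<open>\<tau>\<^sub>M(R)\<close> denotes the common value of two
  ideals: the intersection of the colons \<open>A : A\<^sup>c\<^sup>l\<close> over all pairs of \<open>R\<close>-modules \<open>A \<subseteq> B\<close>, where
  \<open>A\<^sup>c\<^sup>l\<close> is the closure of \<open>A\<close> in \<open>B\<close> induced by \<open>M\<close>, and the trace ideal, the sum of \<open>f(M)\<close>
  over all \<open>R\<close>-linear \<open>f : M \<rightarrow> R\<close>.  The latter is used, as the former ranges over modules
  in all types.\<close>

definition test_ideal ::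
    "('a, 'c) ring_scheme \<Rightarrow> ('a, 'm, 'd) module_scheme \<Rightarrow> 'a set"
  where "test_ideal R M =
    Idl\<^bsub>R\<^esub> (\<Union>f\<in>module_hom R M (regular_module R). f ` carrier M)"

text \<open>The intersection over all isomorphism classes needs a type of representatives.
  Finitely generated modules are quotients of some \<open>R\<^sup>n\<close>, so they all have a copy
  whose elements are sets of coefficient vectors; see \<open>fin_gen_module_copy\<close> below.\<close>

definition test_ideal_MCM :: "('a, 'c) ring_scheme \<Rightarrow> 'a set"
  where "test_ideal_MCM R = carrier R \<inter>
    (\<Inter>M \<in> {M :: ('a, (nat \<Rightarrow> 'a) set) module. maximal_CM R M}. test_ideal R M)"

lemma fin_gen_module_copy:
  fixes R :: "('a, 'c) ring_scheme" and M :: "('a, 'm, 'd) module_scheme"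
  assumes "module R M" and "fin_gen R M"
  shows "\<exists>(N :: ('a, (nat \<Rightarrow> 'a) set) module) f.
    module R N \<and> f \<in> module_hom R M N \<and> bij_betw f (carrier M) (carrier N)"
proof -
  interpret M: module R M by fact
  obtain S where S: "finite S" "S \<subseteq> carrier M" "gen_submodule R M S = carrier M"
    using assms(2) unfolding fin_gen_def by blast
  obtain n and g :: "nat \<Rightarrow> 'm" where g: "S = g ` {..<n}"
    using S(1) by (metis finite_imp_nat_seg_image_inj_on lessThan_def)
  have gM: "g i \<in> carrier M" if "i < n" for i using that S(2) g by auto
  define L where "L c = (\<Oplus>\<^bsub>M\<^esub>i\<in>{..<n}. c i \<odot>\<^bsub>M\<^esub> g i)" for c
  define C where "C = {..<n} \<rightarrow> carrier R"
  have L_closed: "L c \<in> carrier M" if "c \<in> C" for c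
    unfolding L_def using that gM by (intro M.finsum_closed) (auto simp: C_def Pi_def)
  have L_add: "L (\<lambda>i. c i \<oplus>\<^bsub>R\<^esub> d i) = L c \<oplus>\<^bsub>M\<^esub> L d" if "c \<in> C" "d \<in> C" for c d
  proof -
    have "L c \<oplus>\<^bsub>M\<^esub> L d = (\<Oplus>\<^bsub>M\<^esub>i\<in>{..<n}. c i \<odot>\<^bsub>M\<^esub> g i \<oplus>\<^bsub>M\<^esub> d i \<odot>\<^bsub>M\<^esub> g i)"
      unfolding L_def using that gM
      by (intro M.finsum_addf [symmetric]) (auto simp: C_def Pi_def)
    also have "\<dots> = L (\<lambda>i. c i \<oplus>\<^bsub>R\<^esub> d i)"
      unfolding L_def using that gM
      by (intro M.M.finsum_cong') (auto simp: C_def Pi_def M.smult_l_distr)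
    finally show ?thesis by simp
  qed
  have L_smult: "L (\<lambda>i. a \<otimes>\<^bsub>R\<^esub> c i) = a \<odot>\<^bsub>M\<^esub> L c" if "a \<in> carrier R" "c \<in> C" for a c
  proof -
    have "a \<odot>\<^bsub>M\<^esub> L c = (\<Oplus>\<^bsub>M\<^esub>i\<in>{..<n}. a \<odot>\<^bsub>M\<^esub> (c i \<odot>\<^bsub>M\<^esub> g i))"
      unfolding L_def using that gM by (intro M.finsum_smult_ldistr) (auto simp: C_def Pi_def)
    also have "\<dots> = L (\<lambda>i. a \<otimes>\<^bsub>R\<^esub> c i)"
      unfolding L_def using that gM
      by (intro M.M.finsum_cong') (auto simp: C_def Pi_def M.smult_assoc1)
    finally show ?thesis by simp
  qed
  have sub: "submodule (L ` C) R M"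
  proof (rule M.submoduleI)
    show "L ` C \<subseteq> carrier M" using L_closed by auto
    have "L (\<lambda>_. \<zero>\<^bsub>R\<^esub>) = \<zero>\<^bsub>M\<^esub>"
      unfolding L_def using gM by (intro M.M.add.finprod_one_eqI) (auto)
    thus "\<zero>\<^bsub>M\<^esub> \<in> L ` C" by (force simp: C_def)
    show "a \<odot>\<^bsub>M\<^esub> x \<in> L ` C" if "a \<in> carrier R" "x \<in> L ` C" for a x
    proof -
      obtain c where c: "c \<in> C" "x = L c" using \<open>x \<in> L ` C\<close> by blast
      have "(\<lambda>i. a \<otimes>\<^bsub>R\<^esub> c i) \<in> C" using that c by (auto simp: C_def Pi_def)
      thus ?thesis using L_smult[OF that(1) c(1)] c(2) by (metis imageI)
    qed
    thus "\<ominus>\<^bsub>M\<^esub> x \<in> L ` C" if "x \<in> L ` C" for x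
      using that L_closed M.smult_l_minus[of "\<one>\<^bsub>R\<^esub>" x]
      by (metis M.R.a_inv_closed M.R.one_closed M.smult_one imageE)
    show "x \<oplus>\<^bsub>M\<^esub> y \<in> L ` C" if xy: "x \<in> L ` C" "y \<in> L ` C" for x y
    proof -
      obtain c d where cd: "c \<in> C" "x = L c" "d \<in> C" "y = L d" using xy by blast
      have "(\<lambda>i. c i \<oplus>\<^bsub>R\<^esub> d i) \<in> C" using cd by (auto simp: C_def Pi_def)
      thus ?thesis using L_add[OF cd(1,3)] cd by (metis imageI)
    qed
  qed
  have "S \<subseteq> L ` C"
  proof
    fix s assume "s \<in> S"
    then obtain j where j: "j < n" "s = g j" using g by auto
    have "L (\<lambda>i. if j = i then \<one>\<^bsub>R\<^esub> else \<zero>\<^bsub>R\<^esub>)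
        = (\<Oplus>\<^bsub>M\<^esub>i\<in>{..<n}. if j = i then g i else \<zero>\<^bsub>M\<^esub>)"
      unfolding L_def using gM by (intro M.M.finsum_cong') auto
    also have "\<dots> = s" using j gM by (subst M.M.finsum_singleton) auto
    finally show "s \<in> L ` C" by (force simp: C_def)
  qed
  hence surj: "carrier M \<subseteq> L ` C" using S(3) sub unfolding gen_submodule_def by auto

  define h where "h m = {c \<in> C. L c = m}" for m
  have inj: "inj_on h (carrier M)"
  proof (rule inj_onI)
    fix u v assume uv: "u \<in> carrier M" "v \<in> carrier M" "h u = h v"
    then obtain c where "c \<in> h u" using surj unfolding h_def by auto
    thus "u = v" using uv(3) unfolding h_def by auto
  qed
  define k where "k = the_inv_into (carrier M) h"
  have kh [simp]: "k (h m) = m" if "m \<in> carrier M" for m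
    using that inj unfolding k_def by (rule the_inv_into_f_f[rotated])
  define N :: "('a, (nat \<Rightarrow> 'a) set) module" where
    "N = \<lparr>carrier = h ` carrier M, monoid.mult = (\<lambda>_ _. {}), one = {}, ring.zero = h \<zero>\<^bsub>M\<^esub>,
      ring.add = (\<lambda>u v. h (k u \<oplus>\<^bsub>M\<^esub> k v)), module.smult = (\<lambda>a u. h (a \<odot>\<^bsub>M\<^esub> k u))\<rparr>"
  have "abelian_group N"
  proof (rule abelian_groupI)
    show "\<exists>y\<in>carrier N. y \<oplus>\<^bsub>N\<^esub> x = \<zero>\<^bsub>N\<^esub>" if xN: "x \<in> carrier N" for x
    proof -
      obtain u where u: "u \<in> carrier M" "x = h u" using xN by (auto simp: N_def)
      hence "h (\<ominus>\<^bsub>M\<^esub> u) \<oplus>\<^bsub>N\<^esub> x = \<zero>\<^bsub>N\<^esub>" by (simp add: N_def M.M.l_neg)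
      thus ?thesis using u by (intro bexI[of _ "h (\<ominus>\<^bsub>M\<^esub> u)"]) (auto simp: N_def)
    qed
  qed (auto simp: N_def M.M.a_assoc M.M.a_comm M.M.a_lcomm)
  hence "module R N"
    by (intro moduleI M.is_cring)
       (auto simp: N_def M.smult_l_distr M.smult_r_distr M.smult_assoc1)
  moreover have "h \<in> module_hom R M N" by (auto simp: module_hom_def N_def)
  moreover have "bij_betw h (carrier M) (carrier N)"
    using inj by (simp add: bij_betw_def N_def)
  ultimately show ?thesis by blast
qed


section \<open>The E8 hypersurface singularity\<close>

text \<open>\<open>k\<lbrakk>x,y,z\<rbrakk>\<close> is represented as \<open>k\<lbrakk>x\<rbrakk>\<lbrakk>y\<rbrakk>\<lbrakk>z\<rbrakk>\<close>: the coefficient of \<open>x\<^sup>a y\<^sup>b z\<^sup>c\<close> in \<open>f\<close> is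
  \<open>fps_nth (fps_nth (fps_nth f c) b) a\<close>.\<close>

type_synonym 'k fps3 = "'k fps fps fps"

lemma fps3_mult_nth:
  fixes f g :: "'k::comm_ring_1 fps3"
  shows "fps_nth (fps_nth (fps_nth (f * g) c) b) a =
    (\<Sum>l=0..c. \<Sum>j=0..b. \<Sum>i=0..a.
      fps_nth (fps_nth (fps_nth f l) j) i *
      fps_nth (fps_nth (fps_nth g (c - l)) (b - j)) (a - i))"
  by (simp add: fps_mult_nth fps_sum_nth)

abbreviation fps3_ring :: "'k::field fps3 ring"
  where "fps3_ring \<equiv> ring_of_type_algebra"

definition var_x :: "'k::field fps3" where "var_x = fps_const (fps_const fps_X)"
definition var_y :: "'k::field fps3" where "var_y = fps_const fps_X"
definition var_z :: "'k::field fps3" where "var_z = fps_X"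

definition E8_ideal :: "'k::field fps3 set"
  where "E8_ideal = PIdl\<^bsub>fps3_ring\<^esub> (var_z ^ 2 + var_x ^ 3 + var_y ^ 5)"

definition E8_ring :: "'k::field fps3 set ring"
  where "E8_ring = fps3_ring Quot E8_ideal"

definition E8_class :: "'k::field fps3 \<Rightarrow> 'k fps3 set"
  where "E8_class f = E8_ideal +>\<^bsub>fps3_ring\<^esub> f"

end

theory Submission
  imports Defs "HOL-Library.Product_Plus"
begin

text \<open>
  Let \<open>S\<close> be the power series ring in \<open>x\<close> and \<open>y\<close>, and \<open>g = x\<^sup>3 + y\<^sup>5\<close>.  Then \<open>R\<close> is free over \<open>S\<close> with
  basis \<open>1, z\<close>, where \<open>z\<^sup>2 = - g\<close>.  The test ideal of a module is its trace ideal, and both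
  inclusions come from reading a maximal Cohen-Macaulay (MCM) module as a square matrix over
  \<open>S\<close> whose square is \<open>- g\<close>.

  Every MCM module \<open>M\<close> is free over \<open>S\<close> (\<open>maximal_CM_basis\<close>), so \<open>z\<close> acts on it by a matrix
  \<open>\<phi>\<close> over \<open>S\<close> with \<open>\<phi>\<^sup>2 = - g\<close>.  If \<open>\<lambda>\<close> is an \<open>S\<close>-linear form on \<open>M\<close>, then \<open>m \<mapsto> \<lambda>(z m) + z \<lambda>(m)\<close>
  is \<open>R\<close>-linear; applied to coordinate forms and basis vectors this shows that the trace ideal
  contains all entries of \<open>\<phi> + z\<close>.  If some entry of \<open>\<phi>\<close> is a unit, the trace ideal is all
  of \<open>R\<close>.  Otherwise let \<open>A\<close>, \<open>B\<close>, \<open>C\<close> be the coefficient matrices of \<open>x\<close>, \<open>y\<close>, \<open>y\<^sup>2\<close> in \<open>\<phi>\<close>.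
  The part of degree 2 of \<open>\<phi>\<^sup>2 = - g\<close> says \<open>A\<^sup>2 = B\<^sup>2 = A B + B A = 0\<close>, so every combination of \<open>A\<close>
  and \<open>B\<close> has square zero and none is a nonzero multiple of the identity.  The coefficients
  up to degree 5 give \<open>A \<noteq> 0\<close>, forbid that \<open>B\<close> is a nonzero multiple of \<open>A\<close>, and if \<open>B = 0\<close>
  they force \<open>C\<close> to be nonzero, square-zero, anticommuting with \<open>A\<close> and not a multiple of \<open>A\<close>.
  So \<open>A, B, 1\<close> or \<open>A, C, 1\<close> are linearly independent.  Hence three entries of \<open>\<phi> + z\<close>,
  written as combinations of \<open>x, y, z\<close> or of \<open>x, y\<^sup>2, z\<close>, have a unit as coefficient
  determinant, and by Cramer's rule the trace ideal contains \<open>x\<close>, \<open>y\<^sup>2\<close> and \<open>z\<close>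
  (\<open>entries_generate\<close>, \<open>test_ideal_contains\<close>).

  Conversely, the matrix factorization of \<open>g\<close> with rows \<open>(y\<^sup>2, x)\<close> and \<open>(x\<^sup>2, - y\<^sup>3)\<close> makes \<open>S\<^sup>4\<close>
  an MCM module on which \<open>z\<close> acts with entries in \<open>(x, y\<^sup>2)\<close>.  For an \<open>R\<close>-linear
  \<open>f : M \<rightarrow> R\<close> the element \<open>z f(m) = f(z m)\<close> then lies in \<open>(x, y\<^sup>2) R\<close>.  Its coefficient at \<open>z\<close> is
  the \<open>S\<close>-part of \<open>f(m)\<close>, which therefore lies in \<open>(x, y\<^sup>2)\<close>, and so \<open>f(m) \<in> (x, y\<^sup>2, z)\<close>
  (\<open>quad_test_ideal\<close>).

  Being MCM refers to depth and dimension, so \<open>dim R = 2\<close> is needed as well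
  (\<open>krull_dim_E8\<close>).  The finiteness properties of \<open>S\<close> that enter, the dimension bound and a
  form of Krull's intersection theorem, are both deduced from Weierstrass division, which is
  plain long division in \<open>S\<close> seen as power series in \<open>y\<close> over the Euclidean ring of power
  series in \<open>x\<close>.  Throughout, the type of \<open>S\<close> is \<open>'k fps fps\<close>, with \<open>y\<close> the outer variable.
\<close>

section \<open>Weierstrass division and ideals of power series in two variables\<close>

text \<open>The coefficients at \<open>y\<^sup>n\<close> of the quotient of \<open>q\<close> by \<open>s\<close>: long division in \<open>y\<close>, where
  dividing by the lowest coefficient \<open>s\<^sub>0\<close> leaves a remainder in the Euclidean ring of power
  series in \<open>x\<close>.\<close>

fun weierstrass_quot :: "'k::field fps fps \<Rightarrow> 'k fps fps \<Rightarrow> nat \<Rightarrow> 'k fps" where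
  "weierstrass_quot q s n =
    (fps_nth q n - (\<Sum>i<n. weierstrass_quot q s i * fps_nth s (n - i))) div fps_nth s 0"

declare weierstrass_quot.simps [simp del]

lemma subdegree_mod_less:
  fixes f g :: "'k::field fps"
  assumes "g \<noteq> 0" "f mod g \<noteq> 0"
  shows "subdegree (f mod g) < subdegree g"
  using mod_size_less[OF assms(1), of f] assms by (simp add: fps_euclidean_size_def)

text \<open>The bound on the remainder is stated through orders: each coefficient of \<open>r\<close> is a
  remainder modulo \<open>s\<^sub>0\<close>, so it vanishes or has smaller order in \<open>x\<close> than \<open>s\<^sub>0\<close>.  This is what the
  minimality arguments below consume.\<close>

lemma weierstrass_division:
  fixes q s :: "'k::field fps fps"
  assumes s: "fps_nth s 0 \<noteq> 0"
  obtains u r where "q = u * s + r"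
    "\<And>i. fps_nth r i \<noteq> 0 \<Longrightarrow> subdegree (fps_nth r i) < subdegree (fps_nth s 0)"
proof
  define u where "u = Abs_fps (weierstrass_quot q s)"
  define c where "c n = fps_nth q n - (\<Sum>i<n. fps_nth u i * fps_nth s (n - i))" for n
  have u: "fps_nth u n = c n div fps_nth s 0" for n
    unfolding u_def c_def by (subst fps_nth_Abs_fps, subst weierstrass_quot.simps) simp
  show "q = u * s + (q - u * s)" by simp
  fix n assume nz: "fps_nth (q - u * s) n \<noteq> 0"
  have "fps_nth (u * s) n = (\<Sum>i<n. fps_nth u i * fps_nth s (n - i)) + fps_nth u n * fps_nth s 0"
    unfolding fps_mult_nth by (cases n) (simp_all add: atLeast0AtMost lessThan_Suc_atMost)
  hence "fps_nth (q - u * s) n = c n - c n div fps_nth s 0 * fps_nth s 0"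
    unfolding u[symmetric] by (simp add: c_def)
  also have "\<dots> = c n mod fps_nth s 0" by (simp add: minus_div_mult_eq_mod)
  finally show "subdegree (fps_nth (q - u * s) n) < subdegree (fps_nth s 0)"
    using nz subdegree_mod_less[OF s] by simp
qed

definition is_ideal :: "'a::comm_ring_1 set \<Rightarrow> bool" where
  "is_ideal I \<longleftrightarrow> 0 \<in> I \<and> (\<forall>f\<in>I. \<forall>g\<in>I. f + g \<in> I) \<and> (\<forall>f\<in>I. \<forall>h. h * f \<in> I)"

lemma is_idealD:
  assumes "is_ideal I"
  shows "0 \<in> I" "f \<in> I \<Longrightarrow> g \<in> I \<Longrightarrow> f + g \<in> I" "f \<in> I \<Longrightarrow> h * f \<in> I" "f \<in> I \<Longrightarrow> f * h \<in> I"
    "f \<in> I \<Longrightarrow> g \<in> I \<Longrightarrow> f - g \<in> I"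
proof -
  show "f - g \<in> I" if "f \<in> I" "g \<in> I"
    using assms that unfolding is_ideal_def by (metis add_uminus_conv_diff mult_minus1)
qed (use assms in \<open>auto simp: is_ideal_def mult.commute\<close>)

abbreviation vanishes_below :: "nat \<Rightarrow> 'a::zero fps \<Rightarrow> bool"
  where "vanishes_below m f \<equiv> \<forall>i<m. fps_nth f i = 0"

lemma vanishes_below_decompose:
  fixes f :: "'a::comm_ring_1 fps"
  assumes "vanishes_below m f"
  shows "f = fps_shift m f * fps_X ^ m"
  using assms by (intro fps_ext) (auto simp: fps_X_power_mult_right_nth)

text \<open>Krull's intersection theorem in the form of Nakayama's lemma: \<open>D = x D + I\<close> implies
  \<open>D = I\<close>.  At each power \<open>y\<^sup>m\<close> the ideals have the same leading coefficients, because an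
  element of \<open>D\<close> whose leading coefficient has least order in \<open>x\<close> agrees modulo \<open>x D\<close> with one of
  \<open>I\<close>.  So an element of \<open>D\<close> can be corrected by \<open>I\<close> up to any order in \<open>y\<close>, and once the order
  of an element \<open>h\<close> of \<open>I\<close> with the least leading coefficient of all is reached, Weierstrass
  division by \<open>h\<close> leaves no remainder.\<close>

lemma Krull_ideal:
  fixes I D :: "'k::field fps fps set"
  assumes I: "is_ideal I" and D: "is_ideal D" and ID: "I \<subseteq> D"
    and x: "\<And>d. d \<in> D \<Longrightarrow> \<exists>d'\<in>D. d - fps_const fps_X * d' \<in> I"
  shows "D \<subseteq> I"
proof -
  \<comment> \<open>\<open>I\<close> and \<open>D\<close> have the same coefficients at \<open>y\<^sup>m\<close> among their elements of order at least \<open>m\<close>.\<close>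
  have lead: "\<exists>i\<in>I. vanishes_below m i \<and> fps_nth i m = fps_nth h m"
    if app: "\<forall>f\<in>D. \<exists>i\<in>I. vanishes_below m (f - i)" and h: "h \<in> D" "vanishes_below m h" for m h
  proof (cases "\<forall>h\<in>D. vanishes_below m h \<longrightarrow> fps_nth h m = 0")
    case True
    thus ?thesis using h is_idealD(1)[OF I] by (intro bexI[of _ 0]) auto
  next
    case False
    define C where "C h \<longleftrightarrow> h \<in> D \<and> vanishes_below m h \<and> fps_nth h m \<noteq> 0" for h
    obtain h0 where "C h0" using False unfolding C_def by blast
    then obtain h1 where C: "C h1"
      and least: "\<And>h. C h \<Longrightarrow> subdegree (fps_nth h1 m) \<le> subdegree (fps_nth h m)"
      using ex_has_least_nat[of C h0 "\<lambda>h. subdegree (fps_nth h m)"] by blast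
    have h1: "h1 \<in> D" "vanishes_below m h1" "fps_nth h1 m \<noteq> 0" using C unfolding C_def by blast+
    have min: "subdegree (fps_nth h1 m) \<le> subdegree (fps_nth h m)"
      if "h \<in> D" "vanishes_below m h" "fps_nth h m \<noteq> 0" for h
      using that by (intro least) (simp add: C_def)
    obtain d where d: "d \<in> D" "h1 - fps_const fps_X * d \<in> I" using x[OF h1(1)] by blast
    obtain i where i: "i \<in> I" "vanishes_below m (d - i)" using app d(1) by blast
    \<comment> \<open>Correcting \<open>d\<close> by \<open>i\<close> keeps \<open>j\<close> in \<open>I\<close> and makes it vanish below \<open>m\<close>; the factor \<open>x\<close> raises
      the order, so the leading coefficient of \<open>h1\<close> survives.\<close>
    define j where "j = h1 - fps_const fps_X * (d - i)"
    have "j = (h1 - fps_const fps_X * d) + fps_const fps_X * i" by (simp add: j_def algebra_simps)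
    hence jI: "j \<in> I" using d i is_idealD[OF I] by auto
    have jm: "vanishes_below m j" using h1(2) i(2) by (simp add: j_def)
    define e where "e = subdegree (fps_nth h1 m)"
    have "d - i \<in> D" using i d ID is_idealD(5)[OF D] by blast
    hence "fps_nth (d - i) m \<noteq> 0 \<Longrightarrow> e \<le> subdegree (fps_nth (d - i) m)"
      unfolding e_def using i(2) by (intro min)
    hence "fps_nth (fps_nth (d - i) m) n = 0" if "n < e" for n
      using that nth_less_subdegree_zero[of n "fps_nth (d - i) m"]
      by (cases "fps_nth (d - i) m = 0") (simp_all del: fps_sub_nth)
    hence "fps_nth (fps_X * fps_nth (d - i) m) e = 0" by (cases e) auto
    hence "fps_nth (fps_nth j m) e = fps_nth (fps_nth h1 m) e" by (simp add: j_def)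
    hence nz: "fps_nth (fps_nth j m) e \<noteq> 0" using h1(3) by (simp add: e_def)
    hence "subdegree (fps_nth j m) \<le> e" by (rule subdegree_leI)
    moreover have "fps_nth j m \<noteq> 0" using nz by auto
    ultimately have "fps_nth j m dvd fps_nth h m"
      using min[OF h] by (cases "fps_nth h m = 0") (auto simp: fps_dvd_iff e_def)
    then obtain c where c: "fps_nth h m = c * fps_nth j m" by (metis dvd_def mult.commute)
    show ?thesis
      using jI jm c is_idealD(3)[OF I] by (intro bexI[of _ "fps_const c * j"]) auto
  qed
  have app: "\<forall>f\<in>D. \<exists>i\<in>I. vanishes_below m (f - i)" for m
  proof (induction m)
    case 0
    thus ?case using is_idealD(1)[OF I] by auto
  next
    case (Suc m)
    show ?case
    proof
      fix f assume f: "f \<in> D"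
      then obtain i where i: "i \<in> I" "vanishes_below m (f - i)" using Suc by blast
      have "f - i \<in> D" using f i ID is_idealD(5)[OF D] by auto
      then obtain j where j: "j \<in> I" "vanishes_below m j" "fps_nth j m = fps_nth (f - i) m"
        using lead[OF Suc _ i(2)] by blast
      show "\<exists>i\<in>I. vanishes_below (Suc m) (f - i)"
        using i j is_idealD(2)[OF I] by (intro bexI[of _ "i + j"]) (auto simp: less_Suc_eq)
    qed
  qed
  show ?thesis
  proof (cases "\<exists>h\<in>D. h \<noteq> 0")
    case False
    thus ?thesis using is_idealD(1)[OF I] by auto
  next
    case True
    then obtain h where h: "h \<in> D" "h \<noteq> 0" and min: "\<And>f. f \<in> D \<Longrightarrow> f \<noteq> 0 \<Longrightarrow>
        subdegree (fps_nth h (subdegree h)) \<le> subdegree (fps_nth f (subdegree f))"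
      using ex_has_least_nat[of "\<lambda>h. h \<in> D \<and> h \<noteq> 0" _ "\<lambda>h. subdegree (fps_nth h (subdegree h))"]
      by blast
    \<comment> \<open>Replace \<open>h\<close> by an element of \<open>I\<close> with the same leading coefficient.\<close>
    define N where "N = subdegree h"
    obtain i where i: "i \<in> I" "vanishes_below N i" "fps_nth i N = fps_nth h N"
      using lead[OF app h(1), of N] by (auto simp: N_def)
    define i' where "i' = fps_shift N i"
    have i': "i = i' * fps_X ^ N" using vanishes_below_decompose[OF i(2)] by (simp add: i'_def)
    have i'0: "fps_nth i' 0 = fps_nth h N" using i by (simp add: i'_def)
    show ?thesis
    proof
      fix f assume f: "f \<in> D"
      obtain j where j: "j \<in> I" "vanishes_below N (f - j)" using app f by blast
      define f' where "f' = fps_shift N (f - j)"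
      have f': "f - j = f' * fps_X ^ N" using vanishes_below_decompose[OF j(2)] by (simp add: f'_def)
      obtain u r where ur: "f' = u * i' + r"
        "\<And>n. fps_nth r n \<noteq> 0 \<Longrightarrow> subdegree (fps_nth r n) < subdegree (fps_nth i' 0)"
        using weierstrass_division[of i' f'] i'0 h by (metis N_def nth_subdegree_nonzero)
      have rD: "r * fps_X ^ N \<in> D"
      proof -
        have "r * fps_X ^ N = (f - j) - u * i" unfolding f' i' ur by (simp add: algebra_simps)
        thus ?thesis using f j i ID is_idealD[OF D] by (metis subsetD)
      qed
      \<comment> \<open>A remainder would have a leading coefficient of smaller order than \<open>h\<close>.\<close>
      have "r = 0"
      proof (rule ccontr)
        assume r: "r \<noteq> 0"
        hence "subdegree (r * fps_X ^ N) = subdegree r + N" by simp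
        hence "fps_nth (r * fps_X ^ N) (subdegree (r * fps_X ^ N)) = fps_nth r (subdegree r)"
          by (simp add: fps_X_power_mult_right_nth)
        moreover have "r * fps_X ^ N \<noteq> 0" using r by simp
        ultimately show False
          using min[OF rD] ur(2)[of "subdegree r"] r i'0 by (simp add: N_def)
      qed
      hence "f = u * i + j" using f' ur i' by (simp add: algebra_simps)
      thus "f \<in> I" using i j is_idealD[OF I] by auto
    qed
  qed
qed

definition is_prime :: "'a::comm_ring_1 set \<Rightarrow> bool" where
  "is_prime P \<longleftrightarrow> is_ideal P \<and> 1 \<notin> P \<and> (\<forall>f g. f * g \<in> P \<longrightarrow> f \<in> P \<or> g \<in> P)"

lemma is_primeD:
  assumes "is_prime P"
  shows "is_ideal P" "1 \<notin> P" "f * g \<in> P \<Longrightarrow> f \<in> P \<or> g \<in> P" "f ^ n \<in> P \<Longrightarrow> f \<in> P"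
proof -
  show "f \<in> P" if "f ^ n \<in> P"
    using that assms unfolding is_prime_def by (induction n) auto
qed (use assms in \<open>auto simp: is_prime_def\<close>)

lemma prime_shift:
  fixes P :: "'a::comm_ring_1 fps set"
  assumes "is_prime P" "fps_X \<notin> P" "f \<in> P"
  shows "fps_shift (subdegree f) f \<in> P"
  using is_primeD(3,4)[OF assms(1)] assms(2,3) by (metis subdegree_decompose)

text \<open>A prime not containing \<open>y\<close> has elements with nonzero coefficient at \<open>y\<^sup>0\<close>.  One for which
  that coefficient has least order in \<open>x\<close> divides all others: the remainder of the division, freed
  of its powers of \<open>y\<close>, would have smaller order.\<close>

lemma prime_principal:
  fixes P :: "'k::field fps fps set"
  assumes P: "is_prime P" and y: "fps_X \<notin> P" and nz: "P \<noteq> {0}"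
  obtains s where "s \<in> P" "\<And>q. q \<in> P \<Longrightarrow> s dvd q"
proof -
  have ideal: "is_ideal P" by (rule is_primeD[OF P])
  note shift = prime_shift[OF P y]
  obtain f where "f \<in> P" "f \<noteq> 0" using nz is_idealD(1)[OF ideal] by auto
  hence "fps_shift (subdegree f) f \<in> P \<and> fps_nth (fps_shift (subdegree f) f) 0 \<noteq> 0"
    using shift by auto
  then obtain s where s: "s \<in> P" "fps_nth s 0 \<noteq> 0" and min: "\<And>q. q \<in> P \<Longrightarrow> fps_nth q 0 \<noteq> 0 \<Longrightarrow>
      subdegree (fps_nth s 0) \<le> subdegree (fps_nth q 0)"
    using ex_has_least_nat[of "\<lambda>s. s \<in> P \<and> fps_nth s 0 \<noteq> 0" _ "\<lambda>s. subdegree (fps_nth s 0)"]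
    by blast
  have "s dvd q" if q: "q \<in> P" for q
  proof -
    obtain u r where ur: "q = u * s + r"
      "\<And>n. fps_nth r n \<noteq> 0 \<Longrightarrow> subdegree (fps_nth r n) < subdegree (fps_nth s 0)"
      using weierstrass_division[OF s(2)] by metis
    have "r = q - u * s" using ur by simp
    hence "r \<in> P" using q s is_idealD[OF ideal] by auto
    hence "r = 0" using min[OF shift, of r] ur(2)[of "subdegree r"] by fastforce
    thus ?thesis using ur by simp
  qed
  thus ?thesis using that s by blast
qed

lemma fps2_unit:
  fixes f :: "'k::field fps fps"
  assumes "fps_nth (fps_nth f 0) 0 \<noteq> 0"
  obtains h where "h * f = 1"
proof -
  obtain c where c: "fps_nth f 0 * c = 1"
    using assms by (metis fps_is_unit_iff dvdE)
  have "f * fps_right_inverse f c = 1" using fps_right_inverse[OF c] .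
  thus ?thesis using that by (metis mult.commute)
qed

lemma fps1_decompose:
  fixes f :: "'k::field fps"
  assumes "f \<noteq> 0"
  obtains v where "v * f = fps_X ^ subdegree f"
proof -
  have "f dvd fps_X ^ subdegree f" using assms by (simp add: fps_dvd_iff)
  thus ?thesis using that by (metis dvdE mult.commute)
qed

lemma fps_split0:
  fixes f :: "'a::comm_ring_1 fps"
  shows "f = fps_const (fps_nth f 0) + fps_X * fps_shift 1 f"
  by (intro fps_ext) (auto simp: fps_X_mult_nth)

lemma const_mem:
  assumes "is_ideal P" "fps_X \<in> P" "f \<in> P"
  shows "fps_const (fps_nth f 0) \<in> P"
proof -
  have "fps_const (fps_nth f 0) = f - fps_X * fps_shift 1 f" using fps_split0[of f] by (simp add: algebra_simps)
  thus ?thesis using assms is_idealD[OF assms(1)] by simp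
qed

text \<open>The ring \<open>S\<close> has dimension at most 2.  If \<open>y \<in> P2\<close>, then either \<open>x \<in> P2\<close> and \<open>P2\<close> is
  maximal, or \<open>P2 = (y) = P1\<close>.  If \<open>y \<notin> P2\<close>, then both \<open>P1\<close> and \<open>P2\<close> are principal, and one
  nonzero principal prime is never properly contained in another.\<close>

lemma no_prime_chain:
  fixes P1 P2 P3 :: "'k::field fps fps set"
  assumes P: "is_prime P1" "is_prime P2" "is_prime P3" and nz: "P1 \<noteq> {0}"
    and strict: "P1 \<subset> P2" "P2 \<subset> P3"
  shows False
proof -
  have no_xy: False if xy: "fps_X \<in> P2" "fps_const fps_X \<in> P2"
  proof -
    obtain f where f: "f \<in> P3" "f \<notin> P2" using strict by auto
    have "fps_nth (fps_nth f 0) 0 \<noteq> 0"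
    proof
      assume "fps_nth (fps_nth f 0) 0 = 0"
      hence "f = fps_const (fps_shift 1 (fps_nth f 0)) * fps_const fps_X + fps_shift 1 f * fps_X"
        using fps_split0[of f] fps_split0[of "fps_nth f 0"] by (simp add: mult.commute)
      thus False using f xy is_idealD[OF is_primeD(1)[OF P(2)]] by metis
    qed
    then obtain h where "h * f = 1" by (rule fps2_unit)
    thus False using is_primeD(1,2)[OF P(3)] f is_idealD(3) by metis
  qed
  have x: "fps_const fps_X \<in> P" if PP: "is_prime P" "fps_X \<in> P" "f \<in> P" "fps_nth f 0 \<noteq> 0"
    for P :: "'k fps fps set" and f
  proof -
    obtain v where v: "v * fps_nth f 0 = fps_X ^ subdegree (fps_nth f 0)" using fps1_decompose PP(4) .
    have "fps_const v * fps_const (fps_nth f 0) \<in> P"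
      using const_mem is_primeD(1) PP(1,2,3) is_idealD(3) by metis
    thus ?thesis using v is_primeD(4)[OF PP(1)] by (metis fps_const_mult fps_const_power)
  qed
  show False
  proof (cases "fps_X \<in> P2")
    case True
    show False
    proof (cases "\<exists>f\<in>P2. fps_nth f 0 \<noteq> 0")
      case True
      thus False using x[OF P(2) \<open>fps_X \<in> P2\<close>] no_xy \<open>fps_X \<in> P2\<close> by blast
    next
      case False
      have yP1: "fps_X \<in> P1"
      proof (rule ccontr)
        assume "fps_X \<notin> P1"
        moreover obtain s where s: "s \<in> P1" "s \<noteq> 0"
          using nz is_idealD(1)[OF is_primeD(1)[OF P(1)]] by auto
        ultimately have "fps_shift (subdegree s) s \<in> P2"
          using prime_shift[OF P(1)] strict(1) by blast
        hence "fps_nth (fps_shift (subdegree s) s) 0 = 0" using False by blast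
        thus False using s(2) by simp
      qed
      obtain f where f: "f \<in> P2" "f \<notin> P1" using strict by auto
      have "f = fps_X * fps_shift 1 f" using fps_split0[of f] False f by simp
      thus False using f yP1 is_idealD(4)[OF is_primeD(1)[OF P(1)]] by metis
    qed
  next
    case False
    have nz2: "P2 \<noteq> {0}" using strict nz is_idealD(1)[OF is_primeD(1)[OF P(1)]] by auto
    obtain s where s: "s \<in> P1" "\<And>q. q \<in> P1 \<Longrightarrow> s dvd q"
      using prime_principal[OF P(1) _ nz] False strict by (metis psubsetD)
    obtain t where t: "t \<in> P2" "\<And>q. q \<in> P2 \<Longrightarrow> t dvd q"
      using prime_principal[OF P(2) False nz2] by metis
    have s0: "s \<noteq> 0" using s(2) nz s(1) by auto
    obtain u where u: "s = t * u" using s t strict by (metis dvdE psubsetD)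
    have "t \<notin> P1"
    proof
      assume "t \<in> P1"
      have "P2 \<subseteq> P1"
      proof
        fix q assume "q \<in> P2"
        then obtain v where "q = t * v" using t by (metis dvdE)
        thus "q \<in> P1" using \<open>t \<in> P1\<close> is_idealD(4)[OF is_primeD(1)[OF P(1)]] by auto
      qed
      thus False using strict by auto
    qed
    hence "u \<in> P1" using is_primeD(3)[OF P(1)] u s by metis
    then obtain w where "u = s * w" using s by (metis dvdE)
    hence "s * 1 = s * (t * w)" using u by (simp add: mult_ac)
    hence "t * w = 1" using s0 by (metis mult_cancel_left)
    thus False using t is_primeD(1,2)[OF P(2)] is_idealD(4) by metis
  qed
qed

text \<open>The first term has even order, the second odd order.\<close>

lemma cubic_norm_zero:
  fixes p q :: "'k::field fps"
  assumes "p\<^sup>2 + fps_X ^ 3 * q\<^sup>2 = 0"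
  shows "p = 0" "q = 0"
proof -
  have eq: "p\<^sup>2 = - (fps_X ^ 3 * q\<^sup>2)" using assms by (simp add: eq_neg_iff_add_eq_0)
  show q: "q = 0"
  proof (rule ccontr)
    assume "q \<noteq> 0"
    hence "subdegree (p\<^sup>2) = 3 + 2 * subdegree q" unfolding eq by simp
    hence "2 * subdegree p = 3 + 2 * subdegree q" by simp
    thus False by presburger
  qed
  show "p = 0" using eq q by simp
qed

text \<open>The equation \<open>g\<close> of the branch curve of \<open>R\<close> over \<open>S\<close>; in \<open>R\<close> it is \<open>- z\<^sup>2\<close>.\<close>

definition e8_branch :: "'k::field fps fps" where
  "e8_branch = fps_const (fps_X ^ 3) + fps_X ^ 5"

lemma e8_branch_0: "fps_nth e8_branch 0 = fps_X ^ 3"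
  by (simp add: e8_branch_def)

text \<open>The norm of \<open>p + q z\<close> vanishes only at zero.  Modulo \<open>y\<close> this is the case of
  \<open>cubic_norm_zero\<close>, so \<open>y\<close> divides \<open>p\<close> and \<open>q\<close>; it can be cancelled, and one repeats.\<close>

lemma e8_norm_zero:
  fixes p q :: "'k::field fps fps"
  assumes "p\<^sup>2 + e8_branch * q\<^sup>2 = 0"
  shows "p = 0 \<and> q = 0"
proof -
  have "p\<^sup>2 + e8_branch * q\<^sup>2 = 0 \<Longrightarrow> fps_nth p n = 0 \<and> fps_nth q n = 0" for n
  proof (induction n arbitrary: p q)
    case (0 p q)
    have "fps_nth (p\<^sup>2 + e8_branch * q\<^sup>2) 0 = 0" using 0 by simp
    hence "(fps_nth p 0)\<^sup>2 + fps_X ^ 3 * (fps_nth q 0)\<^sup>2 = 0"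
      by (simp add: e8_branch_0 power2_eq_square)
    thus ?case using cubic_norm_zero by blast
  next
    case (Suc n p q)
    have "fps_nth (p\<^sup>2 + e8_branch * q\<^sup>2) 0 = 0" using Suc by simp
    hence "(fps_nth p 0)\<^sup>2 + fps_X ^ 3 * (fps_nth q 0)\<^sup>2 = 0"
      by (simp add: e8_branch_0 power2_eq_square)
    hence "fps_nth p 0 = 0" "fps_nth q 0 = 0" using cubic_norm_zero by blast+
    hence pq: "p = fps_X * fps_shift 1 p" "q = fps_X * fps_shift 1 q"
      using fps_split0[of p] fps_split0[of q] by auto
    have "p\<^sup>2 + e8_branch * q\<^sup>2
        = (fps_X * fps_shift 1 p)\<^sup>2 + e8_branch * (fps_X * fps_shift 1 q)\<^sup>2"
      unfolding pq[symmetric] ..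
    also have "\<dots> = fps_X\<^sup>2 * ((fps_shift 1 p)\<^sup>2 + e8_branch * (fps_shift 1 q)\<^sup>2)"
      by (simp only: power_mult_distrib distrib_left mult.left_commute)
    finally have "fps_X\<^sup>2 * ((fps_shift 1 p)\<^sup>2 + e8_branch * (fps_shift 1 q)\<^sup>2)
        = p\<^sup>2 + e8_branch * q\<^sup>2" ..
    hence "(fps_shift 1 p)\<^sup>2 + e8_branch * (fps_shift 1 q)\<^sup>2 = 0" using Suc.prems by simp
    from Suc.IH[OF this] show ?case by simp
  qed
  thus ?thesis using assms by (simp add: fps_eq_iff)
qed


section \<open>The normal form of elements of the \<open>E\<^sub>8\<close> ring\<close>

text \<open>The powers of the ideal \<open>(x, y)\<close>, described by coefficients.  They measure the convergence
  of series in powers of \<open>g\<close>.\<close>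

definition total_order_ge :: "nat \<Rightarrow> 'a::zero fps fps \<Rightarrow> bool" where
  "total_order_ge m f \<longleftrightarrow> (\<forall>a b. a + b < m \<longrightarrow> fps_nth (fps_nth f b) a = 0)"

lemma total_order_ge_mult:
  fixes f g :: "'a::comm_ring_1 fps fps"
  assumes "total_order_ge m f" "total_order_ge n g"
  shows "total_order_ge (m + n) (f * g)"
  unfolding total_order_ge_def
proof (intro allI impI)
  fix a b assume ab: "a + b < m + n"
  have "fps_nth (fps_nth f j) i * fps_nth (fps_nth g (b - j)) (a - i) = 0" if "j \<le> b" "i \<le> a" for i j
  proof (cases "i + j < m")
    case True
    thus ?thesis using assms(1) unfolding total_order_ge_def by simp
  next
    case False
    hence "(a - i) + (b - j) < n" using that ab by linarith
    thus ?thesis using assms(2) unfolding total_order_ge_def by simp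
  qed
  thus "fps_nth (fps_nth (f * g) b) a = 0"
    by (simp add: fps_mult_nth fps_sum_nth)
qed

lemma total_order_ge_mult_left:
  fixes f g :: "'a::comm_ring_1 fps fps"
  assumes "total_order_ge n g"
  shows "total_order_ge n (f * g)" "total_order_ge n (g * f)"
proof -
  show "total_order_ge n (f * g)"
    using total_order_ge_mult[of 0 f n g] assms by (simp add: total_order_ge_def)
  thus "total_order_ge n (g * f)" by (simp add: mult.commute)
qed

lemma total_order_ge_add:
  fixes f g :: "'a::comm_ring_1 fps fps"
  assumes "total_order_ge n f" "total_order_ge n g"
  shows "total_order_ge n (f + g)" "total_order_ge n (f - g)"
  using assms by (auto simp: total_order_ge_def)

lemma total_order_ge_mono: "total_order_ge n f \<Longrightarrow> m \<le> n \<Longrightarrow> total_order_ge m f"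
  by (auto simp: total_order_ge_def)

lemma total_order_ge_eq_0:
  assumes "\<And>m. total_order_ge m f"
  shows "f = 0"
proof (intro fps_ext)
  fix b a
  show "fps_nth (fps_nth f b) a = fps_nth (fps_nth 0 b) a"
    using assms[of "Suc (a + b)"] by (simp add: total_order_ge_def)
qed

lemma total_order_ge_branch: "total_order_ge i ((- e8_branch) ^ i)"
proof (induction i)
  case 0
  thus ?case by (simp add: total_order_ge_def)
next
  case (Suc i)
  have "total_order_ge 1 (- e8_branch)"
    by (simp add: total_order_ge_def e8_branch_def)
  from total_order_ge_mult[OF this Suc] show ?case by simp
qed

definition e8_eqn :: "'k::field fps3" where
  "e8_eqn = fps_X ^ 2 + fps_const e8_branch"

lemma e8_eqn_eq: "var_z ^ 2 + var_x ^ 3 + var_y ^ 5 = e8_eqn"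
  by (simp add: e8_eqn_def var_x_def var_y_def var_z_def e8_branch_def
      fps_const_add[symmetric] del: fps_const_add)

lemma e8_eqn_mult_nth:
  "fps_nth (u * e8_eqn) n = (if n < 2 then 0 else fps_nth u (n - 2)) + e8_branch * fps_nth u n"
  by (simp add: e8_eqn_def distrib_left fps_X_power_mult_right_nth mult.commute)

text \<open>The coefficient at \<open>z\<^sup>n\<close> of the quotient of \<open>h\<close> by \<open>z\<^sup>2 + g\<close>, namely the sum over all \<open>i\<close> of
  \<open>(- g)\<^sup>i h\<^sub>n\<^sub>+\<^sub>2\<^sub>+\<^sub>2\<^sub>i\<close>.  The terms with \<open>i > a + b\<close> do not contribute to the coefficient of
  \<open>x\<^sup>a y\<^sup>b\<close>, so each coefficient is a finite sum.\<close>

definition e8_quot :: "'k::field fps3 \<Rightarrow> nat \<Rightarrow> 'k fps fps" where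
  "e8_quot h n = Abs_fps (\<lambda>b. Abs_fps (\<lambda>a.
    fps_nth (fps_nth (\<Sum>i\<le>a + b. (- e8_branch) ^ i * fps_nth h (n + 2 + 2 * i)) b) a))"

lemma e8_quot_approx:
  assumes "m \<le> N"
  shows "total_order_ge m (e8_quot h n - (\<Sum>i\<le>N. (- e8_branch) ^ i * fps_nth h (n + 2 + 2 * i)))"
  unfolding total_order_ge_def
proof (intro allI impI)
  fix a b assume ab: "a + b < m"
  define t where "t i = (- e8_branch) ^ i * fps_nth h (n + 2 + 2 * i)" for i
  have "(\<Sum>i\<le>N. fps_nth (fps_nth (t i) b) a) = (\<Sum>i\<le>a + b. fps_nth (fps_nth (t i) b) a)"
  proof (rule sum.mono_neutral_right)
    show "\<forall>i\<in>{..N} - {..a + b}. fps_nth (fps_nth (t i) b) a = 0"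
    proof
      fix i assume "i \<in> {..N} - {..a + b}"
      moreover have "total_order_ge i (t i)"
        unfolding t_def by (rule total_order_ge_mult_left(2)[OF total_order_ge_branch])
      ultimately show "fps_nth (fps_nth (t i) b) a = 0" by (simp add: total_order_ge_def)
    qed
  qed (use ab assms in auto)
  thus "fps_nth (fps_nth (e8_quot h n - (\<Sum>i\<le>N. (- e8_branch) ^ i * fps_nth h (n + 2 + 2 * i))) b) a = 0"
    by (simp add: e8_quot_def fps_sum_nth t_def)
qed

lemma e8_quot_rec: "e8_quot h n + e8_branch * e8_quot h (n + 2) = fps_nth h (n + 2)"
proof -
  have "total_order_ge m (e8_quot h n + e8_branch * e8_quot h (n + 2) - fps_nth h (n + 2))" for m
  proof -
    define A where "A n = (\<Sum>i\<le>m. (- e8_branch) ^ i * fps_nth h (n + 2 + 2 * i))" for n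
    define B where "B = (- e8_branch) ^ Suc m * fps_nth h (n + 4 + 2 * m)"
    have "A n + B = (\<Sum>i\<le>Suc m. (- e8_branch) ^ i * fps_nth h (n + 2 + 2 * i))"
      by (simp add: A_def B_def numeral_eq_Suc)
    also have "\<dots> = fps_nth h (n + 2) + (\<Sum>i\<le>m. (- e8_branch) ^ Suc i * fps_nth h (n + 2 + 2 * Suc i))"
      by (subst sum.atMost_Suc_shift) simp
    also have "(\<Sum>i\<le>m. (- e8_branch) ^ Suc i * fps_nth h (n + 2 + 2 * Suc i)) = - e8_branch * A (n + 2)"
      unfolding A_def sum_distrib_left by (intro sum.cong) (simp_all add: mult.assoc)
    finally have AB: "A n + e8_branch * A (n + 2) = fps_nth h (n + 2) - B"
      by (simp add: algebra_simps)
    have "total_order_ge m B"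
      unfolding B_def using total_order_ge_mono[OF total_order_ge_branch, of m "Suc m"]
      by (intro total_order_ge_mult_left) auto
    moreover have "total_order_ge m (e8_quot h n - A n)" for n
      unfolding A_def by (rule e8_quot_approx) simp
    ultimately
    have "total_order_ge m ((e8_quot h n - A n) + e8_branch * (e8_quot h (n + 2) - A (n + 2)) - B)"
      by (intro total_order_ge_add(2)[of _ _ B] total_order_ge_add(1) total_order_ge_mult_left(1))
    also have "(e8_quot h n - A n) + e8_branch * (e8_quot h (n + 2) - A (n + 2)) - B
        = e8_quot h n + e8_branch * e8_quot h (n + 2) - (A n + e8_branch * A (n + 2)) - B"
      by (simp add: algebra_simps)
    also have "\<dots> = e8_quot h n + e8_branch * e8_quot h (n + 2) - fps_nth h (n + 2)"
      unfolding AB by simp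
    finally show ?thesis .
  qed
  from total_order_ge_eq_0[OF this] show ?thesis by simp
qed

definition e8_rep :: "'k::field fps fps \<Rightarrow> 'k fps fps \<Rightarrow> 'k fps3" where
  "e8_rep p q = fps_const p + fps_const q * fps_X"

lemma e8_rep_nth: "fps_nth (e8_rep p q) n = (if n = 0 then p else if n = 1 then q else 0)"
  by (auto simp: e8_rep_def)

lemma e8_division: "\<exists>u p q. h = u * e8_eqn + e8_rep p q"
proof (intro exI)
  define u where "u = Abs_fps (e8_quot h)"
  show "h = u * e8_eqn
    + e8_rep (fps_nth h 0 - e8_branch * fps_nth u 0) (fps_nth h 1 - e8_branch * fps_nth u 1)"
  proof (rule fps_ext)
    fix n
    show "fps_nth h n = fps_nth (u * e8_eqn
      + e8_rep (fps_nth h 0 - e8_branch * fps_nth u 0) (fps_nth h 1 - e8_branch * fps_nth u 1)) n"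
    proof (cases "n < 2")
      case True
      hence "n = 0 \<or> n = 1" by auto
      thus ?thesis by (auto simp: e8_eqn_mult_nth e8_rep_nth)
    next
      case False
      then obtain m where "n = m + 2" by (metis add.commute le_Suc_ex not_less)
      thus ?thesis using e8_quot_rec[of h m] by (simp add: e8_eqn_mult_nth e8_rep_nth u_def)
    qed
  qed
qed

text \<open>If \<open>p + q z\<close> is a multiple \<open>u (z\<^sup>2 + g)\<close>, then \<open>u\<^sub>n = - g u\<^sub>n\<^sub>+\<^sub>2\<close>, so every coefficient of \<open>u\<close> is
  divisible by all powers of \<open>g\<close>.\<close>

lemma e8_rep_multiple:
  assumes "e8_rep p q = u * e8_eqn"
  shows "p = 0 \<and> q = 0"
proof -
  have step: "fps_nth u n = - e8_branch * fps_nth u (n + 2)" for n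
  proof -
    have "fps_nth (u * e8_eqn) (n + 2) = 0" using e8_rep_nth[of p q "n + 2"] assms by simp
    hence "fps_nth u n + e8_branch * fps_nth u (n + 2) = 0" by (simp add: e8_eqn_mult_nth)
    thus ?thesis by (simp add: eq_neg_iff_add_eq_0)
  qed
  have "fps_nth u n = (- e8_branch) ^ i * fps_nth u (n + 2 * i)" for n i
  proof (induction i)
    case (Suc i)
    thus ?case using step[of "n + 2 * i"] by (simp add: mult_ac)
  qed simp
  hence "total_order_ge i (fps_nth u n)" for i n
    using total_order_ge_mult_left(2)[OF total_order_ge_branch] by metis
  hence "fps_nth u n = 0" for n by (intro total_order_ge_eq_0)
  hence "u = 0" by (intro fps_ext) simp
  hence "fps_nth (e8_rep p q) 0 = 0" "fps_nth (e8_rep p q) 1 = 0" using assms by simp_all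
  thus ?thesis by (simp add: e8_rep_nth)
qed

lemma fps3_cring: "cring (fps3_ring :: 'k::field fps3 ring)"
  by (rule cring_from_type_algebra)

lemma E8_ideal_eq: "E8_ideal = {u * e8_eqn |u. True}"
  by (simp add: E8_ideal_def e8_eqn_eq cgenideal_def ring_of_type_algebra_def)

lemma E8_ideal_ideal: "ideal (E8_ideal :: 'k::field fps3 set) fps3_ring"
  unfolding E8_ideal_def
  by (rule cring.cgenideal_ideal[OF fps3_cring]) (simp add: ring_of_type_algebra_def)

lemma E8_cring: "cring (E8_ring :: 'k::field fps3 set ring)"
  unfolding E8_ring_def by (rule ideal.quotient_is_cring[OF E8_ideal_ideal fps3_cring])

lemma E8_class_eq: "E8_class f = {u * e8_eqn + f |u. True}"
  by (auto simp: E8_class_def E8_ideal_eq a_r_coset_def r_coset_def ring_of_type_algebra_def)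

lemma E8_class_hom: "E8_class \<in> ring_hom (fps3_ring :: 'k::field fps3 ring) E8_ring"
proof -
  have "E8_class = (+>\<^bsub>fps3_ring\<^esub>) (E8_ideal :: 'k fps3 set)" by (rule ext) (simp add: E8_class_def)
  show ?thesis unfolding E8_ring_def \<open>E8_class = _\<close> using ideal.rcos_ring_hom[OF E8_ideal_ideal] .
qed

lemma E8_class_closed [simp, intro]: "E8_class f \<in> carrier E8_ring"
  and E8_class_add: "E8_class (f + g) = E8_class f \<oplus>\<^bsub>E8_ring\<^esub> E8_class g"
  and E8_class_mult: "E8_class (f * g) = E8_class f \<otimes>\<^bsub>E8_ring\<^esub> E8_class g"
  and E8_class_one: "E8_class 1 = \<one>\<^bsub>E8_ring\<^esub>"
  using ring_hom_closed[OF E8_class_hom, of f] ring_hom_add[OF E8_class_hom, of f g]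
    ring_hom_mult[OF E8_class_hom, of f g] ring_hom_one[OF E8_class_hom]
  by (simp_all add: ring_of_type_algebra_def)

lemma E8_class_0: "E8_class 0 = \<zero>\<^bsub>E8_ring\<^esub>"
  by (simp add: E8_ring_def FactRing_def E8_class_eq E8_ideal_eq)

lemma E8_class_pow: "E8_class (f ^ n) = E8_class f [^]\<^bsub>E8_ring\<^esub> n"
proof -
  interpret cring "E8_ring :: 'a fps3 set ring" by (rule E8_cring)
  show ?thesis by (induction n) (simp_all add: E8_class_one E8_class_mult m_comm)
qed

lemma E8_carrier: "carrier E8_ring = range E8_class"
  by (auto simp: E8_ring_def FactRing_def E8_class_def A_RCOSETS_def RCOSETS_def
      a_r_coset_def ring_of_type_algebra_def)

lemma E8_class_eq_iff: "E8_class f = E8_class g \<longleftrightarrow> (\<exists>u. f - g = u * e8_eqn)"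
proof
  assume "E8_class f = E8_class g"
  moreover have "f \<in> E8_class f" unfolding E8_class_eq by (auto intro!: exI[of _ 0])
  ultimately show "\<exists>u. f - g = u * e8_eqn" unfolding E8_class_eq by auto
next
  assume "\<exists>u. f - g = u * e8_eqn"
  then obtain u where u: "f = u * e8_eqn + g" by (auto simp: algebra_simps)
  have "\<exists>w. v * e8_eqn + f = w * e8_eqn + g" for v
    by (intro exI[of _ "v + u"]) (simp add: u algebra_simps)
  moreover have "\<exists>w. v * e8_eqn + g = w * e8_eqn + f" for v
    by (intro exI[of _ "v - u"]) (simp add: u algebra_simps)
  ultimately show "E8_class f = E8_class g" unfolding E8_class_eq by auto
qed

lemma E8_class_eqn: "E8_class (f * e8_eqn + g) = E8_class g"
  by (auto simp: E8_class_eq_iff)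

lemma E8_class_rep_eq_iff: "E8_class (e8_rep p q) = E8_class (e8_rep p' q') \<longleftrightarrow> p = p' \<and> q = q'"
proof
  assume "E8_class (e8_rep p q) = E8_class (e8_rep p' q')"
  then obtain u where "e8_rep p q - e8_rep p' q' = u * e8_eqn" using E8_class_eq_iff by blast
  moreover have "e8_rep p q - e8_rep p' q' = e8_rep (p - p') (q - q')"
    by (simp add: e8_rep_def fps_const_sub[symmetric] algebra_simps del: fps_const_sub)
  ultimately show "p = p' \<and> q = q'" using e8_rep_multiple[of "p - p'" "q - q'" u] by simp
qed auto

lemma e8_coords_ex1: "\<exists>!pq. E8_class h = E8_class (e8_rep (fst pq) (snd pq))"
proof -
  obtain u p q where h: "h = u * e8_eqn + e8_rep p q" using e8_division by blast
  show ?thesis unfolding h E8_class_eqn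
    by (rule ex1I[of _ "(p, q)"]) (auto simp: E8_class_rep_eq_iff prod_eq_iff)
qed

text \<open>The coordinates of the class of \<open>h\<close> with respect to the \<open>S\<close>-basis \<open>1, z\<close> of \<open>R\<close>.  They are
  defined on representatives, so that computations in \<open>R\<close> become computations with power
  series.\<close>

definition e8_coords :: "'k::field fps3 \<Rightarrow> 'k fps fps \<times> 'k fps fps" where
  "e8_coords h = (THE pq. E8_class h = E8_class (e8_rep (fst pq) (snd pq)))"

abbreviation "e8_re h \<equiv> fst (e8_coords h)"
abbreviation "e8_im h \<equiv> snd (e8_coords h)"

lemma E8_class_coords: "E8_class h = E8_class (e8_rep (e8_re h) (e8_im h))"
  unfolding e8_coords_def by (rule theI'[OF e8_coords_ex1])

lemma e8_coords_eqI: "E8_class h = E8_class (e8_rep p q) \<Longrightarrow> e8_coords h = (p, q)"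
  using E8_class_coords[of h] by (auto simp: E8_class_rep_eq_iff prod_eq_iff)

lemma e8_coords_rep [simp]: "e8_coords (e8_rep p q) = (p, q)"
  by (rule e8_coords_eqI) simp

lemma E8_class_eq_iff_coords: "E8_class f = E8_class g \<longleftrightarrow> e8_coords f = e8_coords g"
  using E8_class_coords[of f] E8_class_coords[of g] by (metis E8_class_rep_eq_iff prod_eq_iff)

lemma e8_coords_const [simp]: "e8_coords (fps_const p) = (p, 0)"
  using e8_coords_rep[of p 0] by (simp add: e8_rep_def)

lemma e8_coords_0 [simp]: "e8_coords 0 = (0, 0)" and e8_coords_1 [simp]: "e8_coords 1 = (1, 0)"
  using e8_coords_const[of 0] e8_coords_const[of 1] by simp_all

lemma e8_coords_X [simp]: "e8_coords fps_X = (0, 1)"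
  using e8_coords_rep[of 0 1] by (simp add: e8_rep_def)

lemma e8_coords_add [simp]: "e8_coords (f + g) = (e8_re f + e8_re g, e8_im f + e8_im g)"
proof (rule e8_coords_eqI)
  have "E8_class (f + g) = E8_class (e8_rep (e8_re f) (e8_im f) + e8_rep (e8_re g) (e8_im g))"
    unfolding E8_class_add using E8_class_coords by metis
  also have "e8_rep (e8_re f) (e8_im f) + e8_rep (e8_re g) (e8_im g)
      = e8_rep (e8_re f + e8_re g) (e8_im f + e8_im g)"
    by (simp add: e8_rep_def fps_const_add[symmetric] algebra_simps del: fps_const_add)
  finally show "E8_class (f + g) = E8_class (e8_rep (e8_re f + e8_re g) (e8_im f + e8_im g))" .
qed

lemma e8_rep_mult:
  "e8_rep p q * e8_rep p' q' = fps_const (q * q') * e8_eqn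
    + e8_rep (p * p' - e8_branch * (q * q')) (p * q' + q * p')"
  by (simp add: e8_rep_def e8_eqn_def fps_const_add[symmetric] fps_const_sub[symmetric]
      fps_const_mult[symmetric] algebra_simps power2_eq_square
      del: fps_const_add fps_const_sub fps_const_mult)

lemma e8_coords_mult [simp]:
  "e8_coords (f * g) = (e8_re f * e8_re g - e8_branch * (e8_im f * e8_im g),
    e8_re f * e8_im g + e8_im f * e8_re g)"
proof (rule e8_coords_eqI)
  have "E8_class (f * g) = E8_class (e8_rep (e8_re f) (e8_im f) * e8_rep (e8_re g) (e8_im g))"
    unfolding E8_class_mult using E8_class_coords by metis
  thus "E8_class (f * g) = E8_class (e8_rep (e8_re f * e8_re g - e8_branch * (e8_im f * e8_im g))
      (e8_re f * e8_im g + e8_im f * e8_re g))"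
    by (simp only: e8_rep_mult E8_class_eqn)
qed

text \<open>The product with the conjugate \<open>p - q z\<close> is the norm \<open>p\<^sup>2 + g q\<^sup>2\<close>, which has a nonzero
  constant term.\<close>

lemma e8_unit:
  assumes "fps_nth (fps_nth (e8_re h) 0) 0 \<noteq> 0"
  obtains h' where "E8_class (h' * h) = E8_class 1"
proof -
  have "fps_nth (fps_nth ((e8_re h)\<^sup>2 + e8_branch * (e8_im h)\<^sup>2) 0) 0 \<noteq> 0"
    using assms by (simp add: e8_branch_0 power2_eq_square)
  then obtain v where "v * ((e8_re h)\<^sup>2 + e8_branch * (e8_im h)\<^sup>2) = 1" by (rule fps2_unit)
  hence "E8_class (fps_const v * e8_rep (e8_re h) (- e8_im h) * h) = E8_class 1"
    by (simp add: E8_class_eq_iff_coords power2_eq_square algebra_simps)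
  thus ?thesis using that by blast
qed


section \<open>Prime ideals and the dimension of the \<open>E\<^sub>8\<close> ring\<close>

lemma E8_class_uminus: "E8_class (- f) = \<ominus>\<^bsub>E8_ring\<^esub> E8_class f"
proof -
  interpret cring "E8_ring :: 'a fps3 set ring" by (rule E8_cring)
  have "E8_class (- f) \<oplus>\<^bsub>E8_ring\<^esub> E8_class f = \<zero>\<^bsub>E8_ring\<^esub>"
    by (simp add: E8_class_add[symmetric] E8_class_0)
  thus ?thesis by (intro minus_equality[symmetric]) auto
qed

lemma pullback_ideal:
  assumes "ideal P E8_ring"
  shows "is_ideal (E8_class -` P)"
proof -
  interpret ideal P E8_ring by fact
  show ?thesis
    using additive_subgroup.a_closed[OF is_additive_subgroup] I_l_closed
      additive_subgroup.zero_closed[OF is_additive_subgroup]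
    by (auto simp: is_ideal_def E8_class_0 E8_class_add E8_class_mult)
qed

lemma pullback_eqn:
  assumes "ideal P E8_ring"
  shows "(e8_eqn :: 'k::field fps3) \<in> E8_class -` P"
proof -
  interpret ideal P E8_ring by fact
  have "E8_class (1 * e8_eqn + 0 :: 'k fps3) = \<zero>\<^bsub>E8_ring\<^esub>" unfolding E8_class_eqn by (rule E8_class_0)
  thus ?thesis using additive_subgroup.zero_closed[OF is_additive_subgroup] by simp
qed

lemma pullback_prime:
  assumes "primeideal P E8_ring"
  shows "is_prime (E8_class -` P)"
proof -
  interpret primeideal P E8_ring by fact
  have "E8_class 1 \<notin> P" using one_imp_carrier I_notcarr by (auto simp: E8_class_one)
  thus ?thesis
    using I_prime pullback_ideal[OF ideal_axioms]
    by (auto simp: is_prime_def E8_class_mult)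
qed

lemma image_prime:
  assumes P: "is_prime P" and eqn: "e8_eqn \<in> P"
  shows "primeideal (E8_class ` P) E8_ring"
proof -
  interpret cring "E8_ring :: 'a fps3 set ring" by (rule E8_cring)
  note ideal = is_idealD[OF is_primeD(1)[OF P]]
  have mem: "E8_class f \<in> E8_class ` P \<longleftrightarrow> f \<in> P" for f
  proof
    assume "E8_class f \<in> E8_class ` P"
    then obtain g where g: "g \<in> P" "E8_class f = E8_class g" by auto
    then obtain u where "f - g = u * e8_eqn" using E8_class_eq_iff by blast
    hence "f = u * e8_eqn + g" by (simp add: algebra_simps)
    thus "f \<in> P" using g eqn ideal by auto
  qed auto
  show ?thesis
  proof (rule primeidealI2[OF additive_subgroupI])
    show "subgroup (E8_class ` P) (add_monoid E8_ring)"
    proof (rule add.subgroupI)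
      show "E8_class ` P \<noteq> {}" using ideal(1) by auto
      show "\<ominus>\<^bsub>E8_ring\<^esub> a \<in> E8_class ` P" if "a \<in> E8_class ` P" for a
        using that ideal(3)[of _ "-1"] by (auto simp: E8_class_uminus[symmetric] mem)
      show "a \<oplus>\<^bsub>E8_ring\<^esub> b \<in> E8_class ` P" if "a \<in> E8_class ` P" "b \<in> E8_class ` P" for a b
        using that ideal(2) by (auto simp: E8_class_add[symmetric] mem)
    qed auto
    show "cring (E8_ring :: 'a fps3 set ring)" by (rule E8_cring)
    show "x \<otimes>\<^bsub>E8_ring\<^esub> a \<in> E8_class ` P" "a \<otimes>\<^bsub>E8_ring\<^esub> x \<in> E8_class ` P"
      if "a \<in> E8_class ` P" "x \<in> carrier E8_ring" for a x
      using that ideal(3,4) by (auto simp: E8_carrier E8_class_mult[symmetric] mem)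
    show "carrier E8_ring \<noteq> E8_class ` P"
      using is_primeD(2)[OF P] mem[of 1] by (auto simp: E8_carrier)
    show "a \<in> E8_class ` P \<or> b \<in> E8_class ` P"
      if ab: "a \<in> carrier E8_ring" "b \<in> carrier E8_ring" "a \<otimes>\<^bsub>E8_ring\<^esub> b \<in> E8_class ` P" for a b
    proof -
      obtain f g where fg: "a = E8_class f" "b = E8_class g" using ab(1,2) by (auto simp: E8_carrier)
      hence "f * g \<in> P" using ab(3) by (simp only: E8_class_mult[symmetric] mem)
      thus ?thesis using is_primeD(3)[OF P] fg by (auto simp: mem)
    qed
  qed
qed

text \<open>Incomparability for the integral extension \<open>R\<close> of \<open>S\<close>.  If the contractions agree and
  \<open>p + q z\<close> lies in the larger prime only, its norm lies in both, so the smaller prime contains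
  the conjugate \<open>p - q z\<close>.  Then the trace \<open>2 p\<close> lies in both primes as well, and so does
  \<open>p + q z = 2 p - (p - q z)\<close>.\<close>

lemma contraction_strict:
  fixes P P' :: "'k::field fps3 set"
  assumes P: "is_prime P" "is_prime P'" and eqn: "e8_eqn \<in> P" and strict: "P \<subset> P'"
  shows "fps_const -` P \<subset> fps_const -` P'"
proof (rule psubsetI)
  show "fps_const -` P \<subseteq> fps_const -` P'" using strict by auto
  show "fps_const -` P \<noteq> fps_const -` P'"
  proof
    assume eq: "fps_const -` P = fps_const -` P'"
    note ideal = is_idealD[OF is_primeD(1)[OF P(1)]] and ideal' = is_idealD[OF is_primeD(1)[OF P(2)]]
    obtain f where f: "f \<in> P'" "f \<notin> P" using strict by auto
    obtain u p q where u: "f = u * e8_eqn + e8_rep p q" using e8_division by blast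
    have h: "e8_rep p q \<in> P'" "e8_rep p q \<notin> P"
    proof -
      have "e8_rep p q = f - u * e8_eqn" using u by simp
      thus "e8_rep p q \<in> P'" using f eqn strict ideal' by auto
      show "e8_rep p q \<notin> P" using f eqn ideal u by auto
    qed
    have "e8_rep p (- q) * e8_rep p q
        = fps_const (p * p + e8_branch * (q * q)) + fps_const (- (q * q)) * e8_eqn"
      unfolding e8_rep_mult by (simp add: e8_rep_def algebra_simps)
    moreover have "e8_rep p (- q) * e8_rep p q \<in> P'" using h ideal' by auto
    ultimately have "fps_const (p * p + e8_branch * (q * q)) \<in> P'"
      using ideal'(3,5) eqn strict by (metis add_diff_cancel_right' psubsetD)
    hence "fps_const (p * p + e8_branch * (q * q)) \<in> P" using eq by auto
    moreover have "e8_rep p (- q) * e8_rep p q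
        = fps_const (p * p + e8_branch * (q * q)) + fps_const (- (q * q)) * e8_eqn" by fact
    ultimately have "e8_rep p (- q) * e8_rep p q \<in> P" using eqn ideal by auto
    hence conj: "e8_rep p (- q) \<in> P" using is_primeD(3)[OF P(1)] h by blast
    have sum: "e8_rep p q + e8_rep p (- q) = fps_const (p + p)"
      by (simp add: e8_rep_def fps_const_neg[symmetric] fps_const_add[symmetric]
          del: fps_const_neg fps_const_add)
    have "e8_rep p q + e8_rep p (- q) \<in> P'" using h conj strict ideal' by auto
    hence "fps_const (p + p) \<in> P" using eq sum by auto
    moreover have "e8_rep p q = fps_const (p + p) - e8_rep p (- q)" using sum by (simp add: algebra_simps)
    ultimately show False using conj h ideal by auto
  qed
qed

lemma contraction_prime:
  assumes "is_prime (P :: 'k::field fps3 set)"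
  shows "is_prime (fps_const -` P)"
  using assms
  by (auto simp: is_prime_def is_ideal_def fps_const_add[symmetric] fps_const_mult[symmetric]
      simp del: fps_const_add fps_const_mult)

lemma E8_prime_chain_le:
  fixes P :: "nat \<Rightarrow> 'k::field fps3 set set"
  assumes P: "\<And>i. i \<le> n \<Longrightarrow> primeideal (P i) E8_ring" and strict: "\<And>i. i < n \<Longrightarrow> P i \<subset> P (Suc i)"
  shows "n \<le> 2"
proof (rule ccontr)
  assume n: "\<not> n \<le> 2"
  define C :: "nat \<Rightarrow> 'k fps fps set" where "C i = fps_const -` (E8_class -` P i)" for i
  have C: "is_prime (C i)" if "i \<le> 3" for i
    unfolding C_def using n that by (intro contraction_prime pullback_prime P) auto
  have ideal: "ideal (P i) E8_ring" if "i \<le> n" for i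
    using P[OF that] by (rule primeideal.axioms(1))
  have CC: "C i \<subset> C (Suc i)" if "i < 3" for i
  proof -
    have i: "i \<le> n" "Suc i \<le> n" using n that by auto
    have PP: "P i \<subset> P (Suc i)" by (rule strict) (use n that in simp)
    then obtain r where r: "r \<in> P (Suc i)" "r \<notin> P i" by (meson psubset_imp_ex_mem DiffE)
    have "r \<in> range E8_class"
      using ideal.Icarr[OF ideal[OF i(2)] r(1)] unfolding E8_carrier .
    then obtain f where "r = E8_class f" by (rule rangeE)
    hence f: "E8_class f \<in> P (Suc i)" "E8_class f \<notin> P i" using r by simp_all
    have "E8_class -` P i \<subset> E8_class -` P (Suc i)"
    proof (rule psubsetI)
      show "E8_class -` P i \<subseteq> E8_class -` P (Suc i)"
        by (rule vimage_mono[OF psubset_imp_subset[OF PP]])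
      show "E8_class -` P i \<noteq> E8_class -` P (Suc i)"
      proof
        assume "E8_class -` P i = E8_class -` P (Suc i)"
        moreover have "f \<in> E8_class -` P (Suc i)" using f(1) by (rule vimageI2)
        ultimately have "f \<in> E8_class -` P i" by simp
        thus False using f(2) by simp
      qed
    qed
    thus ?thesis unfolding C_def
      by (rule contraction_strict[OF pullback_prime[OF P[OF i(1)]] pullback_prime[OF P[OF i(2)]]
            pullback_eqn[OF ideal[OF i(1)]]])
  qed
  have "0 \<in> C 0" by (rule is_idealD(1)[OF is_primeD(1)[OF C]]) simp
  moreover obtain f where "f \<in> C 1" "f \<notin> C 0" using CC[of 0] by auto
  ultimately have nz: "C 1 \<noteq> {0}" by auto
  have "is_prime (C 1)" "is_prime (C 2)" "is_prime (C 3)" by (simp_all add: C)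
  moreover have "C 1 \<subset> C 2" "C 2 \<subset> C 3" using CC[of 1] CC[of 2] by (simp_all add: eval_nat_numeral)
  ultimately show False using no_prime_chain nz by blast
qed

text \<open>The kernel of a homomorphism into a quadratic extension that has no nonzero elements of
  norm zero.  It
  serves for the zero ideal of \<open>R\<close> and for the ideal generated by \<open>y\<close>.\<close>

lemma quadratic_prime:
  fixes Z :: "'k::field fps3 \<Rightarrow> 'a::idom \<times> 'a" and c :: 'a
  assumes zero: "Z 0 = (0, 0)" and one: "Z 1 = (1, 0)"
    and add: "\<And>f g. Z (f + g) = (fst (Z f) + fst (Z g), snd (Z f) + snd (Z g))"
    and mult: "\<And>f g. Z (f * g) = (fst (Z f) * fst (Z g) - c * (snd (Z f) * snd (Z g)),
      fst (Z f) * snd (Z g) + snd (Z f) * fst (Z g))"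
    and norm: "\<And>p q. p\<^sup>2 + c * q\<^sup>2 = 0 \<Longrightarrow> p = 0 \<and> q = 0"
  shows "is_prime {f. Z f = (0, 0)}"
proof -
  have "Z f = (0, 0) \<or> Z g = (0, 0)" if "Z (f * g) = (0, 0)" for f g
  proof -
    obtain p q r s where pq: "Z f = (p, q)" "Z g = (r, s)" by (metis surj_pair)
    hence "p * r - c * (q * s) = 0" "p * s + q * r = 0" using that mult[of f g] by auto
    moreover have "(p\<^sup>2 + c * q\<^sup>2) * (r\<^sup>2 + c * s\<^sup>2) = (p * r - c * (q * s))\<^sup>2 + c * (p * s + q * r)\<^sup>2"
      by (simp add: power2_eq_square algebra_simps)
    ultimately have "(p\<^sup>2 + c * q\<^sup>2) * (r\<^sup>2 + c * s\<^sup>2) = 0" by simp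
    thus ?thesis using norm[of p q] norm[of r s] pq by auto
  qed
  thus ?thesis by (auto simp: is_prime_def is_ideal_def zero one add mult)
qed

lemma krull_dim_E8: "krull_dim (E8_ring :: 'k::field fps3 set ring) = 2"
proof (rule antisym)
  show "krull_dim (E8_ring :: 'k fps3 set ring) \<le> 2"
    unfolding krull_dim_def
  proof (rule SUP_least)
    fix n assume "n \<in> {n. \<exists>P :: nat \<Rightarrow> 'k fps3 set set.
      (\<forall>i\<le>n. primeideal (P i) E8_ring) \<and> (\<forall>i<n. P i \<subset> P (Suc i))}"
    hence "n \<le> 2" using E8_prime_chain_le by blast
    thus "enat n \<le> 2" by (simp add: numeral_eq_enat)
  qed
next
  define Z1 :: "'k fps3 \<Rightarrow> 'k fps \<times> 'k fps"
    where "Z1 h = (fps_nth (e8_re h) 0, fps_nth (e8_im h) 0)" for h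
  define I0 :: "'k fps3 set" where "I0 = {h. e8_coords h = (0, 0)}"
  define I1 where "I1 = {h. Z1 h = (0, 0)}"
  define I2 :: "'k fps3 set" where "I2 = {h. fps_nth (fps_nth (e8_re h) 0) 0 = 0}"
  have coords_eqn: "e8_coords (e8_eqn :: 'k fps3) = (0, 0)"
  proof -
    have "E8_class (e8_eqn :: 'k fps3) = E8_class 0" using E8_class_eqn[of 1 0] by simp
    thus ?thesis by (simp only: E8_class_eq_iff_coords e8_coords_0)
  qed
  have I0: "is_prime I0" unfolding I0_def
    by (rule quadratic_prime[where c = e8_branch]) (use e8_norm_zero in auto)
  have I1: "is_prime I1" unfolding I1_def
    by (rule quadratic_prime[where c = "fps_X ^ 3"])
       (use cubic_norm_zero in \<open>auto simp: Z1_def e8_branch_0\<close>)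
  have I2: "is_prime I2"
    unfolding I2_def is_prime_def is_ideal_def by (auto simp: e8_branch_0)
  define P where "P i = E8_class ` (if i = 0 then I0 else if i = 1 then I1 else I2)" for i :: nat
  have prime: "primeideal (P i) E8_ring" for i
    unfolding P_def using I0 I1 I2 coords_eqn
    by (intro image_prime) (auto simp: I0_def I1_def I2_def Z1_def)
  have P_iff: "E8_class h \<in> P i \<longleftrightarrow> h \<in> (if i = 0 then I0 else if i = 1 then I1 else I2)" for h i
    by (auto simp: P_def I0_def I1_def I2_def Z1_def E8_class_eq_iff_coords)
  have "P 0 \<subset> P 1"
  proof (rule psubsetI)
    show "P 0 \<subseteq> P 1" by (auto simp: P_def I0_def I1_def Z1_def)
    show "P 0 \<noteq> P 1"
      using P_iff[of "fps_const fps_X" 0] P_iff[of "fps_const fps_X" 1]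
      by (auto simp: I0_def I1_def Z1_def)
  qed
  moreover have "P 1 \<subset> P 2"
  proof (rule psubsetI)
    show "P 1 \<subseteq> P 2" by (auto simp: P_def I1_def I2_def Z1_def)
    show "P 1 \<noteq> P 2"
      using P_iff[of fps_X 1] P_iff[of fps_X 2] by (auto simp: I1_def I2_def Z1_def)
  qed
  ultimately have "\<forall>i<2. P i \<subset> P (Suc i)" by (auto simp: less_Suc_eq numeral_eq_Suc)
  thus "2 \<le> krull_dim (E8_ring :: 'k fps3 set ring)"
    unfolding krull_dim_def numeral_eq_enat using prime by (intro SUP_upper) auto
qed


section \<open>Modules over the \<open>E\<^sub>8\<close> ring\<close>

text \<open>A module over \<open>R\<close> is handled as a module over power series in three variables, so that
  scalars can be manipulated by type class arithmetic.\<close>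

locale e8_module = module E8_ring M
  for M :: "('k::field fps3 set, 'm, 'd) module_scheme"
begin

definition act :: "'k fps3 \<Rightarrow> 'm \<Rightarrow> 'm" where
  "act h m = E8_class h \<odot>\<^bsub>M\<^esub> m"

lemma act_closed [simp, intro]: "m \<in> carrier M \<Longrightarrow> act h m \<in> carrier M"
  by (simp add: act_def)

lemma act_add: "m \<in> carrier M \<Longrightarrow> act (f + g) m = act f m \<oplus>\<^bsub>M\<^esub> act g m"
  by (simp add: act_def E8_class_add smult_l_distr)

lemma act_mult: "m \<in> carrier M \<Longrightarrow> act (f * g) m = act f (act g m)"
  by (simp add: act_def E8_class_mult smult_assoc1)

lemma act_1 [simp]: "m \<in> carrier M \<Longrightarrow> act 1 m = m"
  by (simp add: act_def E8_class_one)

lemma act_0 [simp]: "m \<in> carrier M \<Longrightarrow> act 0 m = \<zero>\<^bsub>M\<^esub>"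
  by (simp add: act_def E8_class_0)

lemma act_zero [simp]: "act f \<zero>\<^bsub>M\<^esub> = \<zero>\<^bsub>M\<^esub>"
  by (simp add: act_def)

lemma act_distrib:
  "m \<in> carrier M \<Longrightarrow> n \<in> carrier M \<Longrightarrow> act f (m \<oplus>\<^bsub>M\<^esub> n) = act f m \<oplus>\<^bsub>M\<^esub> act f n"
  by (simp add: act_def smult_r_distr)

lemma act_commute: "m \<in> carrier M \<Longrightarrow> act f (act g m) = act g (act f m)"
  by (simp add: act_mult[symmetric] mult.commute)

lemma act_cong: "E8_class f = E8_class g \<Longrightarrow> act f m = act g m"
  by (simp add: act_def)

lemma act_uminus: "m \<in> carrier M \<Longrightarrow> act (- f) m = \<ominus>\<^bsub>M\<^esub> act f m"
  by (simp add: act_def E8_class_uminus smult_l_minus)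

lemma act_minus: "m \<in> carrier M \<Longrightarrow> act f (\<ominus>\<^bsub>M\<^esub> m) = \<ominus>\<^bsub>M\<^esub> act f m"
  by (simp add: act_def smult_r_minus)

lemma act_diff: "m \<in> carrier M \<Longrightarrow> act (f - g) m = act f m \<ominus>\<^bsub>M\<^esub> act g m"
  using act_add[of m f "- g"] by (simp add: act_uminus M.minus_eq)

lemma act_coords: "m \<in> carrier M \<Longrightarrow>
    act h m = act (fps_const (e8_re h)) m \<oplus>\<^bsub>M\<^esub> act (fps_const (e8_im h)) (act fps_X m)"
  using act_cong[OF E8_class_coords] by (metis e8_rep_def act_add act_mult)

lemma act_square_X: "m \<in> carrier M \<Longrightarrow> act fps_X (act fps_X m) = act (fps_const (- e8_branch)) m"
  unfolding act_mult[symmetric] by (intro act_cong) (simp add: E8_class_eq_iff_coords)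

lemma act_inj:
  assumes "\<And>m. m \<in> carrier M \<Longrightarrow> act f m = \<zero>\<^bsub>M\<^esub> \<Longrightarrow> m = \<zero>\<^bsub>M\<^esub>"
    and "m \<in> carrier M" "n \<in> carrier M" "act f m = act f n"
  shows "m = n"
proof -
  have "act f (m \<ominus>\<^bsub>M\<^esub> n) = \<zero>\<^bsub>M\<^esub>"
    using assms(2-4) by (simp add: M.minus_eq act_distrib act_minus M.r_neg)
  hence "m \<ominus>\<^bsub>M\<^esub> n = \<zero>\<^bsub>M\<^esub>" using assms by auto
  moreover have "m = (m \<ominus>\<^bsub>M\<^esub> n) \<oplus>\<^bsub>M\<^esub> n"
    using assms(2,3) by (simp add: M.minus_eq M.a_assoc M.l_neg)
  ultimately show ?thesis using assms(3) by simp
qed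

text \<open>Linear combinations with coefficients in \<open>S\<close>.  The family of vectors is indexed by itself.\<close>

definition lc :: "'m set \<Rightarrow> ('m \<Rightarrow> 'k fps fps) \<Rightarrow> 'm" where
  "lc B c = (\<Oplus>\<^bsub>M\<^esub>b\<in>B. act (fps_const (c b)) b)"

definition lspan :: "'m set \<Rightarrow> 'm set" where
  "lspan B = range (lc B)"

lemma lc_empty [simp]: "lc {} c = \<zero>\<^bsub>M\<^esub>"
  by (simp add: lc_def)

context
  fixes B assumes B: "finite B" "B \<subseteq> carrier M"
begin

lemma lc_closed [simp]: "lc B c \<in> carrier M"
  unfolding lc_def using B by (intro M.finsum_closed) auto

lemma lc_cong: "(\<And>b. b \<in> B \<Longrightarrow> c b = d b) \<Longrightarrow> lc B c = lc B d"
  unfolding lc_def using B by (intro M.finsum_cong') auto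

lemma lc_insert:
  "b \<in> carrier M \<Longrightarrow> b \<notin> B \<Longrightarrow> lc (insert b B) c = act (fps_const (c b)) b \<oplus>\<^bsub>M\<^esub> lc B c"
  unfolding lc_def using B by (intro M.finsum_insert) auto

lemma lc_add: "lc B (\<lambda>b. c b + d b) = lc B c \<oplus>\<^bsub>M\<^esub> lc B d"
proof -
  have "lc B c \<oplus>\<^bsub>M\<^esub> lc B d = (\<Oplus>\<^bsub>M\<^esub>b\<in>B. act (fps_const (c b)) b \<oplus>\<^bsub>M\<^esub> act (fps_const (d b)) b)"
    unfolding lc_def using B by (intro M.finsum_addf[symmetric]) auto
  also have "\<dots> = lc B (\<lambda>b. c b + d b)"
    unfolding lc_def using B
    by (intro M.finsum_cong') (auto simp: act_add[symmetric])
  finally show ?thesis ..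
qed

lemma lc_smult: "lc B (\<lambda>b. s * c b) = act (fps_const s) (lc B c)"
proof -
  have "act (fps_const s) (lc B c) = (\<Oplus>\<^bsub>M\<^esub>b\<in>B. act (fps_const s) (act (fps_const (c b)) b))"
    unfolding lc_def act_def using B by (intro finsum_smult_ldistr) auto
  also have "\<dots> = lc B (\<lambda>b. s * c b)"
    unfolding lc_def using B
    by (intro M.finsum_cong') (auto simp: act_mult[symmetric])
  finally show ?thesis ..
qed

lemma lc_zero [simp]: "lc B (\<lambda>b. 0) = \<zero>\<^bsub>M\<^esub>"
  using lc_smult[of 0 "\<lambda>b. 0"] by simp

lemma lc_diff: "lc B (\<lambda>b. c b - d b) = lc B c \<ominus>\<^bsub>M\<^esub> lc B d"
proof -
  have "lc B (\<lambda>b. c b + (- 1) * d b) = lc B c \<oplus>\<^bsub>M\<^esub> act (fps_const (- 1)) (lc B d)"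
    unfolding lc_add lc_smult ..
  thus ?thesis
    using act_uminus[of "lc B d" 1]
    by (simp add: M.minus_eq fps_const_neg[symmetric] del: fps_const_neg)
qed

lemma lc_single: "j \<in> B \<Longrightarrow> lc B (\<lambda>b. if b = j then 1 else 0) = j"
proof -
  assume j: "j \<in> B"
  have "lc B (\<lambda>b. if b = j then 1 else 0) = (\<Oplus>\<^bsub>M\<^esub>b\<in>B. if j = b then b else \<zero>\<^bsub>M\<^esub>)"
    unfolding lc_def using B by (intro M.finsum_cong') auto
  also have "\<dots> = j" using j B by (subst M.finsum_singleton) auto
  finally show ?thesis .
qed

lemma lspan_closed: "m \<in> lspan B \<Longrightarrow> m \<in> carrier M"
  by (auto simp: lspan_def)

lemma lspan_zero: "\<zero>\<^bsub>M\<^esub> \<in> lspan B"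
  using lc_zero by (metis lspan_def rangeI)

lemma lspan_add: "m \<in> lspan B \<Longrightarrow> n \<in> lspan B \<Longrightarrow> m \<oplus>\<^bsub>M\<^esub> n \<in> lspan B"
  by (auto simp: lspan_def lc_add[symmetric])

lemma lspan_diff: "m \<in> lspan B \<Longrightarrow> n \<in> lspan B \<Longrightarrow> m \<ominus>\<^bsub>M\<^esub> n \<in> lspan B"
  by (auto simp: lspan_def lc_diff[symmetric])

lemma lspan_act: "m \<in> lspan B \<Longrightarrow> act (fps_const s) m \<in> lspan B"
  by (auto simp: lspan_def lc_smult[symmetric])

lemma lspan_mem: "j \<in> B \<Longrightarrow> j \<in> lspan B"
  using lc_single by (metis lspan_def rangeI)

lemma lspan_minimal:
  assumes "\<zero>\<^bsub>M\<^esub> \<in> N" "\<And>m n. m \<in> N \<Longrightarrow> n \<in> N \<Longrightarrow> m \<oplus>\<^bsub>M\<^esub> n \<in> N"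
    and "\<And>b s. b \<in> B \<Longrightarrow> act (fps_const s) b \<in> N"
  shows "lspan B \<subseteq> N"
proof -
  have "lc B' c \<in> N" if "B' \<subseteq> B" for B' c
    using finite_subset[OF that B(1)] that
  proof (induction B')
    case (insert b B')
    have "lc (insert b B') c = act (fps_const (c b)) b \<oplus>\<^bsub>M\<^esub> lc B' c"
      unfolding lc_def using insert B by (intro M.finsum_insert) auto
    thus ?case using insert assms by auto
  qed (use assms in simp)
  thus ?thesis by (auto simp: lspan_def)
qed

end

lemma lc_remove:
  assumes "finite B" "B \<subseteq> carrier M" "j \<in> B"
  shows "lc B c = act (fps_const (c j)) j \<oplus>\<^bsub>M\<^esub> lc (B - {j}) c"
  using lc_insert[of "B - {j}" j c] assms by (auto simp: insert_absorb)

text \<open>Induction on the number of generators.  The coefficients at a generator \<open>b\<close> of elements of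
  \<open>D\<close> form an ideal \<open>E\<close> with \<open>E = x E + I\<close>, where \<open>I\<close> consists of the scalars that move \<open>b\<close> into the
  span of the other generators.  By \<open>Krull_ideal\<close>, \<open>b\<close> can be dispensed with.\<close>

lemma Krull_module:
  assumes B: "finite B" "B \<subseteq> carrier M" and D: "D \<subseteq> lspan B"
    and zero: "\<zero>\<^bsub>M\<^esub> \<in> D" and add: "\<And>d e. d \<in> D \<Longrightarrow> e \<in> D \<Longrightarrow> d \<oplus>\<^bsub>M\<^esub> e \<in> D"
    and smult: "\<And>d s. d \<in> D \<Longrightarrow> act (fps_const s) d \<in> D"
    and x: "\<And>d. d \<in> D \<Longrightarrow> \<exists>d'\<in>D. d = act var_x d'"
  shows "D \<subseteq> {\<zero>\<^bsub>M\<^esub>}"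
  using B D
proof (induction B)
  case empty
  thus ?case by (auto simp: lspan_def)
next
  case (insert b B)
  have B: "finite B" "B \<subseteq> carrier M" and b: "b \<in> carrier M" using insert by auto
  note span = lspan_zero[OF B] lspan_add[OF B] lspan_act[OF B] lspan_diff[OF B] lspan_closed[OF B]
  define E where "E = {s. \<exists>m\<in>lspan B. act (fps_const s) b \<oplus>\<^bsub>M\<^esub> m \<in> D}"
  define I where "I = {s. act (fps_const s) b \<in> lspan B}"
  have decomp: "\<exists>s. \<exists>m\<in>lspan B. d = act (fps_const s) b \<oplus>\<^bsub>M\<^esub> m" if d: "d \<in> D" for d
  proof -
    obtain c where "d = lc (insert b B) c" using d insert.prems(2) unfolding lspan_def by blast
    hence "d = act (fps_const (c b)) b \<oplus>\<^bsub>M\<^esub> lc B c" using lc_insert[OF B b] insert by auto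
    thus ?thesis by (auto simp: lspan_def)
  qed
  have "E \<subseteq> I"
  proof (rule Krull_ideal)
    show "is_ideal I"
      unfolding is_ideal_def I_def using span b
      by (auto simp: fps_const_add[symmetric] fps_const_mult[symmetric] act_add act_mult
          simp del: fps_const_add fps_const_mult)
    show "is_ideal E"
      unfolding is_ideal_def
    proof (intro conjI ballI allI)
      show "0 \<in> E" unfolding E_def using span(1) zero b by (auto intro!: bexI[of _ "\<zero>\<^bsub>M\<^esub>"])
      fix f assume "f \<in> E"
      then obtain m where m: "m \<in> lspan B" "act (fps_const f) b \<oplus>\<^bsub>M\<^esub> m \<in> D" by (auto simp: E_def)
      show "h * f \<in> E" for h
      proof -
        have "act (fps_const h) (act (fps_const f) b \<oplus>\<^bsub>M\<^esub> m)
            = act (fps_const (h * f)) b \<oplus>\<^bsub>M\<^esub> act (fps_const h) m"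
          using m b span by (simp add: act_distrib act_mult fps_const_mult[symmetric] del: fps_const_mult)
        thus ?thesis using smult[OF m(2), of h] span(3)[OF m(1), of h] by (auto simp: E_def)
      qed
      fix g assume "g \<in> E"
      then obtain n where n: "n \<in> lspan B" "act (fps_const g) b \<oplus>\<^bsub>M\<^esub> n \<in> D" by (auto simp: E_def)
      have "(act (fps_const f) b \<oplus>\<^bsub>M\<^esub> m) \<oplus>\<^bsub>M\<^esub> (act (fps_const g) b \<oplus>\<^bsub>M\<^esub> n)
          = act (fps_const (f + g)) b \<oplus>\<^bsub>M\<^esub> (m \<oplus>\<^bsub>M\<^esub> n)"
        using m n b span(5)
        by (simp add: act_add fps_const_add[symmetric] M.a_ac del: fps_const_add)
      thus "f + g \<in> E" using add[OF m(2) n(2)] span(2)[OF m(1) n(1)] by (auto simp: E_def)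
    qed
    show "I \<subseteq> E"
    proof
      fix s assume "s \<in> I"
      hence "act (fps_const s) b \<in> lspan B" by (simp add: I_def)
      hence "\<zero>\<^bsub>M\<^esub> \<ominus>\<^bsub>M\<^esub> act (fps_const s) b \<in> lspan B" using span by blast
      moreover have "act (fps_const s) b \<oplus>\<^bsub>M\<^esub> (\<zero>\<^bsub>M\<^esub> \<ominus>\<^bsub>M\<^esub> act (fps_const s) b) = \<zero>\<^bsub>M\<^esub>"
        using b by (simp add: M.minus_eq M.r_neg)
      ultimately show "s \<in> E"
        unfolding E_def using zero by (metis (mono_tags, lifting) mem_Collect_eq)
    qed
    fix s assume "s \<in> E"
    then obtain m where m: "m \<in> lspan B" "act (fps_const s) b \<oplus>\<^bsub>M\<^esub> m \<in> D" by (auto simp: E_def)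
    obtain d where d: "d \<in> D" "act (fps_const s) b \<oplus>\<^bsub>M\<^esub> m = act var_x d" using x[OF m(2)] by blast
    obtain t n where n: "n \<in> lspan B" "d = act (fps_const t) b \<oplus>\<^bsub>M\<^esub> n" using decomp[OF d(1)] by blast
    have "act (fps_const s) b \<oplus>\<^bsub>M\<^esub> m = act var_x (act (fps_const t) b) \<oplus>\<^bsub>M\<^esub> act var_x n"
      using d n b span(5) by (simp add: act_distrib)
    also have "act var_x (act (fps_const t) b) = act (fps_const (fps_const fps_X * t)) b"
      using b by (simp add: act_mult fps_const_mult[symmetric] var_x_def del: fps_const_mult)
    finally have eq: "act (fps_const s) b \<oplus>\<^bsub>M\<^esub> m
        = act (fps_const (fps_const fps_X * t)) b \<oplus>\<^bsub>M\<^esub> act var_x n" .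
    have "act (fps_const (s - fps_const fps_X * t)) b
        = act (fps_const s) b \<ominus>\<^bsub>M\<^esub> act (fps_const (fps_const fps_X * t)) b"
      using b by (simp add: act_diff fps_const_sub[symmetric] del: fps_const_sub)
    also have "\<dots> = (act (fps_const s) b \<oplus>\<^bsub>M\<^esub> m)
        \<ominus>\<^bsub>M\<^esub> act (fps_const (fps_const fps_X * t)) b \<ominus>\<^bsub>M\<^esub> m"
      using b m span(5) by (simp add: M.minus_eq M.a_ac M.r_neg M.r_neg2)
    also have "\<dots> = act var_x n \<ominus>\<^bsub>M\<^esub> m"
      unfolding eq using b m n span(5)
      by (simp add: M.minus_eq M.a_ac M.r_neg2 M.r_neg)
    also have "\<dots> \<in> lspan B" using m n span(3,4) unfolding var_x_def by blast
    finally have "s - fps_const fps_X * t \<in> I" by (simp add: I_def)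
    moreover have "t \<in> E" using n d by (auto simp: E_def)
    ultimately show "\<exists>t\<in>E. s - fps_const fps_X * t \<in> I" by blast
  qed
  hence "D \<subseteq> lspan B"
  proof (intro subsetI)
    fix d assume d: "d \<in> D"
    then obtain s m where m: "m \<in> lspan B" "d = act (fps_const s) b \<oplus>\<^bsub>M\<^esub> m" using decomp by blast
    hence "s \<in> E" using d by (auto simp: E_def)
    hence "act (fps_const s) b \<in> lspan B" using \<open>E \<subseteq> I\<close> by (auto simp: I_def)
    thus "d \<in> lspan B" using m span by auto
  qed
  thus ?case using insert.IH B by blast
qed

text \<open>The generators and their multiples by \<open>z\<close> generate over \<open>S\<close>.\<close>

lemma fin_gen_span:
  assumes "fin_gen E8_ring M"
  obtains B where "finite B" "B \<subseteq> carrier M" "lspan B = carrier M"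
proof -
  obtain S where S: "finite S" "S \<subseteq> carrier M" "gen_submodule E8_ring M S = carrier M"
    using assms unfolding fin_gen_def by blast
  define B where "B = S \<union> act fps_X ` S"
  have B: "finite B" "B \<subseteq> carrier M" using S by (auto simp: B_def)
  note span = lspan_zero[OF B] lspan_add[OF B] lspan_act[OF B] lspan_diff[OF B] lspan_closed[OF B]
  have X: "act fps_X m \<in> lspan B" if "m \<in> lspan B" for m
  proof -
    have "lspan B \<subseteq> {m \<in> carrier M. act fps_X m \<in> lspan B}"
    proof (rule lspan_minimal[OF B])
      fix b s assume b: "b \<in> B"
      have "act fps_X b \<in> lspan B"
      proof (cases "b \<in> S")
        case True
        thus ?thesis using lspan_mem[OF B] by (auto simp: B_def)
      next
        case False
        then obtain c where c: "c \<in> S" "b = act fps_X c" using b by (auto simp: B_def)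
        hence "act fps_X b = act (fps_const (- e8_branch)) c" using S act_square_X by auto
        thus ?thesis using c span(3)[OF lspan_mem[OF B]] by (auto simp: B_def)
      qed
      moreover have "act fps_X (act (fps_const s) b) = act (fps_const s) (act fps_X b)"
        using b B by (intro act_commute) auto
      ultimately show "act (fps_const s) b \<in> {m \<in> carrier M. act fps_X m \<in> lspan B}"
        using b B span(3) by auto
    qed (use span in \<open>auto simp: act_distrib\<close>)
    thus ?thesis using that by auto
  qed
  have act_span: "act h m \<in> lspan B" if "m \<in> lspan B" for h m
    using act_coords[of m h] that X span by auto
  have "submodule (lspan B) E8_ring M"
  proof (rule submoduleI)
    show "a \<odot>\<^bsub>M\<^esub> m \<in> lspan B" if "a \<in> carrier E8_ring" "m \<in> lspan B" for a m
      using that act_span by (auto simp: E8_carrier act_def)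
    show "\<ominus>\<^bsub>M\<^esub> m \<in> lspan B" if "m \<in> lspan B" for m
      using span(4)[OF span(1) that] span(5)[OF that] by (simp add: M.minus_eq)
  qed (use span in auto)
  moreover have "S \<subseteq> lspan B" using lspan_mem[OF B] by (auto simp: B_def)
  ultimately have "carrier M \<subseteq> lspan B"
    using S(3) unfolding gen_submodule_def by blast
  thus ?thesis using that B span(5) by blast
qed

lemma submodule_zero: "submodule N E8_ring M \<Longrightarrow> \<zero>\<^bsub>M\<^esub> \<in> N"
  using subgroup.one_closed[OF submodule.axioms(1)] by fastforce

text \<open>The scalars that map \<open>M\<close> into \<open>N\<close> form an ideal.\<close>

lemma ideal_smult_minimal:
  assumes sub: "submodule N E8_ring M" and S: "S \<subseteq> carrier E8_ring"
    and SN: "\<And>s m. s \<in> S \<Longrightarrow> m \<in> carrier M \<Longrightarrow> s \<odot>\<^bsub>M\<^esub> m \<in> N"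
  shows "ideal_smult E8_ring (Idl\<^bsub>E8_ring\<^esub> S) M \<subseteq> N"
proof -
  note N = submoduleE[OF sub] submodule_zero[OF sub]
  define J where "J = {a \<in> carrier E8_ring. \<forall>m\<in>carrier M. a \<odot>\<^bsub>M\<^esub> m \<in> N}"
  have "ideal J E8_ring"
  proof (rule idealI)
    show "ring (E8_ring :: 'k fps3 set ring)" by (rule R.ring_axioms)
    show "subgroup J (add_monoid E8_ring)"
    proof (rule R.add.subgroupI)
      have "\<zero>\<^bsub>E8_ring\<^esub> \<in> J" using N(7) by (auto simp: J_def)
      thus "J \<noteq> {}" by auto
    qed (use N(3,5) in \<open>auto simp: J_def smult_l_distr smult_l_minus\<close>)
    show "x \<otimes>\<^bsub>E8_ring\<^esub> a \<in> J" if "a \<in> J" "x \<in> carrier E8_ring" for a x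
      using that N(4) by (auto simp: J_def smult_assoc1)
    thus "a \<otimes>\<^bsub>E8_ring\<^esub> x \<in> J" if "a \<in> J" "x \<in> carrier E8_ring" for a x
      using that by (auto simp: J_def R.m_comm)
  qed
  moreover have "S \<subseteq> J" using S SN by (auto simp: J_def)
  ultimately have "Idl\<^bsub>E8_ring\<^esub> S \<subseteq> J" by (rule R.genideal_minimal)
  thus ?thesis using sub unfolding ideal_smult_def gen_submodule_def J_def by blast
qed

lemma ideal_smult_mem:
  assumes "S \<subseteq> carrier E8_ring" "s \<in> Idl\<^bsub>E8_ring\<^esub> S" "m \<in> carrier M"
  shows "s \<odot>\<^bsub>M\<^esub> m \<in> ideal_smult E8_ring (Idl\<^bsub>E8_ring\<^esub> S) M"
  using assms unfolding ideal_smult_def gen_submodule_def by blast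

lemma ideal_smult_empty: "ideal_smult E8_ring (Idl\<^bsub>E8_ring\<^esub> {}) M = {\<zero>\<^bsub>M\<^esub>}"
proof
  show "ideal_smult E8_ring (Idl\<^bsub>E8_ring\<^esub> {}) M \<subseteq> {\<zero>\<^bsub>M\<^esub>}"
    by (rule ideal_smult_minimal) (auto intro!: submoduleI)
  show "{\<zero>\<^bsub>M\<^esub>} \<subseteq> ideal_smult E8_ring (Idl\<^bsub>E8_ring\<^esub> {}) M"
    unfolding ideal_smult_def gen_submodule_def
    using submodule_zero by blast
qed

definition pair_image :: "'k fps3 \<Rightarrow> 'k fps3 \<Rightarrow> 'm set" where
  "pair_image a b = {act a m \<oplus>\<^bsub>M\<^esub> act b n | m n. m \<in> carrier M \<and> n \<in> carrier M}"

lemma ideal_smult_pair: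
  "ideal_smult E8_ring (Idl\<^bsub>E8_ring\<^esub> {E8_class a, E8_class b}) M = pair_image a b"
proof
  show "ideal_smult E8_ring (Idl\<^bsub>E8_ring\<^esub> {E8_class a, E8_class b}) M \<subseteq> pair_image a b"
  proof (rule ideal_smult_minimal)
    have zero: "\<zero>\<^bsub>M\<^esub> = act a \<zero>\<^bsub>M\<^esub> \<oplus>\<^bsub>M\<^esub> act b \<zero>\<^bsub>M\<^esub>" by simp
    show "submodule (pair_image a b) E8_ring M"
    proof (rule submoduleI)
      show "pair_image a b \<subseteq> carrier M" by (auto simp: pair_image_def)
      show "\<zero>\<^bsub>M\<^esub> \<in> pair_image a b" unfolding pair_image_def using zero by blast
      show "\<ominus>\<^bsub>M\<^esub> u \<in> pair_image a b" if u: "u \<in> pair_image a b" for u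
      proof -
        obtain m n where mn: "m \<in> carrier M" "n \<in> carrier M" "u = act a m \<oplus>\<^bsub>M\<^esub> act b n"
          using u by (auto simp: pair_image_def)
        hence "\<ominus>\<^bsub>M\<^esub> u = act a (\<ominus>\<^bsub>M\<^esub> m) \<oplus>\<^bsub>M\<^esub> act b (\<ominus>\<^bsub>M\<^esub> n)"
          by (simp add: act_minus M.minus_add)
        thus ?thesis using mn unfolding pair_image_def by blast
      qed
      show "u \<oplus>\<^bsub>M\<^esub> v \<in> pair_image a b" if uv: "u \<in> pair_image a b" "v \<in> pair_image a b" for u v
      proof -
        obtain m n m' n' where mn: "m \<in> carrier M" "n \<in> carrier M" "u = act a m \<oplus>\<^bsub>M\<^esub> act b n"
          "m' \<in> carrier M" "n' \<in> carrier M" "v = act a m' \<oplus>\<^bsub>M\<^esub> act b n'"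
          using uv by (auto simp: pair_image_def)
        hence "u \<oplus>\<^bsub>M\<^esub> v = act a (m \<oplus>\<^bsub>M\<^esub> m') \<oplus>\<^bsub>M\<^esub> act b (n \<oplus>\<^bsub>M\<^esub> n')"
          by (simp add: act_distrib M.a_ac)
        thus ?thesis using mn unfolding pair_image_def by blast
      qed
      show "r \<odot>\<^bsub>M\<^esub> u \<in> pair_image a b" if u: "r \<in> carrier E8_ring" "u \<in> pair_image a b" for r u
      proof -
        obtain m n where mn: "m \<in> carrier M" "n \<in> carrier M" "u = act a m \<oplus>\<^bsub>M\<^esub> act b n"
          using u by (auto simp: pair_image_def)
        obtain h where h: "r = E8_class h" using u by (auto simp: E8_carrier)
        have "r \<odot>\<^bsub>M\<^esub> u = act a (act h m) \<oplus>\<^bsub>M\<^esub> act b (act h n)"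
          using mn by (simp add: h act_def[of h, symmetric] act_distrib act_commute[of _ h])
        thus ?thesis using mn unfolding pair_image_def by blast
      qed
    qed
    fix s m assume s: "s \<in> {E8_class a, E8_class b}" and m: "m \<in> carrier M"
    have "act a m = act a m \<oplus>\<^bsub>M\<^esub> act b \<zero>\<^bsub>M\<^esub>" "act b m = act a \<zero>\<^bsub>M\<^esub> \<oplus>\<^bsub>M\<^esub> act b m" using m by simp_all
    hence "act a m \<in> pair_image a b" "act b m \<in> pair_image a b"
      unfolding pair_image_def using m by blast+
    thus "s \<odot>\<^bsub>M\<^esub> m \<in> pair_image a b" using s by (auto simp: act_def)
  qed auto
  show "pair_image a b \<subseteq> ideal_smult E8_ring (Idl\<^bsub>E8_ring\<^esub> {E8_class a, E8_class b}) M"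
  proof
    fix u assume "u \<in> pair_image a b"
    then obtain m n where mn: "m \<in> carrier M" "n \<in> carrier M" "u = act a m \<oplus>\<^bsub>M\<^esub> act b n"
      by (auto simp: pair_image_def)
    have "{E8_class a, E8_class b} \<subseteq> Idl\<^bsub>E8_ring\<^esub> {E8_class a, E8_class b}"
      by (rule R.genideal_self) auto
    hence "act a m \<in> ideal_smult E8_ring (Idl\<^bsub>E8_ring\<^esub> {E8_class a, E8_class b}) M"
      "act b n \<in> ideal_smult E8_ring (Idl\<^bsub>E8_ring\<^esub> {E8_class a, E8_class b}) M"
      unfolding act_def using mn by (auto intro!: ideal_smult_mem)
    thus "u \<in> ideal_smult E8_ring (Idl\<^bsub>E8_ring\<^esub> {E8_class a, E8_class b}) M"
      unfolding mn(3) ideal_smult_def gen_submodule_def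
      using submoduleE(5) by blast
  qed
qed

lemma ideal_smult_single:
  "ideal_smult E8_ring (Idl\<^bsub>E8_ring\<^esub> {E8_class a}) M = act a ` carrier M"
proof -
  have "pair_image a a = act a ` carrier M"
  proof
    show "pair_image a a \<subseteq> act a ` carrier M"
      by (auto simp: pair_image_def act_distrib[symmetric])
    show "act a ` carrier M \<subseteq> pair_image a a"
    proof
      fix u assume "u \<in> act a ` carrier M"
      then obtain m where "m \<in> carrier M" "u = act a m \<oplus>\<^bsub>M\<^esub> act a \<zero>\<^bsub>M\<^esub>" by auto
      thus "u \<in> pair_image a a" unfolding pair_image_def by blast
    qed
  qed
  thus ?thesis using ideal_smult_pair[of a a] by simp
qed

end


section \<open>Maximal Cohen-Macaulay modules are free over power series in two variables\<close>

lemma fps2_nonunit: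
  fixes p :: "'k::field fps fps"
  assumes "fps_nth (fps_nth p 0) 0 = 0"
  shows "p = fps_const fps_X * fps_const (fps_shift 1 (fps_nth p 0)) + fps_X * fps_shift 1 p"
proof -
  have "fps_nth p 0 = fps_X * fps_shift 1 (fps_nth p 0)" using assms fps_split0[of "fps_nth p 0"] by simp
  thus ?thesis using fps_split0[of p] by simp
qed

lemma var_x_coords [simp]: "e8_coords var_x = (fps_const fps_X, 0)"
  and var_y_coords [simp]: "e8_coords var_y = (fps_X, 0)"
  and var_z_coords [simp]: "e8_coords var_z = (0, 1)"
  by (simp_all add: var_x_def var_y_def var_z_def)

lemma e8_multiple_of_y:
  assumes "fps_nth (e8_re h) 0 = 0" "fps_nth (e8_im h) 0 = 0"
  shows "\<exists>h'. E8_class h = E8_class (var_y * h')"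
  using fps_split0[of "e8_re h"] fps_split0[of "e8_im h"] assms
  by (intro exI[of _ "e8_rep (fps_shift 1 (e8_re h)) (fps_shift 1 (e8_im h))"])
     (simp add: E8_class_eq_iff_coords prod_eq_iff)

lemma branch_split:
  fixes x y p q s t :: "'a::comm_ring_1"
  shows "x * s * p + y * t * p - (x ^ 3 + y ^ 5) * (q * q)
    = x * (s * p - x ^ 2 * q ^ 2) + y * (t * p - y ^ 4 * q ^ 2)"
  by (simp add: eval_nat_numeral algebra_simps)

text \<open>The maximal ideal of \<open>R\<close> has its square in \<open>(x, y) R\<close>, because \<open>z\<^sup>2 = - g\<close>.\<close>

lemma nonunit_square:
  assumes h: "fps_nth (fps_nth (e8_re h) 0) 0 = 0"
  shows "\<exists>\<gamma> \<delta>. E8_class (h * h) = E8_class (var_x * \<gamma> + var_y * \<delta>)"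
proof -
  define p q where "p = e8_re h" and "q = e8_im h"
  define s t where "s = fps_const (fps_shift 1 (fps_nth p 0))" and "t = fps_shift 1 p"
  have p: "p = fps_const fps_X * s + fps_X * t" using fps2_nonunit h by (simp add: p_def s_def t_def)
  have pp: "p * p = fps_const fps_X * s * p + fps_X * t * p"
    and pq: "p * q = fps_const fps_X * s * q + fps_X * t * q"
    using p by (metis distrib_right)+
  have g: "e8_branch = fps_const fps_X ^ 3 + fps_X ^ 5" by (simp add: e8_branch_def)
  have re: "p * p - e8_branch * (q * q)
      = fps_const fps_X * (s * p - fps_const fps_X ^ 2 * q\<^sup>2) + fps_X * (t * p - fps_X ^ 4 * q\<^sup>2)"
    unfolding pp g by (rule branch_split)
  have im: "p * q + q * p = fps_const fps_X * (2 * s * q) + fps_X * (2 * t * q)"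
    unfolding mult.commute[of q p] pq by (simp add: algebra_simps)
  have "E8_class (h * h) = E8_class (var_x * e8_rep (s * p - fps_const fps_X ^ 2 * q\<^sup>2) (2 * s * q)
      + var_y * e8_rep (t * p - fps_X ^ 4 * q\<^sup>2) (2 * t * q))"
    unfolding E8_class_eq_iff_coords e8_coords_add e8_coords_mult p_def[symmetric] q_def[symmetric] re im
    by simp
  thus ?thesis by blast
qed

text \<open>The ring \<open>R/(y)\<close> is one-dimensional: the norm of an element \<open>h\<close> outside \<open>(y)\<close> is modulo \<open>y\<close> a
  unit times a power of \<open>x\<close>.\<close>

lemma e8_x_power:
  assumes "\<not> (fps_nth (e8_re h) 0 = 0 \<and> fps_nth (e8_im h) 0 = 0)"
  shows "\<exists>e \<alpha> \<beta>. E8_class (var_x ^ e) = E8_class (h * \<alpha> + var_y * \<beta>)"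
proof -
  define p q where "p = e8_re h" and "q = e8_im h"
  define N where "N = p\<^sup>2 + e8_branch * q\<^sup>2"
  have N0: "fps_nth N 0 = (fps_nth p 0)\<^sup>2 + fps_X ^ 3 * (fps_nth q 0)\<^sup>2"
    by (simp add: N_def e8_branch_0 power2_eq_square)
  hence "fps_nth N 0 \<noteq> 0" using cubic_norm_zero[of "fps_nth p 0" "fps_nth q 0"] assms
    by (auto simp: p_def q_def)
  then obtain v where v: "v * fps_nth N 0 = fps_X ^ subdegree (fps_nth N 0)" by (rule fps1_decompose)
  define e where "e = subdegree (fps_nth N 0)"
  have vN: "fps_const v * N = fps_const fps_X ^ e + fps_X * (fps_const v * fps_shift 1 N)"
    using v by (subst (1) fps_split0[of N])
      (simp add: distrib_left e_def mult_ac)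
  have "E8_class (var_x ^ e) = E8_class (h * (fps_const (fps_const v) * e8_rep p (- q))
      + var_y * fps_const (- (fps_const v * fps_shift 1 N)))"
  proof -
    have "e8_coords (var_x ^ e) = (fps_const fps_X ^ e, 0)"
      by (simp add: var_x_def)
    moreover have "fps_const v * N = fps_const v * (p * p + e8_branch * (q * q))"
      by (simp add: N_def power2_eq_square)
    ultimately show ?thesis using vN
      unfolding E8_class_eq_iff_coords e8_coords_add e8_coords_mult p_def[symmetric] q_def[symmetric]
      by (simp add: prod_eq_iff algebra_simps)
  qed
  thus ?thesis by blast
qed

context e8_module begin

lemma nonunit_of_regular_sequence:
  assumes "regular_sequence E8_ring M xs" "E8_class h \<in> set xs"
  shows "fps_nth (fps_nth (e8_re h) 0) 0 = 0"
proof (rule ccontr)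
  assume "fps_nth (fps_nth (e8_re h) 0) 0 \<noteq> 0"
  then obtain h' where h': "E8_class (h' * h) = E8_class 1" by (rule e8_unit)
  have xs: "set xs \<subseteq> carrier E8_ring" using assms by (simp add: regular_sequence_def)
  interpret I: ideal "Idl\<^bsub>E8_ring\<^esub> (set xs)" "E8_ring :: 'k fps3 set ring"
    by (rule R.genideal_ideal[OF xs])
  have "E8_class h \<in> Idl\<^bsub>E8_ring\<^esub> (set xs)" using R.genideal_self[OF xs] assms by blast
  hence "E8_class (h' * h) \<in> Idl\<^bsub>E8_ring\<^esub> (set xs)"
    unfolding E8_class_mult by (rule I.I_l_closed) simp
  hence one: "\<one>\<^bsub>E8_ring\<^esub> \<in> Idl\<^bsub>E8_ring\<^esub> (set xs)" using h' by (simp add: E8_class_one)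
  have "carrier M \<subseteq> ideal_smult E8_ring (Idl\<^bsub>E8_ring\<^esub> (set xs)) M"
    using ideal_smult_mem[OF xs one] by auto
  moreover have "ideal_smult E8_ring (Idl\<^bsub>E8_ring\<^esub> (set xs)) M \<subseteq> carrier M"
    using xs by (intro ideal_smult_minimal carrier_is_submodule) auto
  ultimately show False using assms by (auto simp: regular_sequence_def)
qed

definition nzd :: "'k fps3 \<Rightarrow> bool" where
  "nzd a \<longleftrightarrow> (\<forall>m\<in>carrier M. act a m = \<zero>\<^bsub>M\<^esub> \<longrightarrow> m = \<zero>\<^bsub>M\<^esub>)"

lemma nzd_inj:
  assumes "nzd a" "m \<in> carrier M" "n \<in> carrier M" "act a m = act a n"
  shows "m = n"
  by (rule act_inj[OF _ assms(2-4)]) (use assms(1) in \<open>simp add: nzd_def\<close>)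

definition nzd_mod :: "'k fps3 \<Rightarrow> 'k fps3 \<Rightarrow> bool" where
  "nzd_mod a b \<longleftrightarrow> (\<forall>m\<in>carrier M. act b m \<in> act a ` carrier M \<longrightarrow> m \<in> act a ` carrier M)"

lemma regular_sequence_start:
  assumes reg: "regular_sequence E8_ring M xs" and len: "length xs \<ge> 2"
  obtains a b where "xs ! 0 = E8_class a" "xs ! 1 = E8_class b"
    "fps_nth (fps_nth (e8_re a) 0) 0 = 0" "fps_nth (fps_nth (e8_re b) 0) 0 = 0"
    "nzd a" "nzd_mod a b"
proof -
  have xs: "set xs \<subseteq> carrier E8_ring" using reg by (simp add: regular_sequence_def)
  have "xs ! 0 \<in> carrier E8_ring" "xs ! 1 \<in> carrier E8_ring"
    using len by (auto intro!: subsetD[OF xs] nth_mem)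
  then obtain a b where ab: "xs ! 0 = E8_class a" "xs ! 1 = E8_class b" by (auto simp: E8_carrier)
  have cond: "xs ! i \<odot>\<^bsub>M\<^esub> m \<in> ideal_smult E8_ring (Idl\<^bsub>E8_ring\<^esub> (set (take i xs))) M
      \<longrightarrow> m \<in> ideal_smult E8_ring (Idl\<^bsub>E8_ring\<^esub> (set (take i xs))) M" if "i < length xs" "m \<in> carrier M" for i m
    using reg that by (simp add: regular_sequence_def)
  have "set (take 1 xs) = {E8_class a}" using ab len by (cases xs) auto
  hence "nzd_mod a b"
    unfolding nzd_mod_def using cond[of 1] len ab by (simp add: ideal_smult_single act_def)
  moreover have "nzd a"
    unfolding nzd_def using cond[of 0] len ab by (cases xs) (simp_all add: ideal_smult_empty act_def)
  moreover have "xs ! 0 \<in> set xs" "xs ! 1 \<in> set xs" using len by (auto intro!: nth_mem)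
  hence "E8_class a \<in> set xs" "E8_class b \<in> set xs" unfolding ab .
  ultimately show ?thesis using that ab nonunit_of_regular_sequence[OF reg] by blast
qed

lemma maximal_CM_regular_pair:
  assumes "maximal_CM E8_ring M"
  obtains a b where
    "fps_nth (fps_nth (e8_re a) 0) 0 = 0" "fps_nth (fps_nth (e8_re b) 0) 0 = 0"
    "nzd a" "nzd_mod a b"
proof -
  have depth: "module_depth E8_ring M = 2"
    using assms by (simp add: maximal_CM_def krull_dim_E8)
  have "\<exists>xs. regular_sequence E8_ring M xs \<and> length xs \<ge> 2"
  proof (rule ccontr)
    assume "\<not> ?thesis"
    hence "length xs \<le> 1" if "regular_sequence E8_ring M xs" for xs using that by force
    hence "module_depth E8_ring M \<le> enat 1"
      unfolding module_depth_def by (intro SUP_least) auto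
    thus False using depth by (simp add: numeral_eq_enat)
  qed
  then obtain xs where "regular_sequence E8_ring M xs" "length xs \<ge> 2" by blast
  thus ?thesis by (rule regular_sequence_start) (rule that)
qed

lemma act_image_act:
  assumes "m \<in> act a ` carrier M"
  shows "act h m \<in> act a ` carrier M"
  using assms act_commute by fastforce

lemma act_image_add:
  "m \<in> act a ` carrier M \<Longrightarrow> n \<in> act a ` carrier M \<Longrightarrow> m \<oplus>\<^bsub>M\<^esub> n \<in> act a ` carrier M"
  by (auto simp: act_distrib[symmetric])

text \<open>Let \<open>N\<close> be the kernel of \<open>y\<close> on \<open>M\<close>.  The regular sequence \<open>a, b\<close> of \<open>M\<close> behaves on \<open>N\<close> like
  a regular sequence, but \<open>N\<close> is a module over the one-dimensional ring \<open>R/(y)\<close>, where a power of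
  \<open>b\<close> is a multiple of \<open>a\<close> (if \<open>a \<in> (y)\<close>, then \<open>a\<close> kills \<open>N\<close> and \<open>N = 0\<close> at once).  Hence \<open>N = a N\<close>, so \<open>N = x N\<close> because \<open>a\<^sup>2\<close> is on \<open>N\<close> a multiple of
  \<open>x\<close>, and Krull's intersection theorem gives \<open>N = 0\<close>.\<close>

lemma y_regular:
  assumes gen: "finite B" "B \<subseteq> carrier M" "lspan B = carrier M"
    and nonunit: "fps_nth (fps_nth (e8_re a) 0) 0 = 0" "fps_nth (fps_nth (e8_re b) 0) 0 = 0"
    and reg: "nzd a" "nzd_mod a b"
  shows "nzd var_y"
proof -
  define N where "N = {m \<in> carrier M. act var_y m = \<zero>\<^bsub>M\<^esub>}"
  have N_act: "act h m \<in> N" if "m \<in> N" for h m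
    using that act_commute[of m var_y h] by (auto simp: N_def)
  have act_N: "act f m = act g m" if m: "m \<in> N" and "E8_class f = E8_class (g + var_y * h)" for f g h m
  proof -
    have "act f m = act g m \<oplus>\<^bsub>M\<^esub> act (var_y * h) m"
      using m act_cong[OF that(2)] by (simp add: act_add N_def)
    also have "act (var_y * h) m = \<zero>\<^bsub>M\<^esub>"
      using m N_act[OF m, of h] by (simp add: act_mult N_def)
    finally show ?thesis using m by (simp add: N_def)
  qed
  have a_inj: "m = n" if "m \<in> carrier M" "n \<in> carrier M" "act a m = act a n" for m n
    by (rule nzd_inj[OF reg(1) that])
  have "N \<subseteq> {\<zero>\<^bsub>M\<^esub>}"
  proof (cases "fps_nth (e8_re a) 0 = 0 \<and> fps_nth (e8_im a) 0 = 0")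
    case True
    obtain h where h: "E8_class a = E8_class (0 + var_y * h)"
      using e8_multiple_of_y[OF True[THEN conjunct1] True[THEN conjunct2]] by auto
    show ?thesis
    proof
      fix m assume m: "m \<in> N"
      have "act a m = act 0 m" by (rule act_N[OF m h])
      thus "m \<in> {\<zero>\<^bsub>M\<^esub>}" using m reg(1) by (auto simp: N_def nzd_def)
    qed
  next
    case False
    then obtain e \<alpha> \<beta> where e: "E8_class (var_x ^ e) = E8_class (a * \<alpha> + var_y * \<beta>)"
      using e8_x_power by blast
    have "\<forall>m\<in>N. m \<in> act a ` carrier M"
    proof -
      \<comment> \<open>On \<open>N\<close>, \<open>b\<^sup>2\<close> is a multiple of \<open>x\<close>; cancelling it modulo \<open>a\<close> lowers the exponent of \<open>x\<close>.\<close>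
      have "\<forall>m\<in>N. act (var_x ^ (e - j)) m \<in> act a ` carrier M" if "j \<le> e" for j
        using that
      proof (induction j)
        case 0
        show ?case
        proof
          fix m assume m: "m \<in> N"
          have "act (var_x ^ e) m = act (a * \<alpha>) m" by (rule act_N[OF m e])
          also have "\<dots> = act a (act \<alpha> m)" using m by (simp add: act_mult N_def)
          finally show "act (var_x ^ (e - 0)) m \<in> act a ` carrier M" using m by (simp add: N_def)
        qed
      next
        case (Suc j)
        define i where "i = e - Suc j"
        have i: "e - j = Suc i" using Suc.prems by (simp add: i_def)
        obtain \<gamma> \<delta> where b2: "E8_class (b * b) = E8_class (var_x * \<gamma> + var_y * \<delta>)"
          using nonunit_square[OF nonunit(2)] by blast
        show ?case
        proof
          fix m assume m: "m \<in> N"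
          define n where "n = act (var_x ^ i) m"
          have n: "n \<in> N" "n \<in> carrier M" using N_act[OF m] by (auto simp: n_def N_def)
          have "act b (act b n) = act (b * b) n" using n by (simp add: act_mult)
          also have "\<dots> = act (var_x * \<gamma>) n" by (rule act_N[OF n(1) b2])
          also have "\<dots> = act (var_x ^ Suc i) (act \<gamma> m)"
            using m by (simp add: act_mult[symmetric] n_def N_def mult_ac)
          also have "\<dots> \<in> act a ` carrier M" using Suc N_act[OF m, of \<gamma>] i by auto
          finally have "act b (act b n) \<in> act a ` carrier M" .
          hence "act b n \<in> act a ` carrier M" using n reg(2) unfolding nzd_mod_def by blast
          hence "n \<in> act a ` carrier M" using n reg(2) unfolding nzd_mod_def by blast
          thus "act (var_x ^ (e - Suc j)) m \<in> act a ` carrier M" by (simp add: n_def i_def)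
        qed
      qed
      from this[of e] show ?thesis by (auto simp: N_def)
    qed
    hence div: "\<exists>n\<in>N. m = act a n" if m: "m \<in> N" for m
    proof -
      obtain n where n: "n \<in> carrier M" "m = act a n" using m \<open>\<forall>m\<in>N. _\<close> by blast
      have "act a (act var_y n) = act var_y m" using n act_commute by simp
      hence "act a (act var_y n) = act a \<zero>\<^bsub>M\<^esub>" using m by (simp add: N_def)
      hence "act var_y n = \<zero>\<^bsub>M\<^esub>" by (rule a_inj[rotated 2]) (use n in auto)
      thus ?thesis using n by (auto simp: N_def)
    qed
    obtain \<gamma> \<delta> where a2: "E8_class (a * a) = E8_class (var_x * \<gamma> + var_y * \<delta>)"
      using nonunit_square[OF nonunit(1)] by blast
    show ?thesis
    proof (rule Krull_module[OF gen(1,2)])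
      show "N \<subseteq> lspan B" using gen by (auto simp: N_def)
      show "\<zero>\<^bsub>M\<^esub> \<in> N" by (simp add: N_def)
      show "d \<oplus>\<^bsub>M\<^esub> e \<in> N" if "d \<in> N" "e \<in> N" for d e using that by (simp add: N_def act_distrib)
      show "act (fps_const s) d \<in> N" if "d \<in> N" for d s by (rule N_act[OF that])
      fix m assume "m \<in> N"
      then obtain n where n: "n \<in> N" "m = act a n" using div by blast
      then obtain n' where n': "n' \<in> N" "n = act a n'" using div by blast
      have "m = act (a * a) n'" using n n' by (simp add: act_mult N_def)
      also have "\<dots> = act (var_x * \<gamma>) n'" by (rule act_N[OF n'(1) a2])
      also have "\<dots> = act var_x (act \<gamma> n')" using n' by (simp add: act_mult N_def)
      finally show "\<exists>d'\<in>N. m = act var_x d'" using N_act[OF n'(1)] by blast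
    qed
  qed
  thus ?thesis by (auto simp: nzd_def N_def)
qed

lemma nzd_mod_square:
  assumes "nzd a" "nzd_mod a b"
  shows "nzd_mod (a * a) (b * b)"
proof -
  have a_inj: "m = n" if "m \<in> carrier M" "n \<in> carrier M" "act a m = act a n" for m n
    by (rule nzd_inj[OF assms(1) that])
  have *: "m \<in> act (a * a) ` carrier M" if m: "m \<in> carrier M" "act b m \<in> act (a * a) ` carrier M" for m
  proof -
    obtain w where w: "w \<in> carrier M" "act b m = act a (act a w)" using m by (auto simp: act_mult)
    hence "m \<in> act a ` carrier M" using m assms(2) by (auto simp: nzd_mod_def)
    then obtain v where v: "v \<in> carrier M" "m = act a v" by auto
    have "act a (act b v) = act a (act a w)" using v w act_commute[of v a b] by simp
    hence "act b v = act a w" by (rule a_inj[rotated 2]) (use v w in auto)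
    hence "v \<in> act a ` carrier M" using v w assms(2) by (auto simp: nzd_mod_def)
    thus ?thesis using v by (auto simp: act_mult image_iff)
  qed
  show ?thesis unfolding nzd_mod_def using * by (simp add: act_mult)
qed

text \<open>If \<open>x m \<in> y M\<close>, then \<open>a\<^sup>2 m\<close> and \<open>b\<^sup>2 m\<close> lie in \<open>y M\<close>, since \<open>a\<^sup>2\<close> and \<open>b\<^sup>2\<close> are in \<open>(x, y)\<close>.  As
  \<open>a\<^sup>2, b\<^sup>2\<close> is again a regular sequence, this gives \<open>m \<in> y M\<close>.\<close>

lemma x_regular_mod_y:
  assumes nonunit: "fps_nth (fps_nth (e8_re a) 0) 0 = 0" "fps_nth (fps_nth (e8_re b) 0) 0 = 0"
    and reg: "nzd a" "nzd_mod a b" and y: "nzd var_y"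
  shows "nzd_mod var_y var_x"
  unfolding nzd_mod_def
proof (intro ballI impI)
  fix m assume m: "m \<in> carrier M" and xm: "act var_x m \<in> act var_y ` carrier M"
  have inj: "m = n" if "m \<in> carrier M" "n \<in> carrier M" "act c m = act c n" "nzd c" for m n c
    by (rule nzd_inj[OF that(4,1-3)])
  have square: "act (c * c) m \<in> act var_y ` carrier M"
    if c: "fps_nth (fps_nth (e8_re c) 0) 0 = 0" for c
  proof -
    obtain \<gamma> \<delta> where c2: "E8_class (c * c) = E8_class (var_x * \<gamma> + var_y * \<delta>)"
      using nonunit_square[OF c] by blast
    have "act (c * c) m = act \<gamma> (act var_x m) \<oplus>\<^bsub>M\<^esub> act var_y (act \<delta> m)"
      using m act_cong[OF c2] by (simp add: act_add act_mult act_commute[of m \<gamma>])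
    thus ?thesis using m act_image_add[OF act_image_act[OF xm]] by simp
  qed
  obtain u where u: "u \<in> carrier M" "act (a * a) m = act var_y u"
    using square[OF nonunit(1)] by blast
  obtain v where v: "v \<in> carrier M" "act (b * b) m = act var_y v"
    using square[OF nonunit(2)] by blast
  have "act var_y (act (b * b) u) = act (b * b) (act (a * a) m)"
    unfolding u(2) by (rule act_commute[OF u(1)])
  also have "\<dots> = act (a * a) (act (b * b) m)" by (rule act_commute[OF m])
  also have "\<dots> = act var_y (act (a * a) v)" unfolding v(2) by (rule act_commute[OF v(1)])
  finally have "act (b * b) u = act (a * a) v" by (rule inj[OF _ _ _ y, rotated 2]) (use u v in auto)
  hence "act (b * b) u \<in> act (a * a) ` carrier M" using v(1) by simp
  hence "u \<in> act (a * a) ` carrier M"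
    using nzd_mod_square[OF reg] u(1) unfolding nzd_mod_def by blast
  then obtain w where w: "w \<in> carrier M" "u = act (a * a) w" by blast
  have "act a (act a m) = act var_y u" unfolding act_mult[OF m, symmetric] by (rule u(2))
  also have "\<dots> = act (a * a) (act var_y w)" unfolding w(2) by (rule act_commute[OF w(1)])
  also have "\<dots> = act a (act a (act var_y w))" using w(1) by (simp add: act_mult)
  finally have "act a (act a m) = act a (act a (act var_y w))" .
  hence "act a m = act a (act var_y w)" by (rule inj[OF _ _ _ reg(1), rotated 2]) (use m w in auto)
  hence "m = act var_y w" by (rule inj[OF _ _ _ reg(1), rotated 2]) (use m w in auto)
  thus "m \<in> act var_y ` carrier M" using w(1) by simp
qed

text \<open>A minimal generating set over \<open>S\<close> is a basis.  By minimality a relation has no unit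
  coefficients.  Since \<open>x\<close> is regular modulo \<open>y\<close>, a relation modulo \<open>y M\<close> with coefficients
  in power series in \<open>x\<close> can be divided by \<open>x\<close> again and again, so it is trivial; since
  \<open>y\<close> is regular, a relation can then be divided by \<open>y\<close> again and again.\<close>

lemma basis_exists:
  assumes fg: "fin_gen E8_ring M" and reg: "nzd var_y" "nzd_mod var_y var_x"
  obtains B where "finite B" "B \<subseteq> carrier M" "lspan B = carrier M"
    "\<forall>c. lc B c = \<zero>\<^bsub>M\<^esub> \<longrightarrow> (\<forall>b\<in>B. c b = 0)"
proof -
  define G where "G B \<longleftrightarrow> finite B \<and> B \<subseteq> carrier M \<and> lspan B = carrier M" for B
  obtain B0 where "finite B0" "B0 \<subseteq> carrier M" "lspan B0 = carrier M" by (rule fin_gen_span[OF fg])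
  hence "G B0" by (simp add: G_def)
  then obtain B where "G B" and min: "\<And>B'. G B' \<Longrightarrow> card B \<le> card B'"
    using ex_has_least_nat[of G B0 card] by blast
  hence B: "finite B" "B \<subseteq> carrier M" and gen: "lspan B = carrier M" by (auto simp: G_def)
  note lc = lc_closed[OF B] lc_add[OF B] lc_smult[OF B] lc_diff[OF B]
  have relation: "fps_nth (fps_nth (c j) 0) 0 = 0" if c: "lc B c = \<zero>\<^bsub>M\<^esub>" and j: "j \<in> B" for c j
  proof (rule ccontr)
    assume "fps_nth (fps_nth (c j) 0) 0 \<noteq> 0"
    then obtain v where v: "v * c j = 1" by (rule fps2_unit)
    have B': "finite (B - {j})" "B - {j} \<subseteq> carrier M" using B by auto
    note span = lspan_zero[OF B'] lspan_add[OF B'] lspan_act[OF B'] lspan_diff[OF B'] lspan_closed[OF B']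
    have "act (fps_const (v * c j)) j \<oplus>\<^bsub>M\<^esub> lc (B - {j}) (\<lambda>b. v * c b) = \<zero>\<^bsub>M\<^esub>"
      using lc_remove[OF B j, of "\<lambda>b. v * c b"] lc(3)[of v c] c by simp
    hence "j \<oplus>\<^bsub>M\<^esub> lc (B - {j}) (\<lambda>b. v * c b) = \<zero>\<^bsub>M\<^esub>" using v j B by auto
    moreover have jM: "j \<in> carrier M" using j B by auto
    ultimately have neg: "\<ominus>\<^bsub>M\<^esub> lc (B - {j}) (\<lambda>b. v * c b) = j"
      by (intro M.minus_equality) (simp_all add: lc_closed[OF B'])
    have "\<zero>\<^bsub>M\<^esub> \<ominus>\<^bsub>M\<^esub> lc (B - {j}) (\<lambda>b. v * c b) \<in> lspan (B - {j})"
      by (rule span(4)[OF span(1)]) (simp add: lspan_def)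
    hence jspan: "j \<in> lspan (B - {j})" unfolding M.minus_eq neg M.l_zero[OF jM] .
    have "lspan B \<subseteq> lspan (B - {j})"
    proof (rule lspan_minimal[OF B span(1,2)])
      fix b s assume "b \<in> B"
      thus "act (fps_const s) b \<in> lspan (B - {j})"
        using jspan lspan_mem[OF B'] span(3) by (cases "b = j") auto
    qed
    hence "G (B - {j})" using gen B' span(5) by (auto simp: G_def)
    thus False using min[of "B - {j}"] card_Diff1_less[OF B(1) j] by simp
  qed
  have level0: "fps_nth (fps_nth (c j) 0) 0 = 0"
    if c: "lc B (\<lambda>b. fps_const (fps_nth (c b) 0)) \<in> act var_y ` carrier M" and j: "j \<in> B" for c j
  proof -
    obtain n where n: "n \<in> carrier M" "lc B (\<lambda>b. fps_const (fps_nth (c b) 0)) = act var_y n"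
      using c by blast
    obtain d where "n = lc B d" using n(1) gen unfolding lspan_def by blast
    hence "lc B (\<lambda>b. fps_const (fps_nth (c b) 0)) = lc B (\<lambda>b. fps_X * d b)"
      using n(2) by (simp add: lc(3) var_y_def)
    hence "lc B (\<lambda>b. fps_const (fps_nth (c b) 0) - fps_X * d b) = \<zero>\<^bsub>M\<^esub>"
      unfolding lc(4) using lc(1) by (simp add: M.minus_eq M.r_neg)
    from relation[OF this j] show ?thesis by simp
  qed
  have level1: "\<forall>j\<in>B. fps_nth (c j) n = 0"
    if "lc B (\<lambda>b. fps_const (c b)) \<in> act var_y ` carrier M" for c :: "'m \<Rightarrow> 'k fps" and n
    using that
  proof (induction n arbitrary: c)
    case 0
    thus ?case using level0[of "\<lambda>b. fps_const (c b)"] by simp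
  next
    case (Suc n)
    have c: "c j = fps_X * fps_shift 1 (c j)" if "j \<in> B" for j
      using level0[of "\<lambda>b. fps_const (c b)" j] Suc.prems that fps_split0[of "c j"] by simp
    have "lc B (\<lambda>b. fps_const (c b)) = lc B (\<lambda>b. fps_const fps_X * fps_const (fps_shift 1 (c b)))"
      using c by (intro lc_cong[OF B]) simp
    also have "\<dots> = act var_x (lc B (\<lambda>b. fps_const (fps_shift 1 (c b))))"
      unfolding lc(3) by (simp add: var_x_def)
    finally have "lc B (\<lambda>b. fps_const (fps_shift 1 (c b))) \<in> act var_y ` carrier M"
      using reg(2) Suc.prems lc(1) by (auto simp: nzd_mod_def)
    from Suc.IH[OF this] show ?case by simp
  qed
  have y_step: "fps_nth (c j) 0 = 0" if c: "lc B c \<in> act var_y ` carrier M" and j: "j \<in> B" for c j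
  proof -
    have "lc B c = lc B (\<lambda>b. fps_const (fps_nth (c b) 0) + fps_X * fps_shift 1 (c b))"
      by (intro lc_cong[OF B]) (rule fps_split0)
    also have "\<dots> = lc B (\<lambda>b. fps_const (fps_nth (c b) 0)) \<oplus>\<^bsub>M\<^esub> act var_y (lc B (\<lambda>b. fps_shift 1 (c b)))"
      unfolding lc(2,3) by (simp add: var_y_def)
    finally have eq: "lc B c = lc B (\<lambda>b. fps_const (fps_nth (c b) 0))
      \<oplus>\<^bsub>M\<^esub> act var_y (lc B (\<lambda>b. fps_shift 1 (c b)))" .
    obtain n where n: "n \<in> carrier M" "lc B c = act var_y n" using c by auto
    have "lc B (\<lambda>b. fps_const (fps_nth (c b) 0))
        = act var_y n \<ominus>\<^bsub>M\<^esub> act var_y (lc B (\<lambda>b. fps_shift 1 (c b)))"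
      using eq n lc(1) by (simp add: M.minus_eq M.a_assoc M.r_neg)
    also have "\<dots> = act var_y (n \<ominus>\<^bsub>M\<^esub> lc B (\<lambda>b. fps_shift 1 (c b)))"
      using n lc(1) by (simp add: M.minus_eq act_distrib act_minus)
    finally have "lc B (\<lambda>b. fps_const (fps_nth (c b) 0)) \<in> act var_y ` carrier M"
      using n lc(1) by auto
    from level1[OF this] have "fps_nth (fps_nth (c j) 0) n = 0" for n using j by blast
    thus ?thesis by (intro fps_ext) simp
  qed
  have "\<forall>j\<in>B. fps_nth (c j) n = 0" if "lc B c = \<zero>\<^bsub>M\<^esub>" for c n
    using that
  proof (induction n arbitrary: c)
    case 0
    have "lc B c \<in> act var_y ` carrier M" using 0 by (auto intro!: image_eqI[of _ _ "\<zero>\<^bsub>M\<^esub>"])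
    thus ?case using y_step by blast
  next
    case (Suc n)
    have "lc B c \<in> act var_y ` carrier M" using Suc by (auto intro!: image_eqI[of _ _ "\<zero>\<^bsub>M\<^esub>"])
    hence "c j = fps_X * fps_shift 1 (c j)" if "j \<in> B" for j
      using y_step that fps_split0[of "c j"] by simp
    hence "lc B c = lc B (\<lambda>b. fps_X * fps_shift 1 (c b))" by (intro lc_cong[OF B])
    also have "\<dots> = act var_y (lc B (\<lambda>b. fps_shift 1 (c b)))"
      unfolding lc(3) by (simp add: var_y_def)
    finally have "act var_y (lc B (\<lambda>b. fps_shift 1 (c b))) = \<zero>\<^bsub>M\<^esub>" using Suc.prems by simp
    hence "lc B (\<lambda>b. fps_shift 1 (c b)) = \<zero>\<^bsub>M\<^esub>" using reg(1) lc(1) by (simp add: nzd_def)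
    from Suc.IH[OF this] show ?case by simp
  qed
  hence "\<forall>c. lc B c = \<zero>\<^bsub>M\<^esub> \<longrightarrow> (\<forall>b\<in>B. c b = 0)" by (simp add: fps_eq_iff)
  with B gen show ?thesis by (rule that)
qed

lemma maximal_CM_basis:
  assumes "maximal_CM E8_ring M"
  obtains B where "finite B" "B \<subseteq> carrier M" "lspan B = carrier M"
    "\<forall>c. lc B c = \<zero>\<^bsub>M\<^esub> \<longrightarrow> (\<forall>b\<in>B. c b = 0)" "B \<noteq> {}"
proof -
  have fg: "fin_gen E8_ring M" and nz: "carrier M \<noteq> {\<zero>\<^bsub>M\<^esub>}"
    using assms by (auto simp: maximal_CM_def)
  obtain a b where ab: "fps_nth (fps_nth (e8_re a) 0) 0 = 0" "fps_nth (fps_nth (e8_re b) 0) 0 = 0"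
    "nzd a" "nzd_mod a b" by (rule maximal_CM_regular_pair[OF assms])
  obtain B0 where "finite B0" "B0 \<subseteq> carrier M" "lspan B0 = carrier M" by (rule fin_gen_span[OF fg])
  from y_regular[OF this ab] have y: "nzd var_y" .
  obtain B where B: "finite B" "B \<subseteq> carrier M" "lspan B = carrier M"
    "\<forall>c. lc B c = \<zero>\<^bsub>M\<^esub> \<longrightarrow> (\<forall>b\<in>B. c b = 0)"
    by (rule basis_exists[OF fg y x_regular_mod_y[OF ab y]])
  have "B \<noteq> {}" using B(3) nz by (auto simp: lspan_def)
  with B show ?thesis by (rule that)
qed

end


section \<open>Square roots of the branch equation\<close>

lemma dependent_of_minors:
  fixes f g h :: "'i \<Rightarrow> 'k::field"
  assumes minors: "\<And>i j l. i \<in> I \<Longrightarrow> j \<in> I \<Longrightarrow> l \<in> I \<Longrightarrow>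
    f i * (g j * h l - g l * h j) - f j * (g i * h l - g l * h i) + f l * (g i * h j - g j * h i) = 0"
  obtains \<alpha> \<beta> \<gamma> where "(\<alpha>, \<beta>, \<gamma>) \<noteq> (0, 0, 0)"
    "\<And>i. i \<in> I \<Longrightarrow> \<alpha> * f i + \<beta> * g i + \<gamma> * h i = 0"
proof (cases "\<exists>i\<in>I. \<exists>j\<in>I. f i * g j - f j * g i \<noteq> 0")
  case True
  then obtain i j where ij: "i \<in> I" "j \<in> I" "f i * g j - f j * g i \<noteq> 0" by blast
  have "(g i * h j - g j * h i) * f l + (f j * h i - f i * h j) * g l + (f i * g j - f j * g i) * h l = 0"
    if "l \<in> I" for l
    using minors[OF ij(1,2) that] by (simp add: algebra_simps)
  with ij(3) show ?thesis
    by (intro that[of "g i * h j - g j * h i" "f j * h i - f i * h j" "f i * g j - f j * g i"]) auto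
next
  case False
  hence minor2: "f i * g j = f j * g i" if "i \<in> I" "j \<in> I" for i j using that by auto
  show ?thesis
  proof (cases "\<exists>i\<in>I. f i \<noteq> 0")
    case True
    then obtain i where i: "i \<in> I" "f i \<noteq> 0" by blast
    show ?thesis
      by (rule that[of "g i" "- f i" 0]) (use i minor2[OF i(1)] in \<open>auto simp: mult.commute\<close>)
  next
    case False
    show ?thesis by (rule that[of 1 0 0]) (use False in auto)
  qed
qed

text \<open>Cramer's rule: linear independence of the constant terms yields three of the given
  elements of \<open>T\<close> whose matrix of coefficients has a unit determinant.\<close>

lemma ideal_of_independent_entries:
  fixes T :: "'k::field fps3 set" and a b c :: "'i \<Rightarrow> 'k fps fps"
  assumes T: "is_ideal T"
    and mem: "\<And>i. i \<in> I \<Longrightarrow> fps_const (a i) * u + fps_const (b i) * v + fps_const (c i) * w \<in> T"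
    and indep: "\<And>\<alpha> \<beta> \<gamma>. (\<And>i. i \<in> I \<Longrightarrow> \<alpha> * fps_nth (fps_nth (a i) 0) 0
        + \<beta> * fps_nth (fps_nth (b i) 0) 0 + \<gamma> * fps_nth (fps_nth (c i) 0) 0 = 0)
      \<Longrightarrow> \<alpha> = 0 \<and> \<beta> = 0 \<and> \<gamma> = 0"
  shows "u \<in> T \<and> v \<in> T \<and> w \<in> T"
proof -
  define e where "e p = fps_nth (fps_nth p 0) 0" for p :: "'k fps fps"
  define D where "D i j l = a i * (b j * c l - b l * c j) - a j * (b i * c l - b l * c i)
    + a l * (b i * c j - b j * c i)" for i j l
  have "\<exists>i\<in>I. \<exists>j\<in>I. \<exists>l\<in>I. e (D i j l) \<noteq> 0"
  proof (rule ccontr)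
    assume "\<not> ?thesis"
    hence "e (a i) * (e (b j) * e (c l) - e (b l) * e (c j)) - e (a j) * (e (b i) * e (c l) - e (b l) * e (c i))
      + e (a l) * (e (b i) * e (c j) - e (b j) * e (c i)) = 0" if "i \<in> I" "j \<in> I" "l \<in> I" for i j l
      using that by (auto simp: e_def D_def)
    then obtain \<alpha> \<beta> \<gamma> where "(\<alpha>, \<beta>, \<gamma>) \<noteq> (0, 0, 0)"
      "\<And>i. i \<in> I \<Longrightarrow> \<alpha> * e (a i) + \<beta> * e (b i) + \<gamma> * e (c i) = 0"
      by (rule dependent_of_minors[of I "\<lambda>i. e (a i)" "\<lambda>i. e (b i)" "\<lambda>i. e (c i)"]) blast+
    thus False using indep[of \<alpha> \<beta> \<gamma>] by (auto simp: e_def)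
  qed
  then obtain i j l where ijl: "i \<in> I" "j \<in> I" "l \<in> I" "e (D i j l) \<noteq> 0" by blast
  then obtain d where d: "d * D i j l = 1" unfolding e_def by (metis fps2_unit)
  have unit: "z \<in> T" if "fps_const (D i j l) * z \<in> T" for z
  proof -
    have "fps_const d * (fps_const (D i j l) * z) = z"
      using d by (simp add: mult.assoc[symmetric])
    thus ?thesis using is_idealD(3)[OF T that, of "fps_const d"] by metis
  qed
  define t where "t i = fps_const (a i) * u + fps_const (b i) * v + fps_const (c i) * w" for i
  have t: "t i \<in> T" "t j \<in> T" "t l \<in> T" using mem ijl by (auto simp: t_def)
  note simps = t_def D_def fps_const_add[symmetric] fps_const_sub[symmetric] fps_const_mult[symmetric]
  have 1: "fps_const (D i j l) * u = fps_const (b j * c l - b l * c j) * t i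
      - fps_const (b i * c l - b l * c i) * t j + fps_const (b i * c j - b j * c i) * t l"
    by (simp add: simps algebra_simps del: fps_const_add fps_const_sub fps_const_mult)
  have 2: "fps_const (D i j l) * v = fps_const (a l * c j - a j * c l) * t i
      + fps_const (a i * c l - a l * c i) * t j + fps_const (a j * c i - a i * c j) * t l"
    by (simp add: simps algebra_simps del: fps_const_add fps_const_sub fps_const_mult)
  have 3: "fps_const (D i j l) * w = fps_const (a j * b l - a l * b j) * t i
      - fps_const (a i * b l - a l * b i) * t j + fps_const (a i * b j - a j * b i) * t l"
    by (simp add: simps algebra_simps del: fps_const_add fps_const_sub fps_const_mult)
  have "u \<in> T" by (rule unit, unfold 1) (intro is_idealD(2,3,5)[OF T] t)
  moreover have "v \<in> T" by (rule unit, unfold 2) (intro is_idealD(2,3,5)[OF T] t)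
  moreover have "w \<in> T" by (rule unit, unfold 3) (intro is_idealD(2,3,5)[OF T] t)
  ultimately show ?thesis by blast
qed

definition mat_mult :: "'i set \<Rightarrow> ('i \<Rightarrow> 'i \<Rightarrow> 'a) \<Rightarrow> ('i \<Rightarrow> 'i \<Rightarrow> 'a) \<Rightarrow> 'i \<Rightarrow> 'i \<Rightarrow> 'a::comm_semiring_0"
  where "mat_mult B U V i l = (\<Sum>j\<in>B. U i j * V j l)"

definition anticomm :: "'i set \<Rightarrow> ('i \<Rightarrow> 'i \<Rightarrow> 'a) \<Rightarrow> ('i \<Rightarrow> 'i \<Rightarrow> 'a) \<Rightarrow> 'i \<Rightarrow> 'i \<Rightarrow> 'a::comm_semiring_0"
  where "anticomm B U V i l = mat_mult B U V i l + mat_mult B V U i l"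

lemma mat_mult_scale:
  assumes "\<And>i j. i \<in> B \<Longrightarrow> j \<in> B \<Longrightarrow> U i j = c * V i j" "i \<in> B" "l \<in> B"
  shows "mat_mult B U W i l = c * mat_mult B V W i l" "mat_mult B W U i l = c * mat_mult B W V i l"
proof -
  show "mat_mult B U W i l = c * mat_mult B V W i l"
    unfolding mat_mult_def sum_distrib_left
    by (rule sum.cong) (simp_all add: assms(1)[OF assms(2)] mult.assoc)
  show "mat_mult B W U i l = c * mat_mult B W V i l"
    unfolding mat_mult_def sum_distrib_left
    by (rule sum.cong) (simp_all add: assms(1)[OF _ assms(3)] mult.left_commute)
qed

lemma anticomm_scale:
  assumes "\<And>i j. i \<in> B \<Longrightarrow> j \<in> B \<Longrightarrow> U i j = c * V i j" "i \<in> B" "l \<in> B"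
  shows "anticomm B U W i l = c * anticomm B V W i l"
  unfolding anticomm_def using mat_mult_scale[OF assms] by (simp add: distrib_left)

text \<open>A combination of \<open>U\<close> and \<open>V\<close> has square zero at the diagonal entry \<open>i\<close>, while the square
  of \<open>- \<gamma>\<close> times the identity is \<open>\<gamma>\<^sup>2\<close> there.\<close>

lemma square_zero_no_identity:
  fixes U V :: "'i \<Rightarrow> 'i \<Rightarrow> 'k::field"
  assumes B: "finite B" "i \<in> B"
    and rel: "mat_mult B U U i i = 0" "mat_mult B V V i i = 0" "anticomm B U V i i = 0"
    and lin: "\<And>i j. i \<in> B \<Longrightarrow> j \<in> B \<Longrightarrow> \<alpha> * U i j + \<beta> * V i j + \<gamma> * (if i = j then 1 else 0) = 0"
  shows "\<gamma> = 0"
proof -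
  define N where "N i j = \<alpha> * U i j + \<beta> * V i j" for i j
  have "mat_mult B N N i i = \<alpha> * \<alpha> * mat_mult B U U i i + \<alpha> * \<beta> * anticomm B U V i i
      + \<beta> * \<beta> * mat_mult B V V i i"
    unfolding mat_mult_def anticomm_def N_def sum_distrib_left distrib_left sum.distrib[symmetric]
    by (intro sum.cong) (simp_all add: algebra_simps)
  hence zero: "mat_mult B N N i i = 0" using rel by simp
  have N: "N i j = (if i = j then - \<gamma> else 0)" if "i \<in> B" "j \<in> B" for i j
    using lin[OF that] by (auto simp: N_def eq_neg_iff_add_eq_0)
  have "mat_mult B N N i i = (\<Sum>j\<in>B. if i = j then \<gamma> * \<gamma> else 0)"
    unfolding mat_mult_def using B by (intro sum.cong) (auto simp: N)
  thus ?thesis using zero B by simp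
qed

text \<open>The action of \<open>z\<close> on a free \<open>S\<close>-module, in the case that no entry is a unit.\<close>

locale branch_factorization =
  fixes B :: "'i set" and \<phi> :: "'i \<Rightarrow> 'i \<Rightarrow> 'k::field fps fps"
  assumes finite_B: "finite B" and B_nonempty: "B \<noteq> {}"
    and nonunit: "i \<in> B \<Longrightarrow> j \<in> B \<Longrightarrow> fps_nth (fps_nth (\<phi> i j) 0) 0 = 0"
    and square: "i \<in> B \<Longrightarrow> l \<in> B \<Longrightarrow> mat_mult B \<phi> \<phi> i l = (if i = l then - e8_branch else 0)"
begin

text \<open>The coefficient matrix of \<open>x\<^sup>a y\<^sup>b\<close> in \<open>\<phi>\<close>.\<close>

definition coeff :: "nat \<Rightarrow> nat \<Rightarrow> 'i \<Rightarrow> 'i \<Rightarrow> 'k" where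
  "coeff a b i j = fps_nth (fps_nth (\<phi> i j) b) a"

lemma coeff_rel:
  assumes "i \<in> B" "l \<in> B"
  shows "(\<Sum>b'=0..b. \<Sum>a'=0..a. mat_mult B (coeff a' b') (coeff (a - a') (b - b')) i l)
    = (if i = l then - fps_nth (fps_nth e8_branch b) a else 0)"
proof -
  have "fps_nth (fps_nth (mat_mult B \<phi> \<phi> i l) b) a
      = (\<Sum>j\<in>B. \<Sum>b'=0..b. \<Sum>a'=0..a. coeff a' b' i j * coeff (a - a') (b - b') j l)"
    by (simp add: mat_mult_def fps_sum_nth fps_mult_nth coeff_def)
  also have "\<dots> = (\<Sum>b'=0..b. \<Sum>j\<in>B. \<Sum>a'=0..a. coeff a' b' i j * coeff (a - a') (b - b') j l)"
    by (rule sum.swap)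
  also have "\<dots> = (\<Sum>b'=0..b. \<Sum>a'=0..a. mat_mult B (coeff a' b') (coeff (a - a') (b - b')) i l)"
    unfolding mat_mult_def by (intro sum.cong refl sum.swap)
  finally show ?thesis using square[OF assms] by auto
qed

lemma coeff_00:
  assumes "i \<in> B" "l \<in> B"
  shows "mat_mult B (coeff 0 0) U i l = 0" "mat_mult B U (coeff 0 0) i l = 0"
proof -
  have "coeff 0 0 i j = 0" "coeff 0 0 j l = 0" if "j \<in> B" for j
    unfolding coeff_def by (rule nonunit[OF assms(1) that], rule nonunit[OF that assms(2)])
  thus "mat_mult B (coeff 0 0) U i l = 0" "mat_mult B U (coeff 0 0) i l = 0"
    unfolding mat_mult_def by (simp_all add: sum.neutral)
qed

lemma branch_nth:
  "fps_nth (fps_nth (e8_branch :: 'k fps fps) b) a = (if a = 3 \<and> b = 0 \<or> a = 0 \<and> b = 5 then 1 else 0)"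
  by (auto simp: e8_branch_def fps_X_power_nth)

text \<open>The diagonal entries of the coefficients of \<open>\<phi>\<^sup>2 = - g\<close> at the monomials in the labels.\<close>

lemma relations:
  assumes i: "i \<in> B"
  shows x2: "mat_mult B (coeff 1 0) (coeff 1 0) i i = 0"
    and xy: "anticomm B (coeff 1 0) (coeff 0 1) i i = 0"
    and y2: "mat_mult B (coeff 0 1) (coeff 0 1) i i = 0"
    and x3: "anticomm B (coeff 1 0) (coeff 2 0) i i = - 1"
    and x2y: "anticomm B (coeff 1 0) (coeff 1 1) i i + anticomm B (coeff 0 1) (coeff 2 0) i i = 0"
    and xy2: "anticomm B (coeff 1 0) (coeff 0 2) i i + anticomm B (coeff 0 1) (coeff 1 1) i i = 0"
    and y3: "anticomm B (coeff 0 1) (coeff 0 2) i i = 0"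
    and y4: "anticomm B (coeff 0 1) (coeff 0 3) i i + mat_mult B (coeff 0 2) (coeff 0 2) i i = 0"
    and y5: "anticomm B (coeff 0 1) (coeff 0 4) i i + anticomm B (coeff 0 2) (coeff 0 3) i i = - 1"
    and xy3: "anticomm B (coeff 1 0) (coeff 0 3) i i + anticomm B (coeff 0 1) (coeff 1 2) i i
      + anticomm B (coeff 0 2) (coeff 1 1) i i = 0"
proof -
  note simps = coeff_00[OF i i] branch_nth anticomm_def eval_nat_numeral sum.atLeast0_atMost_Suc
  show "mat_mult B (coeff 1 0) (coeff 1 0) i i = 0"
    using coeff_rel[OF i i, of 2 0] by (simp add: simps)
  show "anticomm B (coeff 1 0) (coeff 0 1) i i = 0"
    using coeff_rel[OF i i, of 1 1] by (simp add: simps add_ac)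
  show "mat_mult B (coeff 0 1) (coeff 0 1) i i = 0"
    using coeff_rel[OF i i, of 0 2] by (simp add: simps)
  show "anticomm B (coeff 1 0) (coeff 2 0) i i = - 1"
    using coeff_rel[OF i i, of 3 0] by (simp add: simps add_ac)
  show "anticomm B (coeff 1 0) (coeff 1 1) i i + anticomm B (coeff 0 1) (coeff 2 0) i i = 0"
    using coeff_rel[OF i i, of 2 1] by (simp add: simps add_ac)
  show "anticomm B (coeff 1 0) (coeff 0 2) i i + anticomm B (coeff 0 1) (coeff 1 1) i i = 0"
    using coeff_rel[OF i i, of 1 2] by (simp add: simps add_ac)
  show "anticomm B (coeff 0 1) (coeff 0 2) i i = 0"
    using coeff_rel[OF i i, of 0 3] by (simp add: simps add_ac)
  show "anticomm B (coeff 0 1) (coeff 0 3) i i + mat_mult B (coeff 0 2) (coeff 0 2) i i = 0"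
    using coeff_rel[OF i i, of 0 4] by (simp add: simps add_ac)
  show "anticomm B (coeff 0 1) (coeff 0 4) i i + anticomm B (coeff 0 2) (coeff 0 3) i i = - 1"
    using coeff_rel[OF i i, of 0 5] by (simp add: simps add_ac)
  show "anticomm B (coeff 1 0) (coeff 0 3) i i + anticomm B (coeff 0 1) (coeff 1 2) i i
      + anticomm B (coeff 0 2) (coeff 1 1) i i = 0"
    using coeff_rel[OF i i, of 1 3] by (simp add: simps add_ac)
qed

lemma x_part_nonzero:
  assumes "\<And>i j. i \<in> B \<Longrightarrow> j \<in> B \<Longrightarrow> coeff 1 0 i j = 0"
  shows False
proof -
  obtain i where i: "i \<in> B" using B_nonempty by auto
  have "anticomm B (coeff 1 0) (coeff 2 0) i i = 0 * anticomm B (coeff 1 0) (coeff 2 0) i i"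
    by (rule anticomm_scale) (use assms i in auto)
  thus False using x3[OF i] by simp
qed

text \<open>Write \<open>A, B, C, D, F\<close> for the coefficients of \<open>x, y, y\<^sup>2, x y, x\<^sup>2\<close> and \<open>{U, V}\<close> for the diagonal
  entry of \<open>U V + V U\<close>.  If \<open>B = c A\<close>, then \<open>{A, F} = - 1\<close> and \<open>{A, D} + {B, F} = 0\<close> give
  \<open>{A, D} = c\<close>, then \<open>{A, C} + {B, D} = 0\<close> gives \<open>{A, C} = - c\<^sup>2\<close>, and \<open>{B, C} = 0\<close> becomes
  \<open>c\<^sup>3 = 0\<close>.\<close>

lemma independent_y:
  assumes y: "i0 \<in> B" "j0 \<in> B" "coeff 0 1 i0 j0 \<noteq> 0"
    and lin: "\<And>i j. i \<in> B \<Longrightarrow> j \<in> B \<Longrightarrow>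
      \<alpha> * coeff 1 0 i j + \<beta> * coeff 0 1 i j + \<gamma> * (if i = j then 1 else 0) = 0"
  shows "\<alpha> = 0 \<and> \<beta> = 0 \<and> \<gamma> = 0"
proof -
  note i = y(1)
  have \<gamma>: "\<gamma> = 0" by (rule square_zero_no_identity[OF finite_B i x2[OF i] y2[OF i] xy[OF i] lin])
  have lin: "\<alpha> * coeff 1 0 i j + \<beta> * coeff 0 1 i j = 0" if "i \<in> B" "j \<in> B" for i j
    using lin[OF that] \<gamma> by simp
  have "\<beta> = 0"
  proof (rule ccontr)
    assume \<beta>: "\<beta> \<noteq> 0"
    define c where "c = - \<alpha> / \<beta>"
    have c: "coeff 0 1 i j = c * coeff 1 0 i j" if "i \<in> B" "j \<in> B" for i j
      using lin[OF that] \<beta> by (simp add: c_def field_simps eq_neg_iff_add_eq_0)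
    have scale: "anticomm B (coeff 0 1) W i0 i0 = c * anticomm B (coeff 1 0) W i0 i0" for W
      by (rule anticomm_scale[OF c i i])
    have "anticomm B (coeff 1 0) (coeff 1 1) i0 i0 = c"
      using x2y[OF i] x3[OF i] by (simp add: scale del: One_nat_def)
    hence "anticomm B (coeff 1 0) (coeff 0 2) i0 i0 = - c * c"
      using xy2[OF i] by (simp add: scale eq_neg_iff_add_eq_0 del: One_nat_def)
    hence "c * c * c = 0" using y3[OF i] by (simp add: scale del: One_nat_def)
    hence "c = 0" by simp
    thus False using c[OF y(1,2)] y(3) by simp
  qed
  moreover have "\<alpha> = 0"
  proof (rule ccontr)
    assume "\<alpha> \<noteq> 0"
    hence "coeff 1 0 i j = 0" if "i \<in> B" "j \<in> B" for i j using lin[OF that] \<open>\<beta> = 0\<close> by simp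
    thus False by (rule x_part_nonzero)
  qed
  ultimately show ?thesis using \<gamma> by simp
qed

text \<open>With \<open>B = 0\<close>, suppose \<open>C = c A\<close>, and let \<open>G\<close> be the coefficient of \<open>y\<^sup>3\<close>.  The monomials \<open>x\<^sup>2 y\<close>
  and \<open>x y\<^sup>3\<close> give \<open>{A, D} = 0\<close> and \<open>{A, G} = - c {A, D} = 0\<close>, whereas \<open>y\<^sup>5\<close> gives
  \<open>c {A, G} = {C, G} = - 1\<close>.\<close>

lemma independent_y2:
  assumes y: "\<And>i j. i \<in> B \<Longrightarrow> j \<in> B \<Longrightarrow> coeff 0 1 i j = 0"
    and lin: "\<And>i j. i \<in> B \<Longrightarrow> j \<in> B \<Longrightarrow>
      \<alpha> * coeff 1 0 i j + \<beta> * coeff 0 2 i j + \<gamma> * (if i = j then 1 else 0) = 0"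
  shows "\<alpha> = 0 \<and> \<beta> = 0 \<and> \<gamma> = 0"
proof -
  obtain i0 where i: "i0 \<in> B" using B_nonempty by auto
  have y0: "anticomm B (coeff 0 1) W i0 i0 = 0" for W
  proof -
    have "anticomm B (coeff 0 1) W i0 i0 = 0 * anticomm B (coeff 0 1) W i0 i0"
      by (rule anticomm_scale) (use y i in auto)
    thus ?thesis by simp
  qed
  note rel = x2y[OF i] xy2[OF i] y4[OF i] y5[OF i] xy3[OF i]
  have C2: "mat_mult B (coeff 0 2) (coeff 0 2) i0 i0 = 0"
    and AC: "anticomm B (coeff 1 0) (coeff 0 2) i0 i0 = 0" using rel by (simp_all add: y0 del: One_nat_def)
  have \<gamma>: "\<gamma> = 0" by (rule square_zero_no_identity[OF finite_B i x2[OF i] C2 AC lin])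
  have lin: "\<alpha> * coeff 1 0 i j + \<beta> * coeff 0 2 i j = 0" if "i \<in> B" "j \<in> B" for i j
    using lin[OF that] \<gamma> by simp
  have "\<beta> = 0"
  proof (rule ccontr)
    assume \<beta>: "\<beta> \<noteq> 0"
    define c where "c = - \<alpha> / \<beta>"
    have c: "coeff 0 2 i j = c * coeff 1 0 i j" if "i \<in> B" "j \<in> B" for i j
      using lin[OF that] \<beta> by (simp add: c_def field_simps eq_neg_iff_add_eq_0)
    have scale: "anticomm B (coeff 0 2) W i0 i0 = c * anticomm B (coeff 1 0) W i0 i0" for W
      by (rule anticomm_scale[OF c i i])
    have "anticomm B (coeff 1 0) (coeff 0 3) i0 i0 = 0" using rel by (simp add: y0 scale del: One_nat_def)
    thus False using rel by (simp add: y0 scale del: One_nat_def)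
  qed
  moreover have "\<alpha> = 0"
  proof (rule ccontr)
    assume "\<alpha> \<noteq> 0"
    hence "coeff 1 0 i j = 0" if "i \<in> B" "j \<in> B" for i j using lin[OF that] \<open>\<beta> = 0\<close> by simp
    thus False by (rule x_part_nonzero)
  qed
  ultimately show ?thesis using \<gamma> by simp
qed

text \<open>If \<open>B \<noteq> 0\<close>, the entries are expanded in \<open>x, y, z\<close> and even \<open>y\<close> lies in \<open>T\<close>; if
  \<open>B = 0\<close>, they are expanded in \<open>x, y\<^sup>2, z\<close>.\<close>

lemma entries_generate:
  fixes T :: "'k fps3 set"
  assumes T: "is_ideal T"
    and mem: "\<And>i j. i \<in> B \<Longrightarrow> j \<in> B \<Longrightarrow> e8_rep (\<phi> i j) (if i = j then 1 else 0) \<in> T"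
  shows "var_x \<in> T \<and> var_y\<^sup>2 \<in> T \<and> var_z \<in> T"
proof (cases "\<exists>i\<in>B. \<exists>j\<in>B. coeff 0 1 i j \<noteq> 0")
  case True
  then obtain i0 j0 where y: "i0 \<in> B" "j0 \<in> B" "coeff 0 1 i0 j0 \<noteq> 0" by blast
  define a where "a p = fps_const (fps_shift 1 (fps_nth (\<phi> (fst p) (snd p)) 0))" for p
  define b where "b p = fps_shift 1 (\<phi> (fst p) (snd p))" for p
  define c :: "'i \<times> 'i \<Rightarrow> 'k fps fps" where "c p = (if fst p = snd p then 1 else 0)" for p
  have "var_x \<in> T \<and> var_y \<in> T \<and> var_z \<in> T"
  proof (rule ideal_of_independent_entries[OF T])
    fix p assume p: "p \<in> B \<times> B"
    hence "\<phi> (fst p) (snd p) = fps_const fps_X * a p + fps_X * b p"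
      using fps2_nonunit[OF nonunit, of "fst p" "snd p"] by (auto simp: a_def b_def)
    hence "e8_rep (\<phi> (fst p) (snd p)) (c p)
        = fps_const (a p) * var_x + fps_const (b p) * var_y + fps_const (c p) * var_z"
      by (simp add: e8_rep_def var_x_def var_y_def var_z_def fps_const_add[symmetric]
          fps_const_mult[symmetric] mult.commute del: fps_const_add fps_const_mult)
    thus "fps_const (a p) * var_x + fps_const (b p) * var_y + fps_const (c p) * var_z \<in> T"
      using mem[of "fst p" "snd p"] p by (auto simp: c_def)
  next
    fix \<alpha> \<beta> \<gamma> assume lin: "\<And>p. p \<in> B \<times> B \<Longrightarrow> \<alpha> * fps_nth (fps_nth (a p) 0) 0
      + \<beta> * fps_nth (fps_nth (b p) 0) 0 + \<gamma> * fps_nth (fps_nth (c p) 0) 0 = 0"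
    show "\<alpha> = 0 \<and> \<beta> = 0 \<and> \<gamma> = 0"
    proof (rule independent_y[OF y])
      fix i j assume "i \<in> B" "j \<in> B"
      thus "\<alpha> * coeff 1 0 i j + \<beta> * coeff 0 1 i j + \<gamma> * (if i = j then 1 else 0) = 0"
        using lin[of "(i, j)"] by (auto simp: a_def b_def c_def coeff_def)
    qed
  qed
  thus ?thesis using is_idealD(3)[OF T, of var_y var_y] by (simp add: power2_eq_square)
next
  case False
  hence y: "coeff 0 1 i j = 0" if "i \<in> B" "j \<in> B" for i j using that by blast
  define a where "a p = fps_const (fps_shift 1 (fps_nth (\<phi> (fst p) (snd p)) 0))
    + fps_X * fps_const (fps_shift 1 (fps_nth (\<phi> (fst p) (snd p)) 1))" for p
  define b where "b p = fps_shift 2 (\<phi> (fst p) (snd p))" for p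
  define c :: "'i \<times> 'i \<Rightarrow> 'k fps fps" where "c p = (if fst p = snd p then 1 else 0)" for p
  show ?thesis
  proof (rule ideal_of_independent_entries[OF T])
    fix p assume p: "p \<in> B \<times> B"
    define f where "f = \<phi> (fst p) (snd p)"
    define g where "g = fps_shift 1 f"
    have f: "f = fps_const fps_X * fps_const (fps_shift 1 (fps_nth f 0)) + fps_X * g"
      using fps2_nonunit[OF nonunit, of "fst p" "snd p"] p by (auto simp: f_def g_def)
    have g0: "fps_nth g 0 = fps_nth f 1" and g1: "fps_shift 1 g = fps_shift 2 f"
      by (simp_all add: g_def fps_eq_iff eval_nat_numeral)
    have "fps_nth (fps_nth g 0) 0 = 0"
      unfolding g0 using y[of "fst p" "snd p"] p by (auto simp: f_def coeff_def)
    from fps2_nonunit[OF this]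
    have g: "g = fps_const fps_X * fps_const (fps_shift 1 (fps_nth f 1)) + fps_X * fps_shift 2 f"
      unfolding g0 g1 .
    have "fps_const fps_X * a p + fps_X\<^sup>2 * b p
        = fps_const fps_X * fps_const (fps_shift 1 (fps_nth f 0))
          + fps_X * (fps_const fps_X * fps_const (fps_shift 1 (fps_nth f 1)) + fps_X * fps_shift 2 f)"
      unfolding a_def b_def f_def[symmetric] by (simp only: distrib_left power2_eq_square ac_simps)
    also have "\<dots> = f" unfolding g[symmetric] by (rule f[symmetric])
    finally have "f = fps_const fps_X * a p + fps_X\<^sup>2 * b p" ..
    hence "e8_rep f (c p)
        = fps_const (a p) * var_x + fps_const (b p) * var_y\<^sup>2 + fps_const (c p) * var_z"
      by (simp add: e8_rep_def var_x_def var_y_def var_z_def fps_const_add[symmetric]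
          fps_const_mult[symmetric] fps_const_power[symmetric] mult.commute
          del: fps_const_add fps_const_mult fps_const_power)
    thus "fps_const (a p) * var_x + fps_const (b p) * var_y\<^sup>2 + fps_const (c p) * var_z \<in> T"
      using mem[of "fst p" "snd p"] p by (auto simp: c_def f_def)
  next
    fix \<alpha> \<beta> \<gamma> assume lin: "\<And>p. p \<in> B \<times> B \<Longrightarrow> \<alpha> * fps_nth (fps_nth (a p) 0) 0
      + \<beta> * fps_nth (fps_nth (b p) 0) 0 + \<gamma> * fps_nth (fps_nth (c p) 0) 0 = 0"
    show "\<alpha> = 0 \<and> \<beta> = 0 \<and> \<gamma> = 0"
    proof (rule independent_y2[OF y])
      fix i j assume "i \<in> B" "j \<in> B"
      thus "\<alpha> * coeff 1 0 i j + \<beta> * coeff 0 2 i j + \<gamma> * (if i = j then 1 else 0) = 0"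
        using lin[of "(i, j)"] by (auto simp: a_def b_def c_def coeff_def numeral_2_eq_2)
    qed
  qed
qed

end


section \<open>The trace ideal of a maximal Cohen-Macaulay module\<close>

lemma regular_module_simps:
  "carrier (regular_module R) = carrier R"
  "u \<oplus>\<^bsub>regular_module R\<^esub> v = u \<oplus>\<^bsub>R\<^esub> v"
  "a \<odot>\<^bsub>regular_module R\<^esub> u = a \<otimes>\<^bsub>R\<^esub> u"
  by (simp_all add: regular_module_def)

lemma module_hom_closed:
  "f \<in> module_hom R M N \<Longrightarrow> m \<in> carrier M \<Longrightarrow> f m \<in> carrier N"
  by (auto simp: module_hom_def)

context e8_module begin

lemma hom_images_subset:
  "(\<Union>f\<in>module_hom E8_ring M (regular_module E8_ring). f ` carrier M) \<subseteq> carrier E8_ring"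
proof (rule UN_least)
  fix f assume "f \<in> module_hom E8_ring M (regular_module E8_ring)"
  thus "f ` carrier M \<subseteq> carrier E8_ring"
    using module_hom_closed[of f E8_ring M "regular_module E8_ring"]
    unfolding regular_module_simps by (intro image_subsetI)
qed

lemma test_ideal_ideal: "ideal (test_ideal E8_ring M) E8_ring"
  unfolding test_ideal_def by (rule R.genideal_ideal[OF hom_images_subset])

lemma hom_image_mem:
  assumes "f \<in> module_hom E8_ring M (regular_module E8_ring)" "m \<in> carrier M"
  shows "f m \<in> test_ideal E8_ring M"
  using subsetD[OF R.genideal_self[OF hom_images_subset] UN_I[OF assms(1) imageI[OF assms(2)]]]
  unfolding test_ideal_def .

text \<open>An \<open>S\<close>-linear form \<open>co\<close> extends to the \<open>R\<close>-linear form \<open>m \<mapsto> co(z m) + z co(m)\<close>: multiplying the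
  argument by \<open>z\<close> gives \<open>- g co(m) + z co(z m)\<close>, as \<open>z\<^sup>2 = - g\<close>.\<close>

lemma basis_hom:
  fixes co :: "'m \<Rightarrow> 'k fps fps"
  assumes add: "\<And>m n. m \<in> carrier M \<Longrightarrow> n \<in> carrier M \<Longrightarrow> co (m \<oplus>\<^bsub>M\<^esub> n) = co m + co n"
    and smult: "\<And>s m. m \<in> carrier M \<Longrightarrow> co (act (fps_const s) m) = s * co m"
  shows "(\<lambda>m. E8_class (e8_rep (co (act fps_X m)) (co m)))
    \<in> module_hom E8_ring M (regular_module E8_ring)"
  unfolding module_hom_def
proof (intro CollectI conjI ballI)
  define f where "f m = E8_class (e8_rep (co (act fps_X m)) (co m))" for m
  show "(\<lambda>m. E8_class (e8_rep (co (act fps_X m)) (co m))) \<in> carrier M \<rightarrow> carrier (regular_module E8_ring)"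
    unfolding regular_module_simps by (intro funcsetI E8_class_closed)
  fix u v assume uv: "u \<in> carrier M" "v \<in> carrier M"
  show "f (u \<oplus>\<^bsub>M\<^esub> v) = f u \<oplus>\<^bsub>regular_module E8_ring\<^esub> f v"
    using uv by (simp add: f_def regular_module_simps E8_class_add[symmetric] E8_class_eq_iff_coords
        act_distrib add)
next
  define f where "f m = E8_class (e8_rep (co (act fps_X m)) (co m))" for m
  fix r u assume r: "r \<in> carrier (E8_ring :: 'k fps3 set ring)" and u: "u \<in> carrier M"
  obtain h where h: "r = E8_class h" using r by (auto simp: E8_carrier)
  define p q where "p = e8_re h" and "q = e8_im h"
  have act_h: "act h m = act (fps_const p) m \<oplus>\<^bsub>M\<^esub> act (fps_const q) (act fps_X m)"
    if "m \<in> carrier M" for m unfolding p_def q_def by (rule act_coords[OF that])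
  have "co (act h u) = p * co u + q * co (act fps_X u)" using u by (simp add: act_h add smult)
  moreover have "co (act fps_X (act h u)) = p * co (act fps_X u) - q * (e8_branch * co u)"
  proof -
    have "act fps_X (act h u) = act h (act fps_X u)" using u by (rule act_commute)
    also have "\<dots> = act (fps_const p) (act fps_X u) \<oplus>\<^bsub>M\<^esub> act (fps_const q) (act (fps_const (- e8_branch)) u)"
      using u by (simp add: act_h act_square_X)
    finally show ?thesis using u by (simp add: add smult)
  qed
  ultimately show "f (r \<odot>\<^bsub>M\<^esub> u) = r \<odot>\<^bsub>regular_module E8_ring\<^esub> f u"
    by (simp add: h f_def regular_module_simps act_def[of h, symmetric] E8_class_mult[symmetric]
        E8_class_eq_iff_coords p_def[symmetric] q_def[symmetric] algebra_simps)
qed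

lemma test_ideal_contains:
  assumes "maximal_CM E8_ring M"
  shows "E8_class var_x \<in> test_ideal E8_ring M \<and> E8_class (var_y\<^sup>2) \<in> test_ideal E8_ring M
    \<and> E8_class var_z \<in> test_ideal E8_ring M"
proof -
  obtain B where B: "finite B" "B \<subseteq> carrier M" and gen: "lspan B = carrier M"
    and indep: "\<forall>c. lc B c = \<zero>\<^bsub>M\<^esub> \<longrightarrow> (\<forall>b\<in>B. c b = 0)" and ne: "B \<noteq> {}"
    by (rule maximal_CM_basis[OF assms])
  note lc = lc_closed[OF B] lc_add[OF B] lc_smult[OF B] lc_diff[OF B]
  have unique: "c b = d b" if "lc B c = lc B d" "b \<in> B" for c d b
  proof -
    have "lc B (\<lambda>b. c b - d b) = \<zero>\<^bsub>M\<^esub>" unfolding lc(4) that(1) using lc(1) by (simp add: M.minus_eq M.r_neg)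
    thus ?thesis using indep that(2) by fastforce
  qed
  define co where "co m = (SOME c. lc B c = m)" for m
  have co: "lc B (co m) = m" if "m \<in> carrier M" for m
  proof -
    have "m \<in> range (lc B)" using that gen unfolding lspan_def by simp
    hence "\<exists>c. lc B c = m" by auto
    thus ?thesis unfolding co_def by (rule someI_ex)
  qed
  have co_lc: "co (lc B c) b = c b" if "b \<in> B" for b c
    by (rule unique[OF co that]) (rule lc(1))
  have co_add: "co (m \<oplus>\<^bsub>M\<^esub> n) b = co m b + co n b" if "m \<in> carrier M" "n \<in> carrier M" "b \<in> B" for m n b
    using co_lc[OF that(3), of "\<lambda>b. co m b + co n b"] that(1,2) by (simp add: lc(2) co)
  have co_smult: "co (act (fps_const s) m) b = s * co m b" if "m \<in> carrier M" "b \<in> B" for s m b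
    using co_lc[OF that(2), of "\<lambda>b. s * co m b"] that(1) by (simp add: lc(3) co)
  have co_basis: "co j i = (if i = j then 1 else 0)" if "i \<in> B" "j \<in> B" for i j
    using co_lc[OF that(1), of "\<lambda>b. if b = j then 1 else 0"] lc_single[OF B that(2)] by simp
  define \<phi> where "\<phi> i j = co (act fps_X j) i" for i j
  have X: "co (act fps_X m) i = (\<Sum>j\<in>B. \<phi> i j * co m j)" if m: "m \<in> carrier M" and i: "i \<in> B" for m i
  proof -
    have "co (act fps_X (lc B' c)) i = (\<Sum>j\<in>B'. \<phi> i j * c j)" if "B' \<subseteq> B" for B' c
      using finite_subset[OF that B(1)] that
    proof (induction B')
      case empty
      show ?case using co_smult[of "\<zero>\<^bsub>M\<^esub>" i 0] i by simp
    next
      case (insert b B')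
      have B': "finite B'" "B' \<subseteq> carrier M" "b \<in> carrier M" using insert B by auto
      have "act fps_X (lc (insert b B') c)
          = act (fps_const (c b)) (act fps_X b) \<oplus>\<^bsub>M\<^esub> act fps_X (lc B' c)"
        using insert.hyps B' by (simp add: lc_insert lc_closed act_distrib act_commute[of b fps_X])
      thus ?case using insert B' i by (simp add: co_add co_smult lc_closed \<phi>_def mult.commute)
    qed
    from this[of B "co m"] show ?thesis by (simp add: co[OF m])
  qed
  define T where "T = E8_class -` test_ideal E8_ring M"
  have T: "is_ideal T" unfolding T_def by (rule pullback_ideal[OF test_ideal_ideal])
  \<comment> \<open>The form extending the coordinate at \<open>i\<close>, evaluated at the basis vector \<open>j\<close>.\<close>
  have entry: "e8_rep (\<phi> i j) (if i = j then 1 else 0) \<in> T" if "i \<in> B" "j \<in> B" for i j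
  proof -
    have "(\<lambda>m. E8_class (e8_rep (co (act fps_X m) i) (co m i)))
        \<in> module_hom E8_ring M (regular_module E8_ring)"
      by (rule basis_hom) (use that in \<open>auto simp: co_add co_smult\<close>)
    from hom_image_mem[OF this, of j] show ?thesis
      using that B by (auto simp: T_def co_basis \<phi>_def)
  qed
  have "var_x \<in> T \<and> var_y\<^sup>2 \<in> T \<and> var_z \<in> T"
  proof (cases "\<exists>i\<in>B. \<exists>j\<in>B. fps_nth (fps_nth (\<phi> i j) 0) 0 \<noteq> 0")
    case True
    then obtain i j where ij: "i \<in> B" "j \<in> B" "fps_nth (fps_nth (\<phi> i j) 0) 0 \<noteq> 0" by blast
    then obtain h where h: "E8_class (h * e8_rep (\<phi> i j) (if i = j then 1 else 0)) = E8_class 1"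
      using e8_unit[of "e8_rep (\<phi> i j) (if i = j then 1 else 0)"] by auto
    have "1 \<in> T" using is_idealD(3)[OF T entry[OF ij(1,2)], of h] h by (simp add: T_def)
    hence "h \<in> T" for h using is_idealD(3)[OF T, of 1 h] by simp
    thus ?thesis by blast
  next
    case False
    interpret branch_factorization B \<phi>
    proof
      fix i l assume il: "i \<in> B" "l \<in> B"
      have "mat_mult B \<phi> \<phi> i l = co (act fps_X (act fps_X l)) i"
        using X[of "act fps_X l" i] il B by (auto simp: mat_mult_def \<phi>_def)
      also have "\<dots> = - e8_branch * co l i"
        using il B co_smult[of l i "- e8_branch"] act_square_X[of l] by auto
      finally show "mat_mult B \<phi> \<phi> i l = (if i = l then - e8_branch else 0)"
        using il by (auto simp: co_basis)
    qed (use B ne False in auto)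
    show ?thesis by (rule entries_generate[OF T entry])
  qed
  thus ?thesis by (simp add: T_def)
qed

end


section \<open>A module with the smallest trace ideal\<close>

text \<open>This bounds the depth.  If \<open>y, x\<close> and \<open>a, b, c\<close> are regular sequences and \<open>m\<close> is moved into
  \<open>(y, x) M\<close> by \<open>a\<close>, \<open>b\<close> and \<open>c\<close>, then \<open>m \<in> (y, x) M\<close>.  So \<open>M\<close> has no regular sequence of length
  3 of nonunits once \<open>M/(y, x) M\<close> has a nonzero element killed by the maximal ideal.  The
  proof chases a double Koszul complex: the differences \<open>b n1 - a n2\<close> are \<open>y\<close> times elements
  \<open>w\<close>, these satisfy a Koszul relation for \<open>a, b, c\<close>, and regularity lets one divide back.\<close>

lemma regular_sequence_exchange:
  fixes scale :: "'a::comm_ring_1 \<Rightarrow> 'b::ab_group_add \<Rightarrow> 'b" (infixr \<open>*s\<close> 75)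
  assumes "Modules.module scale"
    and y: "\<And>v. y *s v = 0 \<Longrightarrow> v = 0" and x: "\<And>v w. x *s v = y *s w \<Longrightarrow> \<exists>u. v = y *s u"
    and a: "\<And>v. a *s v = 0 \<Longrightarrow> v = 0" and b: "\<And>v w. b *s v = a *s w \<Longrightarrow> \<exists>u. v = a *s u"
    and c: "\<And>v w w'. c *s v = a *s w + b *s w' \<Longrightarrow> \<exists>u u'. v = a *s u + b *s u'"
    and m: "a *s m = y *s m1 + x *s n1" "b *s m = y *s m2 + x *s n2" "c *s m = y *s m3 + x *s n3"
  shows "\<exists>p q. m = y *s p + x *s q"
proof -
  interpret V: Modules.module scale by fact
  note [simp] = V.scale_right_distrib V.scale_right_diff_distrib V.scale_scale
  have y_inj: "v = w" if "y *s v = y *s w" for v w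
    using y[of "v - w"] that by simp
  have a_inj: "v = w" if "a *s v = a *s w" for v w
    using a[of "v - w"] that by simp
  have syzygy: "\<exists>w. s *s n - r *s n' = y *s w \<and> x *s w = r *s k' - s *s k"
    if "r *s m = y *s k + x *s n" "s *s m = y *s k' + x *s n'" for r s k n k' n'
  proof -
    have "s *s (y *s k + x *s n) = r *s (y *s k' + x *s n')"
      unfolding that[symmetric] by (simp add: mult.commute)
    hence eq: "x *s (s *s n - r *s n') = y *s (r *s k' - s *s k)"
      by (simp add: mult.commute algebra_simps)
    then obtain w where w: "s *s n - r *s n' = y *s w" using x by blast
    have "y *s (x *s w) = y *s (r *s k' - s *s k)"
      unfolding eq[symmetric] w by (simp add: mult.commute)
    thus ?thesis using w y_inj by blast
  qed
  obtain w12 where w12: "b *s n1 - a *s n2 = y *s w12" "x *s w12 = a *s m2 - b *s m1"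
    using syzygy[OF m(1,2)] by blast
  obtain w13 where w13: "c *s n1 - a *s n3 = y *s w13" using syzygy[OF m(1,3)] by blast
  obtain w23 where w23: "c *s n2 - b *s n3 = y *s w23" using syzygy[OF m(2,3)] by blast
  have "y *s (c *s w12) = c *s (b *s n1 - a *s n2)"
    unfolding w12 by (simp add: mult.commute)
  also have "\<dots> = b *s (c *s n1 - a *s n3) - a *s (c *s n2 - b *s n3)"
    by (simp add: mult.commute)
  also have "\<dots> = y *s (a *s (- w23) + b *s w13)"
    unfolding w13 w23 by (simp add: mult.commute)
  finally have "c *s w12 = a *s (- w23) + b *s w13" by (rule y_inj)
  then obtain u v where uv: "w12 = a *s u + b *s v" using c by blast
  have "b *s (n1 - y *s v) = a *s (n2 + y *s u)"
    using w12(1) unfolding uv by (simp add: mult.commute algebra_simps)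
  then obtain t where t: "n1 - y *s v = a *s t" using b by blast
  have "b *s (m1 + x *s v) = a *s (m2 - x *s u)"
    using w12(2) unfolding uv by (simp add: mult.commute algebra_simps)
  then obtain t' where t': "m1 + x *s v = a *s t'" using b by blast
  have "a *s m = y *s (m1 + x *s v) + x *s (n1 - y *s v)"
    unfolding m(1) by (simp add: mult.commute)
  also have "\<dots> = a *s (y *s t' + x *s t)" unfolding t t' by (simp add: mult.commute)
  finally show ?thesis using a_inj by blast
qed

text \<open>Quadruples of power series are mostly treated as single vectors.\<close>

declare split_paired_All [simp del] split_paired_Ex [simp del]

type_synonym 'k quad = "'k fps fps \<times> 'k fps fps \<times> 'k fps fps \<times> 'k fps fps"

text \<open>With \<open>U\<close> the matrix with rows \<open>(y\<^sup>2, x)\<close>, \<open>(x\<^sup>2, - y\<^sup>3)\<close> and \<open>V\<close> the matrix with rows \<open>(y\<^sup>3, x)\<close>,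
  \<open>(x\<^sup>2, - y\<^sup>2)\<close>, one has \<open>U V = V U = g\<close>.  On pairs of vectors \<open>z\<close> acts by
  \<open>(v, w) \<mapsto> (U w, - V v)\<close>, whose square is \<open>- g\<close>, and \<open>p + q z\<close> acts accordingly.\<close>

definition quad_act :: "'k::field fps3 \<Rightarrow> 'k quad \<Rightarrow> 'k quad" where
  "quad_act h = (\<lambda>(a, b, c, d).
    let p = e8_re h; q = e8_im h; x = fps_const fps_X; y = fps_X in
    (p * a + q * (y ^ 2 * c + x * d), p * b + q * (x ^ 2 * c - y ^ 3 * d),
     p * c - q * (y ^ 3 * a + x * b), p * d - q * (x ^ 2 * a - y ^ 2 * b)))"

lemma quad_act_apply:
  "quad_act h (a, b, c, d) =
    (e8_re h * a + e8_im h * (fps_X ^ 2 * c + fps_const fps_X * d),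
     e8_re h * b + e8_im h * (fps_const fps_X ^ 2 * c - fps_X ^ 3 * d),
     e8_re h * c - e8_im h * (fps_X ^ 3 * a + fps_const fps_X * b),
     e8_re h * d - e8_im h * (fps_const fps_X ^ 2 * a - fps_X ^ 2 * b))"
  by (simp add: quad_act_def Let_def del: fps_const_power)

text \<open>The four components of compatibility with products; the terms in \<open>q s\<close> express
  \<open>U V = V U = g\<close>.\<close>

lemma quad_mult_id:
  fixes x y p q r s a b c d :: "'a::comm_ring_1"
  shows "(p * r - (x ^ 3 + y ^ 5) * (q * s)) * a + (p * s + q * r) * (y ^ 2 * c + x * d)
    = p * (r * a + s * (y ^ 2 * c + x * d)) + q * (y ^ 2 * (r * c - s * (y ^ 3 * a + x * b))
      + x * (r * d - s * (x ^ 2 * a - y ^ 2 * b)))"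
    "(p * r - (x ^ 3 + y ^ 5) * (q * s)) * b + (p * s + q * r) * (x ^ 2 * c - y ^ 3 * d)
    = p * (r * b + s * (x ^ 2 * c - y ^ 3 * d)) + q * (x ^ 2 * (r * c - s * (y ^ 3 * a + x * b))
      - y ^ 3 * (r * d - s * (x ^ 2 * a - y ^ 2 * b)))"
    "(p * r - (x ^ 3 + y ^ 5) * (q * s)) * c - (p * s + q * r) * (y ^ 3 * a + x * b)
    = p * (r * c - s * (y ^ 3 * a + x * b)) - q * (y ^ 3 * (r * a + s * (y ^ 2 * c + x * d))
      + x * (r * b + s * (x ^ 2 * c - y ^ 3 * d)))"
    "(p * r - (x ^ 3 + y ^ 5) * (q * s)) * d - (p * s + q * r) * (x ^ 2 * a - y ^ 2 * b)
    = p * (r * d - s * (x ^ 2 * a - y ^ 2 * b)) - q * (x ^ 2 * (r * a + s * (y ^ 2 * c + x * d))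
      - y ^ 2 * (r * b + s * (x ^ 2 * c - y ^ 3 * d)))"
  by (simp_all add: eval_nat_numeral algebra_simps)

lemma quad_act_mult: "quad_act (f * g) v = quad_act f (quad_act g v)"
proof -
  obtain a b c d where v: "v = (a, b, c, d)" by (cases v)
  have g: "e8_branch = fps_const fps_X ^ 3 + fps_X ^ 5" by (simp add: e8_branch_def)
  show ?thesis
    unfolding v quad_act_apply e8_coords_mult fst_conv snd_conv g
    by (intro prod_eqI; unfold fst_conv snd_conv) (rule quad_mult_id)+
qed

lemma quad_act_add: "quad_act f (u + v) = quad_act f u + quad_act f v"
  by (cases u, cases v) (simp add: quad_act_apply algebra_simps)

lemma quad_act_add_left: "quad_act (f + g) v = quad_act f v + quad_act g v"
  by (cases v) (simp add: quad_act_apply algebra_simps)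

lemma quad_act_1: "quad_act 1 v = v"
  by (cases v) (simp add: quad_act_apply)

lemma quad_module: "Modules.module (quad_act :: 'k::field fps3 \<Rightarrow> _)"
  by standard (simp_all add: quad_act_add quad_act_add_left quad_act_mult quad_act_1)

lemma quad_act_const:
  "quad_act (fps_const s) (a, b, c, d) = (s * a, s * b, s * c, s * d)"
  by (simp add: quad_act_apply)

lemma quad_act_cong: "E8_class f = E8_class g \<Longrightarrow> quad_act f v = quad_act g v"
  by (cases v) (simp add: quad_act_apply E8_class_eq_iff_coords)

lemma quad_y_regular:
  assumes "quad_act var_y v = 0"
  shows "v = 0"
  using assms by (cases v) (simp add: var_y_def quad_act_const zero_prod_def)

lemma fps2_x_mod_y:
  fixes s t :: "'k::field fps fps"
  assumes "fps_const fps_X * s = fps_X * t"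
  shows "s = fps_X * fps_shift 1 s"
proof -
  have "fps_nth (fps_const fps_X * s) 0 = fps_nth (fps_X * t) 0" by (simp only: assms)
  hence "fps_X * fps_nth s 0 = 0" by simp
  hence "fps_nth s 0 = 0" by simp
  thus ?thesis using fps_split0[of s] by simp
qed

lemma quad_x_regular:
  assumes "quad_act var_x v = quad_act var_y w"
  shows "\<exists>u. v = quad_act var_y u"
proof -
  obtain a b c d where v: "v = (a, b, c, d)" by (cases v)
  obtain a' b' c' d' where w: "w = (a', b', c', d')" by (cases w)
  have eqs: "fps_const fps_X * a = fps_X * a'" "fps_const fps_X * b = fps_X * b'"
    "fps_const fps_X * c = fps_X * c'" "fps_const fps_X * d = fps_X * d'"
    using assms by (simp_all add: v w var_x_def var_y_def quad_act_const)
  have "v = quad_act var_y (fps_shift 1 a, fps_shift 1 b, fps_shift 1 c, fps_shift 1 d)"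
    unfolding v var_y_def quad_act_const using eqs[THEN fps2_x_mod_y] by simp
  thus ?thesis ..
qed

text \<open>This vector spans, modulo \<open>x\<close> and \<open>y\<close>, a line killed by the maximal ideal.\<close>

definition quad_e :: "'k::field quad" where "quad_e = (1, 0, 0, 0)"

lemma quad_e_not_mem: "quad_e \<noteq> quad_act var_y u + quad_act var_x v"
proof
  assume "quad_e = quad_act var_y u + quad_act var_x v"
  hence "1 = fps_X * fst u + fps_const fps_X * fst v"
    by (cases u, cases v) (simp add: quad_e_def var_x_def var_y_def quad_act_const)
  hence "fps_nth (fps_nth 1 0) 0 = fps_nth (fps_nth (fps_X * fst u + fps_const fps_X * fst v) 0) 0"
    by simp
  thus False by simp
qed

lemma quad_nonunit_e:
  assumes h: "fps_nth (fps_nth (e8_re h) 0) 0 = 0"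
  shows "\<exists>u v. quad_act h quad_e = quad_act var_y u + quad_act var_x v"
proof -
  define p q where "p = e8_re h" and "q = e8_im h"
  define s t where "s = fps_const (fps_shift 1 (fps_nth p 0))" and "t = fps_shift 1 p"
  have p: "p = fps_const fps_X * s + fps_X * t" using fps2_nonunit h by (simp add: p_def s_def t_def)
  have "quad_act h quad_e = (p, 0, - q * fps_X ^ 3, - q * fps_const fps_X ^ 2)"
    by (simp add: quad_e_def quad_act_apply p_def q_def)
  also have "\<dots> = quad_act var_y (t, 0, - q * fps_X ^ 2, 0)
      + quad_act var_x (s, 0, 0, - q * fps_const fps_X)"
    by (subst p) (simp add: var_x_def var_y_def quad_act_const eval_nat_numeral algebra_simps)
  finally show ?thesis by blast
qed

text \<open>All entries of the matrix of \<open>z\<close> lie in \<open>(x, y\<^sup>2)\<close>.\<close>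

lemma quad_z_image:
  "\<exists>u w. quad_act var_z v = quad_act var_x u + quad_act (var_y\<^sup>2) w"
proof -
  obtain a b c d where v: "v = (a, b, c, d)" by (cases v)
  have "quad_act var_z v = quad_act var_x (d, fps_const fps_X * c, - b, - fps_const fps_X * a)
      + quad_act (fps_const (fps_X ^ 2)) (c, - fps_X * d, - fps_X * a, b)"
    unfolding v var_x_def quad_act_const
    by (simp add: quad_act_apply eval_nat_numeral algebra_simps
        del: fps_const_neg fps_const_mult fps_const_power)
  moreover have "var_y\<^sup>2 = fps_const (fps_X ^ 2 :: 'a fps fps)" by (simp add: var_y_def)
  ultimately show ?thesis by metis
qed

text \<open>An isomorphic copy of the module, over an arbitrary type: test ideals are intersected over
  modules whose elements are sets of coefficient vectors, so the example has to be moved there.\<close>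

locale quad_copy = e8_module M for M :: "('k::field fps3 set, 'm, 'd) module_scheme" +
  fixes \<beta> :: "'k quad \<Rightarrow> 'm"
  assumes bij: "bij_betw \<beta> UNIV (carrier M)"
    and \<beta>_add: "\<beta> (u + v) = \<beta> u \<oplus>\<^bsub>M\<^esub> \<beta> v"
    and \<beta>_act: "\<beta> (quad_act h v) = act h (\<beta> v)"
begin

lemma \<beta>_closed [simp, intro]: "\<beta> v \<in> carrier M"
  using bij by (auto simp: bij_betw_def)

lemma \<beta>_eq_iff [simp]: "\<beta> u = \<beta> v \<longleftrightarrow> u = v"
  using bij by (auto simp: bij_betw_def inj_on_def)

lemma \<beta>_surj: "m \<in> carrier M \<Longrightarrow> \<exists>v. m = \<beta> v"
  using bij by (auto simp: bij_betw_def)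

lemma \<beta>_0: "\<beta> 0 = \<zero>\<^bsub>M\<^esub>"
proof -
  have "\<beta> (quad_act 0 0) = \<zero>\<^bsub>M\<^esub>" unfolding \<beta>_act by simp
  thus ?thesis by (simp add: zero_prod_def quad_act_apply)
qed

lemma quad_fin_gen: "fin_gen E8_ring M"
proof -
  define S where "S = \<beta> ` {(1, 0, 0, 0), (0, 1, 0, 0), (0, 0, 1, 0), (0, 0, 0, 1)}"
  have "carrier M \<subseteq> N" if N: "submodule N E8_ring M" "S \<subseteq> N" for N
  proof
    fix m assume "m \<in> carrier M"
    then obtain v where v: "m = \<beta> v" using \<beta>_surj by blast
    obtain a b c d where abcd: "v = (a, b, c, d)" by (cases v)
    have act: "act h n \<in> N" if "n \<in> N" for h n
      using submoduleE(4)[OF N(1) E8_class_closed that] by (simp add: act_def)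
    have S: "\<beta> (1, 0, 0, 0) \<in> N" "\<beta> (0, 1, 0, 0) \<in> N" "\<beta> (0, 0, 1, 0) \<in> N" "\<beta> (0, 0, 0, 1) \<in> N"
      using N(2) by (auto simp: S_def)
    have "v = quad_act (fps_const a) (1, 0, 0, 0) + (quad_act (fps_const b) (0, 1, 0, 0)
      + (quad_act (fps_const c) (0, 0, 1, 0) + quad_act (fps_const d) (0, 0, 0, 1)))"
      by (simp add: abcd quad_act_const)
    hence "m = act (fps_const a) (\<beta> (1, 0, 0, 0)) \<oplus>\<^bsub>M\<^esub> (act (fps_const b) (\<beta> (0, 1, 0, 0))
      \<oplus>\<^bsub>M\<^esub> (act (fps_const c) (\<beta> (0, 0, 1, 0)) \<oplus>\<^bsub>M\<^esub> act (fps_const d) (\<beta> (0, 0, 0, 1))))"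
      by (simp add: v \<beta>_add \<beta>_act)
    thus "m \<in> N" using S by (simp only:) (intro submoduleE(5)[OF N(1)] act)
  qed
  moreover have "S \<subseteq> carrier M" by (auto simp: S_def)
  ultimately have "gen_submodule E8_ring M S = carrier M"
    unfolding gen_submodule_def using carrier_is_submodule by blast
  moreover have "finite S" by (simp add: S_def)
  ultimately show ?thesis unfolding fin_gen_def using \<open>S \<subseteq> carrier M\<close> by blast
qed

lemma quad_pair_image:
  "\<beta> v \<in> pair_image a b \<longleftrightarrow> (\<exists>u w. v = quad_act a u + quad_act b w)"
proof
  assume "\<beta> v \<in> pair_image a b"
  then obtain m n where mn: "m \<in> carrier M" "n \<in> carrier M" "\<beta> v = act a m \<oplus>\<^bsub>M\<^esub> act b n"
    unfolding pair_image_def by blast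
  obtain u w where "m = \<beta> u" "n = \<beta> w" using \<beta>_surj mn by metis
  hence "\<beta> v = \<beta> (quad_act a u + quad_act b w)" using mn by (simp add: \<beta>_add \<beta>_act)
  thus "\<exists>u w. v = quad_act a u + quad_act b w" by auto
next
  assume "\<exists>u w. v = quad_act a u + quad_act b w"
  then obtain u w where "v = quad_act a u + quad_act b w" by blast
  hence "\<beta> v = act a (\<beta> u) \<oplus>\<^bsub>M\<^esub> act b (\<beta> w)" by (simp add: \<beta>_add \<beta>_act)
  thus "\<beta> v \<in> pair_image a b" unfolding pair_image_def using \<beta>_closed by blast
qed

lemma quad_image: "\<beta> v \<in> act a ` carrier M \<longleftrightarrow> (\<exists>u. v = quad_act a u)"
proof
  assume "\<beta> v \<in> act a ` carrier M"
  then obtain m where m: "m \<in> carrier M" "\<beta> v = act a m" by blast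
  then obtain u where "m = \<beta> u" using \<beta>_surj by blast
  hence "\<beta> v = \<beta> (quad_act a u)" using m by (simp add: \<beta>_act)
  thus "\<exists>u. v = quad_act a u" by auto
next
  assume "\<exists>u. v = quad_act a u"
  thus "\<beta> v \<in> act a ` carrier M" by (auto simp: \<beta>_act)
qed

lemma quad_nzd: "nzd a \<longleftrightarrow> (\<forall>v. quad_act a v = 0 \<longrightarrow> v = 0)"
proof -
  have "nzd a \<longleftrightarrow> (\<forall>v. act a (\<beta> v) = \<zero>\<^bsub>M\<^esub> \<longrightarrow> \<beta> v = \<zero>\<^bsub>M\<^esub>)"
    unfolding nzd_def using \<beta>_surj \<beta>_closed by metis
  thus ?thesis by (simp add: \<beta>_act[symmetric] \<beta>_0[symmetric])
qed

lemma quad_nzd_mod: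
  "nzd_mod a b \<longleftrightarrow> (\<forall>v w. quad_act b v = quad_act a w \<longrightarrow> (\<exists>u. v = quad_act a u))"
proof -
  have "nzd_mod a b \<longleftrightarrow> (\<forall>v. \<beta> (quad_act b v) \<in> act a ` carrier M \<longrightarrow> \<beta> v \<in> act a ` carrier M)"
    unfolding nzd_mod_def \<beta>_act using \<beta>_surj \<beta>_closed by metis
  thus ?thesis unfolding quad_image by auto
qed

lemma quad_xy_regular: "regular_sequence E8_ring M [E8_class var_y, E8_class var_x]"
proof -
  have "\<beta> quad_e \<notin> pair_image var_y var_x" by (simp add: quad_pair_image quad_e_not_mem)
  hence "pair_image var_y var_x \<noteq> carrier M" using \<beta>_closed by blast
  moreover have "nzd var_y" unfolding quad_nzd using quad_y_regular by blast
  moreover have "nzd_mod var_y var_x" unfolding quad_nzd_mod using quad_x_regular by blast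
  ultimately have ne: "pair_image var_y var_x \<noteq> carrier M" and y: "nzd var_y"
    and x: "nzd_mod var_y var_x" by blast+
  show ?thesis
    unfolding regular_sequence_def
  proof (intro conjI allI impI ballI)
    show "set [E8_class var_y, E8_class var_x] \<subseteq> carrier E8_ring" by simp
    show "ideal_smult E8_ring (Idl\<^bsub>E8_ring\<^esub> (set [E8_class var_y, E8_class var_x])) M \<noteq> carrier M"
      using ne by (simp add: ideal_smult_pair)
    fix i m
    assume i: "i < length [E8_class var_y, E8_class (var_x :: 'k fps3)]" and m: "m \<in> carrier M"
      and mem: "[E8_class var_y, E8_class var_x] ! i \<odot>\<^bsub>M\<^esub> m \<in> ideal_smult E8_ring
        (Idl\<^bsub>E8_ring\<^esub> (set (take i [E8_class var_y, E8_class var_x]))) M"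
    show "m \<in> ideal_smult E8_ring (Idl\<^bsub>E8_ring\<^esub> (set (take i [E8_class var_y, E8_class var_x]))) M"
    proof (cases i)
      case 0
      thus ?thesis using mem m y by (simp add: ideal_smult_empty nzd_def act_def[symmetric])
    next
      case (Suc j)
      hence "i = Suc 0" using i by simp
      thus ?thesis using mem m x by (simp add: ideal_smult_single nzd_mod_def act_def[symmetric])
    qed
  qed
qed

lemma quad_depth_le:
  assumes reg: "regular_sequence E8_ring M xs"
  shows "length xs \<le> 2"
proof (rule ccontr)
  assume "\<not> length xs \<le> 2"
  hence len: "length xs \<ge> 3" by simp
  obtain a b where ab: "xs ! 0 = E8_class a" "xs ! 1 = E8_class b"
    "fps_nth (fps_nth (e8_re a) 0) 0 = 0" "fps_nth (fps_nth (e8_re b) 0) 0 = 0"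
    "nzd a" "nzd_mod a b"
    by (rule regular_sequence_start[OF reg]) (use len in auto)
  have mem: "xs ! 2 \<in> set xs" using len by (intro nth_mem) simp
  moreover have "set xs \<subseteq> carrier E8_ring" using reg by (simp add: regular_sequence_def)
  ultimately obtain c where c: "xs ! 2 = E8_class c" by (auto simp: E8_carrier)
  have c0: "fps_nth (fps_nth (e8_re c) 0) 0 = 0"
    using nonunit_of_regular_sequence[OF reg, of c] mem c by simp
  have take: "set (take 2 xs) = {E8_class a, E8_class b}"
  proof -
    obtain s t r where "xs = s # t # r" using len by (metis Suc_le_length_iff numeral_3_eq_3)
    thus ?thesis using ab by auto
  qed
  have c_reg: "m \<in> pair_image a b" if "m \<in> carrier M" "act c m \<in> pair_image a b" for m
  proof -
    have "2 < length xs" using len by simp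
    hence "xs ! 2 \<odot>\<^bsub>M\<^esub> m \<in> ideal_smult E8_ring (Idl\<^bsub>E8_ring\<^esub> (set (take 2 xs))) M
      \<longrightarrow> m \<in> ideal_smult E8_ring (Idl\<^bsub>E8_ring\<^esub> (set (take 2 xs))) M"
      using reg that(1) unfolding regular_sequence_def by blast
    thus ?thesis using that(2) by (simp add: take c ideal_smult_pair act_def)
  qed
  have c_quad: "\<exists>u u'. v = quad_act a u + quad_act b u'" if "quad_act c v = quad_act a w + quad_act b w'" for v w w'
  proof -
    have "\<beta> (quad_act c v) \<in> pair_image a b" unfolding quad_pair_image using that by blast
    hence "\<beta> v \<in> pair_image a b" using c_reg \<beta>_act by simp
    thus ?thesis by (simp add: quad_pair_image)
  qed
  obtain m1 n1 where 1: "quad_act a quad_e = quad_act var_y m1 + quad_act var_x n1"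
    using quad_nonunit_e[OF ab(3)] by blast
  obtain m2 n2 where 2: "quad_act b quad_e = quad_act var_y m2 + quad_act var_x n2"
    using quad_nonunit_e[OF ab(4)] by blast
  obtain m3 n3 where 3: "quad_act c quad_e = quad_act var_y m3 + quad_act var_x n3"
    using quad_nonunit_e[OF c0] by blast
  have "\<exists>p q. (quad_e :: 'k quad) = quad_act var_y p + quad_act var_x q"
  proof (rule regular_sequence_exchange[OF quad_module _ _ _ _ _ 1 2 3])
    show "v = 0" if "quad_act a v = 0" for v using ab(5) that by (simp add: quad_nzd)
    show "\<exists>u. v = quad_act a u" if "quad_act b v = quad_act a w" for v w
      using ab(6) that unfolding quad_nzd_mod by blast
  qed (fact quad_y_regular quad_x_regular c_quad)+
  thus False using quad_e_not_mem by blast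
qed

lemma quad_maximal_CM: "maximal_CM E8_ring M"
proof -
  have "module_depth E8_ring M = 2"
  proof (rule antisym)
    show "module_depth E8_ring M \<le> 2"
      unfolding module_depth_def numeral_eq_enat using quad_depth_le by (intro SUP_least) auto
    show "2 \<le> module_depth E8_ring M"
      unfolding module_depth_def using quad_xy_regular
      by (intro SUP_upper2[of "[E8_class var_y, E8_class var_x]"]) (auto simp: numeral_eq_enat)
  qed
  moreover have "\<beta> quad_e \<noteq> \<zero>\<^bsub>M\<^esub>" by (simp add: \<beta>_0[symmetric] quad_e_def zero_prod_def)
  hence "carrier M \<noteq> {\<zero>\<^bsub>M\<^esub>}" using \<beta>_closed by blast
  ultimately show ?thesis
    using quad_fin_gen module_axioms by (simp add: maximal_CM_def krull_dim_E8)
qed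

text \<open>For an \<open>R\<close>-linear \<open>f\<close>, the element \<open>z f(m) = f(z m)\<close> lies in \<open>(x, y\<^sup>2) R\<close>.  The coefficient at \<open>z\<close>
  of \<open>z f(m)\<close> is the \<open>S\<close>-part of \<open>f(m)\<close>.\<close>

lemma quad_test_ideal:
  assumes J: "ideal J E8_ring" and mem: "E8_class var_x \<in> J" "E8_class (var_y\<^sup>2) \<in> J" "E8_class var_z \<in> J"
  shows "test_ideal E8_ring M \<subseteq> J"
  unfolding test_ideal_def
proof (rule R.genideal_minimal[OF J], rule UN_least, rule image_subsetI)
  fix f m assume f: "f \<in> module_hom E8_ring M (regular_module E8_ring)" and m: "m \<in> carrier M"
  have f_closed: "f n \<in> carrier E8_ring" if "n \<in> carrier M" for n
    using module_hom_closed[OF f that] by (simp add: regular_module_simps)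
  have f_add: "f (u \<oplus>\<^bsub>M\<^esub> v) = f u \<oplus>\<^bsub>E8_ring\<^esub> f v" if "u \<in> carrier M" "v \<in> carrier M" for u v
    using f that by (simp add: module_hom_def regular_module_simps)
  have f_act: "f (act h u) = E8_class h \<otimes>\<^bsub>E8_ring\<^esub> f u" if "u \<in> carrier M" for h u
    using f that by (simp add: module_hom_def regular_module_simps act_def)
  define T where "T = E8_class -` J"
  have T: "is_ideal T" unfolding T_def by (rule pullback_ideal[OF J])
  have T_mem: "var_x \<in> T" "var_y\<^sup>2 \<in> T" "var_z \<in> T" using mem by (simp_all add: T_def)
  obtain v where v: "m = \<beta> v" using \<beta>_surj m by blast
  obtain u w where uw: "quad_act var_z v = quad_act var_x u + quad_act (var_y\<^sup>2) w"
    using quad_z_image by blast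
  have f_range: "f n \<in> range E8_class" if "n \<in> carrier M" for n
    using f_closed[OF that] unfolding E8_carrier .
  obtain h where h: "f m = E8_class h" using f_range[OF m] by (rule rangeE)
  obtain h1 where h1: "f (\<beta> u) = E8_class h1" using f_range[OF \<beta>_closed] by (rule rangeE)
  obtain h2 where h2: "f (\<beta> w) = E8_class h2" using f_range[OF \<beta>_closed] by (rule rangeE)
  have "E8_class (var_z * h) = f (act var_z m)" using f_act[OF m] by (simp add: h E8_class_mult)
  also have "act var_z m = act var_x (\<beta> u) \<oplus>\<^bsub>M\<^esub> act (var_y\<^sup>2) (\<beta> w)"
    unfolding v \<beta>_act[symmetric] uw \<beta>_add ..
  also have "f \<dots> = E8_class (var_x * h1 + var_y\<^sup>2 * h2)"
    by (simp add: f_add f_act h1 h2 E8_class_add E8_class_mult)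
  finally have "e8_coords (var_z * h) = e8_coords (var_x * h1 + var_y\<^sup>2 * h2)"
    unfolding E8_class_eq_iff_coords .
  hence re: "e8_re h = fps_const fps_X * e8_im h1 + fps_X ^ 2 * e8_im h2"
    by (simp add: power2_eq_square)
  have "e8_rep (e8_re h) (e8_im h)
      = fps_const (e8_im h1) * var_x + fps_const (e8_im h2) * var_y\<^sup>2 + fps_const (e8_im h) * var_z"
    unfolding re by (simp add: e8_rep_def var_x_def var_y_def var_z_def fps_const_add[symmetric]
          fps_const_mult[symmetric] fps_const_power[symmetric] mult.commute
          del: fps_const_add fps_const_mult fps_const_power)
  also have "\<dots> \<in> T" by (intro is_idealD(2,3)[OF T] T_mem)
  finally show "f m \<in> J" unfolding h E8_class_coords[of h] by (simp add: T_def)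
qed

end

text \<open>A class acts through any representative; \<open>quad_act\<close> depends on coordinates only.\<close>

definition quad_smult :: "'k::field fps3 set \<Rightarrow> 'k quad \<Rightarrow> 'k quad" where
  "quad_smult r = quad_act (SOME h. E8_class h = r)"

definition quad_record :: "('k::field fps3 set, 'k quad) module" where
  "quad_record = \<lparr>carrier = UNIV, monoid.mult = (\<lambda>_ _. 0), one = 0, ring.zero = 0,
    ring.add = (+), module.smult = quad_smult\<rparr>"

lemma quad_smult_class: "quad_smult (E8_class h) v = quad_act h v"
  unfolding quad_smult_def by (rule quad_act_cong) (rule someI[of "\<lambda>f. E8_class f = E8_class h"], rule refl)

lemma quad_record_module: "module E8_ring (quad_record :: ('k::field fps3 set, 'k quad) module)"
proof (rule moduleI)
  show "abelian_group (quad_record :: ('k fps3 set, 'k quad) module)"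
  proof (rule abelian_groupI)
    fix v :: "'k quad"
    show "\<exists>u\<in>carrier quad_record. u \<oplus>\<^bsub>quad_record\<^esub> v = \<zero>\<^bsub>quad_record\<^esub>"
      by (intro bexI[of _ "- v"]) (simp_all add: quad_record_def)
  qed (simp_all add: quad_record_def add_ac)
next
  have smult: "E8_class h \<odot>\<^bsub>quad_record\<^esub> v = quad_act h v" for h and v :: "'k quad"
    by (simp add: quad_record_def quad_smult_class)
  have add: "u \<oplus>\<^bsub>quad_record\<^esub> v = u + v" for u v :: "'k quad" by (simp add: quad_record_def)
  fix r s u v
  assume "r \<in> carrier (E8_ring :: 'k fps3 set ring)" "s \<in> carrier (E8_ring :: 'k fps3 set ring)"
  then obtain f g where fg: "r = E8_class f" "s = E8_class g" by (auto simp: E8_carrier)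
  show "(r \<oplus>\<^bsub>E8_ring\<^esub> s) \<odot>\<^bsub>quad_record\<^esub> v = r \<odot>\<^bsub>quad_record\<^esub> v \<oplus>\<^bsub>quad_record\<^esub> s \<odot>\<^bsub>quad_record\<^esub> v"
    by (simp only: fg E8_class_add[symmetric] smult add quad_act_add_left)
  show "(r \<otimes>\<^bsub>E8_ring\<^esub> s) \<odot>\<^bsub>quad_record\<^esub> v = r \<odot>\<^bsub>quad_record\<^esub> (s \<odot>\<^bsub>quad_record\<^esub> v)"
    by (simp only: fg E8_class_mult[symmetric] smult quad_act_mult)
next
  have smult: "E8_class h \<odot>\<^bsub>quad_record\<^esub> v = quad_act h v" for h and v :: "'k quad"
    by (simp add: quad_record_def quad_smult_class)
  have add: "u \<oplus>\<^bsub>quad_record\<^esub> v = u + v" for u v :: "'k quad" by (simp add: quad_record_def)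
  fix u v :: "'k quad"
  show "r \<odot>\<^bsub>quad_record\<^esub> (u \<oplus>\<^bsub>quad_record\<^esub> v) = r \<odot>\<^bsub>quad_record\<^esub> u \<oplus>\<^bsub>quad_record\<^esub> r \<odot>\<^bsub>quad_record\<^esub> v"
    if r: "r \<in> carrier E8_ring" for r
  proof -
    obtain f where "r = E8_class f" using r by (auto simp: E8_carrier)
    thus ?thesis by (simp only: smult add quad_act_add)
  qed
  show "\<one>\<^bsub>E8_ring\<^esub> \<odot>\<^bsub>quad_record\<^esub> v = v"
    by (simp only: E8_class_one[symmetric] smult quad_act_1)
qed (simp_all add: E8_cring quad_record_def)

lemma quad_record_simps:
  "carrier quad_record = UNIV" "u \<oplus>\<^bsub>quad_record\<^esub> v = u + v"
  "E8_class h \<odot>\<^bsub>quad_record\<^esub> v = quad_act h v"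
  by (simp_all add: quad_record_def quad_smult_class)

lemma quad_copyI:
  assumes "module E8_ring M" "bij_betw \<beta> UNIV (carrier M)"
    and "\<And>u v. \<beta> (u + v) = \<beta> u \<oplus>\<^bsub>M\<^esub> \<beta> v"
    and "\<And>h v. \<beta> (quad_act h v) = E8_class h \<odot>\<^bsub>M\<^esub> \<beta> v"
  shows "quad_copy M \<beta>"
proof -
  have M: "e8_module M" unfolding e8_module_def by (rule assms(1))
  show ?thesis
    by (intro quad_copy.intro quad_copy_axioms.intro M assms(2,3))
       (simp only: e8_module.act_def[OF M] assms(4))
qed

lemma exists_quad_MCM:
  "\<exists>N :: ('k::field fps3 set, (nat \<Rightarrow> 'k fps3 set) set) module. maximal_CM E8_ring N \<and>
    test_ideal E8_ring N \<subseteq> Idl\<^bsub>E8_ring\<^esub> {E8_class var_x, E8_class (var_y\<^sup>2), E8_class var_z}"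
proof -
  have "quad_copy (quad_record :: ('k fps3 set, 'k quad) module) (\<lambda>v. v)"
    by (rule quad_copyI[OF quad_record_module]) (simp_all only: quad_record_simps bij_betw_id[unfolded id_def])
  from fin_gen_module_copy[OF quad_record_module quad_copy.quad_fin_gen[OF this]]
  obtain N :: "('k fps3 set, (nat \<Rightarrow> 'k fps3 set) set) module" and f where N: "module E8_ring N"
    and f: "f \<in> module_hom E8_ring quad_record N" "bij_betw f (carrier quad_record) (carrier N)"
    by blast
  have copy: "quad_copy N f"
  proof (rule quad_copyI[OF N])
    show "bij_betw f UNIV (carrier N)" using f(2) by (simp only: quad_record_simps)
    show "f (u + v) = f u \<oplus>\<^bsub>N\<^esub> f v" for u v
      using f(1) unfolding module_hom_def quad_record_simps by blast
    show "f (quad_act h v) = E8_class h \<odot>\<^bsub>N\<^esub> f v" for h v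
    proof -
      have "\<forall>a\<in>carrier E8_ring. \<forall>u\<in>carrier quad_record. f (a \<odot>\<^bsub>quad_record\<^esub> u) = a \<odot>\<^bsub>N\<^esub> f u"
        using f(1) unfolding module_hom_def by blast
      from this[rule_format, OF E8_class_closed, of v h]
      have "f (E8_class h \<odot>\<^bsub>quad_record\<^esub> v) = E8_class h \<odot>\<^bsub>N\<^esub> f v"
        by (simp only: quad_record_simps UNIV_I True_implies_equals)
      thus ?thesis by (simp only: quad_record_simps)
    qed
  qed
  interpret cring "E8_ring :: 'k fps3 set ring" by (rule E8_cring)
  define G :: "'k fps3 set set" where "G = {E8_class var_x, E8_class (var_y\<^sup>2), E8_class var_z}"
  have sub: "G \<subseteq> carrier E8_ring" by (simp add: G_def)
  have "E8_class var_x \<in> Idl\<^bsub>E8_ring\<^esub> G" "E8_class (var_y\<^sup>2) \<in> Idl\<^bsub>E8_ring\<^esub> G"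
    "E8_class var_z \<in> Idl\<^bsub>E8_ring\<^esub> G"
    using genideal_self[OF sub] by (simp_all add: G_def)
  from quad_copy.quad_test_ideal[OF copy genideal_ideal[OF sub] this]
  show ?thesis unfolding G_def[symmetric] using quad_copy.quad_maximal_CM[OF copy] by blast
qed

theorem proposition6p11:
  fixes R :: "'k::alg_closed_field fps3 set ring"
    and x y z :: "'k fps3 set"
  assumes char: "CHAR('k) \<notin> {2, 3, 5}"
    and R: "R = E8_ring"
    and xyz: "x = E8_class var_x" "y = E8_class var_y" "z = E8_class var_z"
  shows "test_ideal_MCM R = Idl\<^bsub>R\<^esub> {x, y [^]\<^bsub>R\<^esub> (2::nat), z}"
proof -
  interpret cring "E8_ring :: 'k fps3 set ring" by (rule E8_cring)
  define J where "J = Idl\<^bsub>E8_ring\<^esub> {E8_class var_x, E8_class (var_y\<^sup>2), E8_class (var_z :: 'k fps3)}"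
  have gens: "{x, y [^]\<^bsub>R\<^esub> (2::nat), z} = {E8_class var_x, E8_class (var_y\<^sup>2), E8_class var_z}"
    by (simp add: R xyz E8_class_pow)
  have "J \<subseteq> test_ideal E8_ring M" if "maximal_CM E8_ring M" for M :: "('k fps3 set, (nat \<Rightarrow> 'k fps3 set) set) module"
  proof -
    have M: "e8_module M" unfolding e8_module_def using that by (simp add: maximal_CM_def)
    show ?thesis unfolding J_def
      using e8_module.test_ideal_contains[OF M that]
      by (intro genideal_minimal[OF e8_module.test_ideal_ideal[OF M]]) simp
  qed
  moreover have "J \<subseteq> carrier E8_ring"
    unfolding J_def by (rule genideal_minimal[OF oneideal]) auto
  moreover obtain N :: "('k fps3 set, (nat \<Rightarrow> 'k fps3 set) set) module" where
    "maximal_CM E8_ring N" "test_ideal E8_ring N \<subseteq> J" unfolding J_def using exists_quad_MCM by blast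
  ultimately have "test_ideal_MCM E8_ring = J"
    unfolding test_ideal_MCM_def by blast
  thus ?thesis unfolding gens unfolding R J_def .
qed

end
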